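(* There exists an optimal randomized feedback policy for the CMKV-MDP, i.e. a measurable function $\mathfrak a_0:\mathcal P(\mathcal X)\times\mathcal X\times[0,1]\to A$ such that $$\mathbb T^{\mathfrak a_0(\mu,\cdot)}V(\mu)=V(\mu)\qquad\text{for all }\mu\in\mathcal P(\mathcal X),$$ and, for every $\mu_0\in\mathcal P(\mathcal X)$ and every $\mathcal G$-measurable $\xi_0\sim\mu_0$, the randomized feedback control $\alpha^0\in\mathcal A$ defined by $\alpha^0_t=\mathfrak a_0(\mathbb P^0_{X_t},X_t,U_t)$, $t\in\mathbb N$, is optimal for $V(\mu_0)$, i.e. $V^{\alpha^0}(\xi_0)=V(\mu_0)$.
   Context: **Spaces and noises.** $(\mathcal X,d)$ and $(A,d_A)$ are compact Polish (metric) spaces; $\mathcal X\times A$ has the metric $\mathbf d((x,a),(x',a'))=d(x,x')+d_A(a,a')$. $\mathcal P(Y)$ is the set of Borel probability measures on a compact metric space $Y$, with the Wasserstein distance $\mathcal W_\rho(\mu,\mu')=\inf_{\boldsymbol\mu}\int\rho(y,y')\,\boldsymbol\mu(dy,dy')$ (infimum over couplings of $\mu,\mu'$) when $Y$ has metric $\rho$. $\mathcal L(Y)$ is the law of $Y$; $\mathcal U([0,1])$ is the uniform law. On a probability space: $(\varepsilon_t)_{t\in\mathbb N^\star}$ are i.i.d. with values in a measurable space $E$; $(\varepsilon^0_t)_{t\in\mathbb N^\star}$ are i.i.d. with values in a measurable space $E^0$ (common noise); $(U_t)_{t\in\mathbb N}$ are i.i.d. uniform on $[0,1]$; $\mathcal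 G$ is a $\sigma$-algebra, rich enough that every $\mu_0\in\mathcal P(\mathcal X)$ is the law of a $\mathcal G$-measurable random variable; $\mathcal G,(U_t),(\varepsilon_t),(\varepsilon^0_t)$ are independent. **Data and standing assumptions.** $\beta\in(0,1)$; $F:\mathcal X\times A\times\mathcal P(\mathcal X\times A)\times E\times E^0\to\mathcal X$ is measurable; $f:\mathcal X\times A\times\mathcal P(\mathcal X\times A)\to\mathbb R$ is bounded measurable; there are $K_F,K_f>0$ such that for all $x,x'\in\mathcal X$, $a,a'\in A$, $\mu,\mu'\in\mathcal P(\mathcal X\times A)$, $e^0\in E^0$: $$\mathbb E\big[d(F(x,a,\mu,\varepsilon_1,e^0),F(x',a',\mu',\varepsilon_1,e^0))\big]\le K_F\big(\mathbf d((x,a),(x',a'))+\mathcal W_{\mathbf d}(\mu,\mu')\big),$$ $$|f(x,a,\mu)-f(x',a',\mu')|\le K_f\big(\mathbf d((x,a),(x',a'))+\mathcal W_{\mathbf d}(\mu,\mu')\big).$$ **Mean-field problem (CMKV-MDP).** $\mathcal A$ is the set of $A$-valued processes adapted to the filtration generated by $\mathcal G,(U_t),(\varepsilon_t),(\varepsilon^0_t)$. $\mathbb P^0_Y$ is the conditional law of $Y$ given $\varepsilon^0=(\varepsilon^0_t)_t$. For $\mathcal G$-measurable $\xi_0$ of law $\mu_0$ and $\alpha\in\mathcal A$: $X_0=\xi_0$, $X_{t+1}=F(X_t,\alpha_t,\mathbb P^0_{(X_t,\alpha_t)},\varepsilon_{t+1},\varepsilon^0_{t+1})$, $V^\alpha(\xi_0)=\mathbb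 E\big[\sum_{t=0}^\infty\beta^tf(X_t,\alpha_t,\mathbb P^0_{(X_t,\alpha_t)})\big]$, $V(\xi_0)=\sup_{\alpha\in\mathcal A}V^\alpha(\xi_0)$. It is known that $V(\xi_0)$ depends on $\xi_0$ only through $\mu_0$, and one writes $V(\mu_0)$. **Bellman operator.** For measurable $\mathrm a:\mathcal X\times[0,1]\to A$, bounded measurable $W:\mathcal P(\mathcal X)\to\mathbb R$ and $\mu\in\mathcal P(\mathcal X)$, $$\mathbb T^{\mathrm a}W(\mu)=\mathbb E\Big[f(\xi,\mathrm a(\xi,U),\mathcal L(\xi,\mathrm a(\xi,U)))+\beta W\big(\mathbb P^0_{F(\xi,\mathrm a(\xi,U),\mathcal L(\xi,\mathrm a(\xi,U)),\varepsilon_1,\varepsilon^0_1)}\big)\Big],$$ with $(\xi,U)\sim\mu\otimes\mathcal U([0,1])$ independent of $(\varepsilon_1,\varepsilon^0_1)$. *)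

theory Defs
  imports "HOL-Probability.Probability"
begin

section \<open>Wasserstein distance\<close>

abbreviation Prob :: "'y::topological_space measure set" where
  "Prob \<equiv> space (prob_algebra borel)"

definition couplings :: "'y measure \<Rightarrow> 'y measure \<Rightarrow> ('y \<times> 'y) measure set" where
  "couplings \<mu> \<nu> =
     {\<gamma> \<in> space (prob_algebra (\<mu> \<Otimes>\<^sub>M \<nu>)). distr \<gamma> \<mu> fst = \<mu> \<and> distr \<gamma> \<nu> snd = \<nu>}"

text \<open>Off \<^const>\<open>Prob\<close> the value is irrelevant; it is set to 0 because \<^locale>\<open>Metric_space\<close>
  requires nonnegativity and symmetry on the whole type.\<close>
definition wasserstein ::
    "('y \<Rightarrow> 'y \<Rightarrow> real) \<Rightarrow> 'y::topological_space measure \<Rightarrow> 'y measure \<Rightarrow> real" where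
  "wasserstein \<rho> \<mu> \<nu> =
     (if \<mu> \<in> Prob \<and> \<nu> \<in> Prob
      then INF \<gamma>\<in>couplings \<mu> \<nu>. \<integral>p. \<rho> (fst p) (snd p) \<partial>\<gamma>
      else 0)"

text \<open>Borel \<open>\<sigma>\<close>-algebra of the metric space of probability measures under the Wasserstein distance.\<close>
definition wass_borel :: "('y \<Rightarrow> 'y \<Rightarrow> real) \<Rightarrow> 'y::topological_space measure measure" where
  "wass_borel \<rho> =
     sigma Prob {B. openin (Metric_space.mtopology Prob (wasserstein \<rho>)) B}"

text \<open>The library metric on a product type is the Euclidean combination; the sum is used here.\<close>
definition sum_dist :: "'x::metric_space \<times> 'a::metric_space \<Rightarrow> 'x \<times> 'a \<Rightarrow> real" where
  "sum_dist p q = dist (fst p) (fst q) + dist (snd p) (snd q)"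

abbreviation unif :: "real measure" where
  "unif \<equiv> restrict_space lborel {0..1}"


section \<open>Data of the control problem\<close>

text \<open>\<open>prb\<close> is the underlying probability space, \<open>init\<close> the \<open>\<sigma>\<close>-algebra of initial information
  (a measure of which only the space and the measurable sets matter), \<open>noise t\<close> and
  \<open>common t\<close> the idiosyncratic and common noises, indexed by \<open>t \<ge> 1\<close> (the value at \<open>0\<close> is never
  used), with values in \<open>nsp\<close> and \<open>csp\<close>, and \<open>rnd t\<close>, \<open>t \<ge> 0\<close>, the randomization variables.\<close>
record ('w, 'x, 'a, 'e, 'e0) mkv_data =
  prb :: "'w measure"
  init :: "'w measure"
  nsp :: "'e measure"
  csp :: "'e0 measure"
  noise :: "nat \<Rightarrow> 'w \<Rightarrow> 'e"
  common :: "nat \<Rightarrow> 'w \<Rightarrow> 'e0"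
  rnd :: "nat \<Rightarrow> 'w \<Rightarrow> real"
  disc :: real
  trans_fun :: "'x \<Rightarrow> 'a \<Rightarrow> ('x \<times> 'a) measure \<Rightarrow> 'e \<Rightarrow> 'e0 \<Rightarrow> 'x"
  reward :: "'x \<Rightarrow> 'a \<Rightarrow> ('x \<times> 'a) measure \<Rightarrow> real"

definition gen_sigma :: "'w set \<Rightarrow> 'b measure \<Rightarrow> (nat \<Rightarrow> 'w \<Rightarrow> 'b) \<Rightarrow> nat set \<Rightarrow> 'w measure" where
  "gen_sigma \<Omega> N Y I = sigma \<Omega> (\<Union>i\<in>I. sets (vimage_algebra \<Omega> (Y i) N))"

definition rnd_sigma :: "('w, 'x, 'a, 'e, 'e0) mkv_data \<Rightarrow> nat set \<Rightarrow> 'w measure" where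
  "rnd_sigma S I = gen_sigma (space (prb S)) unif (rnd S) I"

definition noise_sigma :: "('w, 'x, 'a, 'e, 'e0) mkv_data \<Rightarrow> nat set \<Rightarrow> 'w measure" where
  "noise_sigma S I = gen_sigma (space (prb S)) (nsp S) (noise S) I"

definition common_sigma :: "('w, 'x, 'a, 'e, 'e0) mkv_data \<Rightarrow> nat set \<Rightarrow> 'w measure" where
  "common_sigma S I = gen_sigma (space (prb S)) (csp S) (common S) I"

locale cmkv_mdp = prob_space "prb S"
  for S :: "('w, 'x::polish_space, 'a::polish_space, 'e, 'e0) mkv_data" +
  assumes compact_state: "compact (UNIV :: 'x set)"
    and compact_action: "compact (UNIV :: 'a set)"
    and init_subalgebra: "subalgebra (prb S) (init S)"
    and init_rich:
      "\<And>\<mu>. \<mu> \<in> (Prob :: 'x measure set) \<Longrightarrow> \<exists>\<xi> \<in> init S \<rightarrow>\<^sub>M borel. distr (prb S) borel \<xi> = \<mu>"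
    and noise_indep: "indep_vars (\<lambda>_. nsp S) (noise S) {1..}"
    and noise_ident: "\<And>t. 1 \<le> t \<Longrightarrow> distr (prb S) (nsp S) (noise S t) = distr (prb S) (nsp S) (noise S 1)"
    and common_indep: "indep_vars (\<lambda>_. csp S) (common S) {1..}"
    and common_ident: "\<And>t. 1 \<le> t \<Longrightarrow> distr (prb S) (csp S) (common S t) = distr (prb S) (csp S) (common S 1)"
    and rnd_indep: "indep_vars (\<lambda>_. unif) (rnd S) UNIV"
    and rnd_uniform: "\<And>t. distr (prb S) unif (rnd S t) = unif"
    and sources_indep:
      "indep_sets
         (\<lambda>i::nat. [sets (init S), sets (rnd_sigma S UNIV),
                    sets (noise_sigma S {1..}), sets (common_sigma S {1..})] ! i) {..<4}"
    and disc: "0 < disc S" "disc S < 1"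
    and trans_measurable:
      "(\<lambda>(x, a, \<mu>, e, e0). trans_fun S x a \<mu> e e0)
         \<in> borel \<Otimes>\<^sub>M borel \<Otimes>\<^sub>M wass_borel sum_dist \<Otimes>\<^sub>M nsp S \<Otimes>\<^sub>M csp S \<rightarrow>\<^sub>M borel"
    and reward_measurable:
      "(\<lambda>(x, a, \<mu>). reward S x a \<mu>) \<in> borel \<Otimes>\<^sub>M borel \<Otimes>\<^sub>M wass_borel sum_dist \<rightarrow>\<^sub>M borel"
    and reward_bounded: "\<exists>C. \<forall>x a. \<forall>\<mu>\<in>Prob. \<bar>reward S x a \<mu>\<bar> \<le> C"
    and trans_lipschitz:
      "\<exists>K>0. \<forall>x x' a a'. \<forall>\<mu>\<in>Prob. \<forall>\<mu>'\<in>Prob. \<forall>e0\<in>space (csp S).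
         expectation (\<lambda>\<omega>. dist (trans_fun S x a \<mu> (noise S 1 \<omega>) e0)
                              (trans_fun S x' a' \<mu>' (noise S 1 \<omega>) e0))
           \<le> K * (sum_dist (x, a) (x', a') + wasserstein sum_dist \<mu> \<mu>')"
    and reward_lipschitz:
      "\<exists>K>0. \<forall>x x' a a'. \<forall>\<mu>\<in>Prob. \<forall>\<mu>'\<in>Prob.
         \<bar>reward S x a \<mu> - reward S x' a' \<mu>'\<bar>
           \<le> K * (sum_dist (x, a) (x', a') + wasserstein sum_dist \<mu> \<mu>')"


section \<open>Controls, conditional laws and value\<close>

definition filt :: "('w, 'x, 'a, 'e, 'e0) mkv_data \<Rightarrow> nat \<Rightarrow> 'w measure" where
  "filt S t =
     sigma (space (prb S))
       (sets (init S) \<union> sets (rnd_sigma S {0..t})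
        \<union> sets (noise_sigma S {1..t}) \<union> sets (common_sigma S {1..t}))"

definition controls ::
    "('w, 'x, 'a::topological_space, 'e, 'e0) mkv_data \<Rightarrow> (nat \<Rightarrow> 'w \<Rightarrow> 'a) set" where
  "controls S = {\<alpha>. \<forall>t. \<alpha> t \<in> filt S t \<rightarrow>\<^sub>M borel}"

definition is_cond_law ::
    "'w measure \<Rightarrow> 'w measure \<Rightarrow> ('w \<Rightarrow> 'y::topological_space) \<Rightarrow> ('w \<Rightarrow> 'y measure) \<Rightarrow> bool" where
  "is_cond_law M H Y \<kappa> \<longleftrightarrow>
     \<kappa> \<in> H \<rightarrow>\<^sub>M prob_algebra borel \<and>
     (\<forall>B\<in>sets borel. AE \<omega> in M.
        measure (\<kappa> \<omega>) B = real_cond_exp M H (indicator (Y -` B \<inter> space M)) \<omega>)"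

text \<open>A version of the conditional law of \<open>Y\<close> given the whole common noise \<open>(\<epsilon>\<^sup>0\<^sub>s)\<^sub>s\<close>.
  Conditional laws are determined almost surely only. For \<open>Y\<close> measurable with respect to
  \<open>filt S t\<close> there is a version that depends on \<open>\<epsilon>\<^sup>0\<^sub>1, \<dots>, \<epsilon>\<^sup>0\<^sub>t\<close> only, and such a version is chosen:
  otherwise a control that is a function of the conditional law would be adapted up to null
  sets only.\<close>
definition cond_law ::
    "('w, 'x, 'a, 'e, 'e0) mkv_data \<Rightarrow> nat \<Rightarrow> ('w \<Rightarrow> 'y::topological_space) \<Rightarrow> 'w \<Rightarrow> 'y measure" where
  "cond_law S t Y =
     (SOME \<kappa>. is_cond_law (prb S) (common_sigma S {1..}) Y \<kappa>
            \<and> \<kappa> \<in> common_sigma S {1..t} \<rightarrow>\<^sub>M prob_algebra borel)"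

definition joint_cond_law ::
    "('w, 'x::topological_space, 'a::topological_space, 'e, 'e0) mkv_data \<Rightarrow> nat
      \<Rightarrow> ('w \<Rightarrow> 'x) \<Rightarrow> ('w \<Rightarrow> 'a) \<Rightarrow> 'w \<Rightarrow> ('x \<times> 'a) measure" where
  "joint_cond_law S t X \<alpha> = cond_law S t (\<lambda>\<omega>. (X \<omega>, \<alpha> \<omega>))"

definition step ::
    "('w, 'x::topological_space, 'a::topological_space, 'e, 'e0) mkv_data \<Rightarrow> nat
      \<Rightarrow> ('w \<Rightarrow> 'x) \<Rightarrow> ('w \<Rightarrow> 'a) \<Rightarrow> 'w \<Rightarrow> 'x" where
  "step S t X \<alpha> \<omega> =
     trans_fun S (X \<omega>) (\<alpha> \<omega>) (joint_cond_law S t X \<alpha> \<omega>) (noise S (Suc t) \<omega>) (common S (Suc t) \<omega>)"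

primrec state ::
    "('w, 'x::topological_space, 'a::topological_space, 'e, 'e0) mkv_data
      \<Rightarrow> (nat \<Rightarrow> 'w \<Rightarrow> 'a) \<Rightarrow> ('w \<Rightarrow> 'x) \<Rightarrow> nat \<Rightarrow> 'w \<Rightarrow> 'x" where
  "state S \<alpha> \<xi> 0 = \<xi>"
| "state S \<alpha> \<xi> (Suc t) = step S t (state S \<alpha> \<xi> t) (\<alpha> t)"

definition gain ::
    "('w, 'x::topological_space, 'a::topological_space, 'e, 'e0) mkv_data
      \<Rightarrow> (nat \<Rightarrow> 'w \<Rightarrow> 'a) \<Rightarrow> ('w \<Rightarrow> 'x) \<Rightarrow> real" where
  "gain S \<alpha> \<xi> =
     (\<integral>\<omega>. (\<Sum>t. disc S ^ t *
        reward S (state S \<alpha> \<xi> t \<omega>) (\<alpha> t \<omega>) (joint_cond_law S t (state S \<alpha> \<xi> t) (\<alpha> t) \<omega>)) \<partial>prb S)"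

definition value_at ::
    "('w, 'x::topological_space, 'a::topological_space, 'e, 'e0) mkv_data \<Rightarrow> ('w \<Rightarrow> 'x) \<Rightarrow> real" where
  "value_at S \<xi> = (SUP \<alpha>\<in>controls S. gain S \<alpha> \<xi>)"

definition initial_states ::
    "('w, 'x::topological_space, 'a, 'e, 'e0) mkv_data \<Rightarrow> 'x measure \<Rightarrow> ('w \<Rightarrow> 'x) set" where
  "initial_states S \<mu> = {\<xi> \<in> init S \<rightarrow>\<^sub>M borel. distr (prb S) borel \<xi> = \<mu>}"

text \<open>The common value of \<open>\<Phi> \<xi>\<close> over all initial states \<open>\<xi>\<close> of law \<open>\<mu>\<close>, for \<open>\<Phi>\<close> depending on
  \<open>\<xi>\<close> only through its law.\<close>
definition on_law ::
    "('w, 'x::topological_space, 'a, 'e, 'e0) mkv_data \<Rightarrow> (('w \<Rightarrow> 'x) \<Rightarrow> real) \<Rightarrow> 'x measure \<Rightarrow> real" where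
  "on_law S \<Phi> \<mu> = (THE v. \<forall>\<xi>\<in>initial_states S \<mu>. \<Phi> \<xi> = v)"

definition value_law ::
    "('w, 'x::topological_space, 'a::topological_space, 'e, 'e0) mkv_data \<Rightarrow> 'x measure \<Rightarrow> real" where
  "value_law S = on_law S (value_at S)"


section \<open>Bellman operator\<close>

text \<open>The pair \<open>(\<xi>, U)\<close> is realized on the given probability space by a \<open>init S\<close>-measurable \<open>\<xi>\<close>
  of law \<open>\<mu>\<close> and \<open>U = rnd S 0\<close>; it has law \<open>\<mu> \<otimes> unif\<close> and is independent of the noises.\<close>
definition bellman_at ::
    "('w, 'x::topological_space, 'a::topological_space, 'e, 'e0) mkv_data
      \<Rightarrow> ('x \<Rightarrow> real \<Rightarrow> 'a) \<Rightarrow> ('x measure \<Rightarrow> real) \<Rightarrow> ('w \<Rightarrow> 'x) \<Rightarrow> real" where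
  "bellman_at S a W \<xi> =
     (let A = (\<lambda>\<omega>. a (\<xi> \<omega>) (rnd S 0 \<omega>));
          L = distr (prb S) borel (\<lambda>\<omega>. (\<xi> \<omega>, A \<omega>));
          Y = (\<lambda>\<omega>. trans_fun S (\<xi> \<omega>) (A \<omega>) L (noise S 1 \<omega>) (common S 1 \<omega>))
      in \<integral>\<omega>. reward S (\<xi> \<omega>) (A \<omega>) L + disc S * W (cond_law S 1 Y \<omega>) \<partial>prb S)"

definition bellman ::
    "('w, 'x::topological_space, 'a::topological_space, 'e, 'e0) mkv_data
      \<Rightarrow> ('x \<Rightarrow> real \<Rightarrow> 'a) \<Rightarrow> ('x measure \<Rightarrow> real) \<Rightarrow> 'x measure \<Rightarrow> real" where
  "bellman S a W = on_law S (bellman_at S a W)"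


section \<open>Randomized feedback controls\<close>

definition feedback_action ::
    "('w, 'x::topological_space, 'a, 'e, 'e0) mkv_data
      \<Rightarrow> ('x measure \<times> 'x \<times> real \<Rightarrow> 'a) \<Rightarrow> nat \<Rightarrow> ('w \<Rightarrow> 'x) \<Rightarrow> 'w \<Rightarrow> 'a" where
  "feedback_action S \<aa> t X \<omega> = \<aa> (cond_law S t X \<omega>, X \<omega>, rnd S t \<omega>)"

primrec feedback_state ::
    "('w, 'x::topological_space, 'a::topological_space, 'e, 'e0) mkv_data
      \<Rightarrow> ('x measure \<times> 'x \<times> real \<Rightarrow> 'a) \<Rightarrow> ('w \<Rightarrow> 'x) \<Rightarrow> nat \<Rightarrow> 'w \<Rightarrow> 'x" where
  "feedback_state S \<aa> \<xi> 0 = \<xi>"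
| "feedback_state S \<aa> \<xi> (Suc t) =
     step S t (feedback_state S \<aa> \<xi> t) (feedback_action S \<aa> t (feedback_state S \<aa> \<xi> t))"

definition feedback_control ::
    "('w, 'x::topological_space, 'a::topological_space, 'e, 'e0) mkv_data
      \<Rightarrow> ('x measure \<times> 'x \<times> real \<Rightarrow> 'a) \<Rightarrow> ('w \<Rightarrow> 'x) \<Rightarrow> nat \<Rightarrow> 'w \<Rightarrow> 'a" where
  "feedback_control S \<aa> \<xi> t = feedback_action S \<aa> t (feedback_state S \<aa> \<xi> t)"

lemma state_feedback_control:
  "state S (feedback_control S \<aa> \<xi>) \<xi> t = feedback_state S \<aa> \<xi> t"
  by (induction t) (simp_all add: feedback_control_def)

lemma feedback_control_eq:
  "feedback_control S \<aa> \<xi> t \<omega> =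
     \<aa> (cond_law S t (state S (feedback_control S \<aa> \<xi>) \<xi> t) \<omega>,
         state S (feedback_control S \<aa> \<xi>) \<xi> t \<omega>, rnd S t \<omega>)"
  by (simp add: state_feedback_control) (simp add: feedback_control_def feedback_action_def)

end

theory Submission
  imports Defs
begin

text \<open>On the level of conditional laws given the common noise the problem is a Markov decision process
  on the compact metric space of probability measures: an action is a joint law \<open>\<gamma>\<close> on states and
  actions whose first marginal is the current law, the reward is \<open>\<integral>f(x, a, \<gamma>) d\<gamma>\<close>, and the next law is the
  law of \<open>F(x, a, \<gamma>, \<epsilon>, e\<^sup>0)\<close> for \<open>(x, a) \<sim> \<gamma>\<close>. Both are Lipschitz in \<open>\<gamma>\<close>, and nearby laws have nearby fibres, so
  the Bellman operator preserves uniform continuity and its fixed point \<open>W\<close> is continuous. An optimal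
  \<open>\<gamma>\<close> exists by compactness, is selected measurably, and is realized as the law of \<open>(x, \<aa>(\<mu>, x, U))\<close> by a jointly
  measurable disintegration (dyadic martingale along a subsequence that depends measurably on \<open>\<mu>\<close>)
  and a conditional quantile transform.

  Compact spaces are encoded in the real line by ternary expansions, so that Helly's and
  Skorohod's theorems yield compactness in the Wasserstein metric. Conditional laws given the common
  noise are computed on the diagonal: a variable adapted to two independent \<open>\<sigma>\<close>-algebras is
  \<open>g(\<omega>, \<omega>)\<close> with \<open>g\<close> measurable for their product, and its conditional law is that of \<open>g(\<cdot>, \<omega>)\<close>.
  The gain of any control is then at most \<open>W\<close> of the initial law, with equality for the feedback \<open>\<aa>\<close>,
  which also identifies \<open>W\<close> with the value.\<close>

section \<open>Encoding a compact metric space in the real line\<close>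

text \<open>Lipschitz continuity is not carried through the value iteration: one application of the
  lifted Bellman operator can multiply a Lipschitz constant by a factor of the order of
  \<open>disc S\<close> times the constant of the transition, and this product may exceed 1. Uniform
  continuity survives both the operator and uniform limits, and it is enough to make sets of
  maximizers closed. Two \<sigma>-algebras on laws meet: coefficients and policy are measurable for
  the Borel sets of the Wasserstein metric, kernels and conditional laws for evaluation on events.
  On a compact space they coincide, and every composition of a policy with a conditional law rests
  on this. Conditional laws are chosen versions, so adaptedness is proved everywhere while their
  identification holds only almost surely; the two are kept apart throughout. The disintegration has
  to be measurable jointly in the law and the point, so it cannot be chosen law by law: the limit
  and the approximating subsequence are both explicit formulas in the law.\<close>

text \<open>By compactness finitely many basic sets of diameter below \<open>e\<close> cover the
  space. The bound \<open>n\<close> dominates their indices, so two points with the same memberships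
  up to \<open>n\<close> lie in a common one of them.\<close>

lemma compact_basis_separates:
  fixes B :: "nat \<Rightarrow> 'y::metric_space set"
  assumes comp: "compact (UNIV :: 'y set)" and B: "topological_basis (range B)" and e: "0 < e"
  shows "\<exists>n. \<forall>y y'. (\<forall>k\<le>n. y \<in> B k \<longleftrightarrow> y' \<in> B k) \<longrightarrow> dist y y' < e"
proof -
  have "\<exists>k. x \<in> B k \<and> B k \<subseteq> ball x (e/2)" for x
    using topological_basisE[OF B, of "ball x (e/2)" x] e by auto
  then obtain i where i: "\<And>x. x \<in> B (i x)" "\<And>x. B (i x) \<subseteq> ball x (e/2)"
    by metis
  have op: "open (B k)" for k
    using topological_basis_open[OF B] by auto
  obtain F where F: "finite F" "UNIV \<subseteq> (\<Union>x\<in>F. B (i x))"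
    using compactE_image[OF comp, of UNIV "\<lambda>x. B (i x)"] op i(1) by (metis UN_I UNIV_I subsetI)
  define n where "n = Max (insert 0 (i ` F))"
  show ?thesis
  proof (intro exI[of _ n] allI impI)
    fix y y' :: 'y assume agree: "\<forall>k\<le>n. y \<in> B k \<longleftrightarrow> y' \<in> B k"
    obtain x where x: "x \<in> F" "y \<in> B (i x)" using F by auto
    have "i x \<le> n" unfolding n_def using F x by (intro Max_ge) auto
    with agree x have "y' \<in> B (i x)" by auto
    then have "dist x y' < e/2" "dist x y < e/2" using i(2)[of x] x by auto
    then show "dist y y' < e" using dist_triangle_half_r by blast
  qed
qed

text \<open>The digits of \<theta> are the memberships in the basic sets. These memberships jump, so
  \<theta> is only measurable; the decoder is the continuous one, because close codes share many
  digits and hence, by the previous lemma, come from close points.\<close>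

lemma compact_encoding:
  assumes comp: "compact (UNIV :: 'y::polish_space set)"
  obtains \<theta> :: "'y::polish_space \<Rightarrow> real" and D :: "real \<Rightarrow> 'y" and K :: "real set"
  where "\<theta> \<in> borel_measurable borel" "D \<in> borel \<rightarrow>\<^sub>M borel" "compact K" "range \<theta> \<subseteq> K"
    "continuous_on K D" "\<And>y. D (\<theta> y) = y"
proof -
  obtain \<B> :: "'y set set" where \<B>: "countable \<B>" "topological_basis \<B>"
    using ex_countable_basis by auto
  have ne: "\<B> \<noteq> {}"
    using topological_basisE[OF \<B>(2), of UNIV] by auto
  define B where "B = from_nat_into \<B>"
  have B: "topological_basis (range B)"
    unfolding B_def using range_from_nat_into[OF ne \<B>(1)] \<B>(2) by simp
  have op: "open (B k)" for k
    using topological_basis_open[OF B] by auto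
  define s where "s y k = (if y \<in> B k then 1 else 0 :: real)" for y k
  define t where "t k = (1/3::real)^k" for k
  have sum_t: "summable t" and sum_t': "summable (\<lambda>k. t (k + m))" for m
    unfolding t_def by (auto intro!: summable_geometric simp: summable_iff_shift)
  \<comment> \<open>The reason for base 3: the tail after digit \<open>m\<close> is only half of the
    digit's weight, so the first disagreement cannot be cancelled by later digits. In base 2 the
    tail would equal the weight.\<close>
  have suminf_t: "(\<Sum>k. t (k + Suc m)) = t m / 2" for m
  proof -
    have "(\<Sum>k. t (k + Suc m)) = (\<Sum>k. t (Suc m) * (1/3)^k)"
      by (simp add: t_def power_add mult_ac)
    also have "\<dots> = t (Suc m) * (3/2)"
      by (subst suminf_mult) (auto intro!: summable_geometric simp: suminf_geometric)
    finally show ?thesis by (simp add: t_def)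
  qed
  define \<theta> where "\<theta> y = (\<Sum>k. s y k * t k)" for y
  have t0: "0 \<le> t k" for k by (simp add: t_def)
  have sums: "summable (\<lambda>k. s y k * t k)" for y
    by (rule summable_comparison_test'[OF sum_t, of 0]) (auto simp: s_def t0)
  have [measurable]: "\<theta> \<in> borel_measurable borel"
  proof -
    have [measurable]: "B k \<in> sets borel" for k using op by auto
    show ?thesis unfolding \<theta>_def s_def by measurable
  qed
  \<comment> \<open>At the first index \<open>m\<close> of disagreement the codes differ by at least
    \<open>t m - t m / 2\<close>; closeness below \<open>t n / 2\<close> therefore forces
    \<open>m\<close> beyond \<open>n\<close>.\<close>
  have sep: "\<forall>k\<le>n. y \<in> B k \<longleftrightarrow> y' \<in> B k" if close: "\<bar>\<theta> y - \<theta> y'\<bar> < t n / 2" for n y y'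
  proof (rule ccontr)
    assume "\<not> ?thesis"
    then have ex: "\<exists>k. \<not> (y \<in> B k \<longleftrightarrow> y' \<in> B k)" and ex': "\<exists>k\<le>n. \<not> (y \<in> B k \<longleftrightarrow> y' \<in> B k)" by auto
    define m where "m = (LEAST k. \<not> (y \<in> B k \<longleftrightarrow> y' \<in> B k))"
    have m: "\<not> (y \<in> B m \<longleftrightarrow> y' \<in> B m)" unfolding m_def by (rule LeastI_ex[OF ex])
    have less: "y \<in> B k \<longleftrightarrow> y' \<in> B k" if "k < m" for k
      using not_less_Least[of k "\<lambda>k. \<not> (y \<in> B k \<longleftrightarrow> y' \<in> B k)"] that unfolding m_def by auto
    have "m \<le> n" using ex' unfolding m_def using Least_le[where P = "\<lambda>k. \<not> (y \<in> B k \<longleftrightarrow> y' \<in> B k)"] order_trans by blast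
    then have tmn: "t n \<le> t m" unfolding t_def by (intro power_decreasing) auto
    define d where "d k = (s y k - s y' k) * t k" for k
    have sd: "summable d" unfolding d_def left_diff_distrib by (intro summable_diff sums)
    have "\<theta> y - \<theta> y' = (\<Sum>k. d k)"
      unfolding \<theta>_def d_def left_diff_distrib by (intro suminf_diff sums)
    also have "\<dots> = (\<Sum>k. d (k + Suc m)) + (\<Sum>k<Suc m. d k)"
      by (rule suminf_split_initial_segment[OF sd])
    also have "(\<Sum>k<Suc m. d k) = d m"
      using less by (auto simp: d_def s_def)
    finally have eq: "\<theta> y - \<theta> y' = (\<Sum>k. d (k + Suc m)) + d m" .
    have dt: "norm (d k) \<le> t k" for k by (auto simp: d_def s_def t0)
    have "norm (\<Sum>k. d (k + Suc m)) \<le> (\<Sum>k. t (k + Suc m))"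
      by (rule norm_suminf_le[OF dt sum_t'])
    then have "\<bar>\<Sum>k. d (k + Suc m)\<bar> \<le> t m / 2" by (simp only: suminf_t real_norm_def)
    moreover have "\<bar>d m\<bar> = t m" using m t0[of m] by (auto simp: d_def s_def)
    ultimately have "\<bar>\<theta> y - \<theta> y'\<bar> \<ge> t m / 2" using eq by linarith
    with close tmn show False by linarith
  qed
  have close_of: "\<exists>\<delta>>0. \<forall>y y'. \<bar>\<theta> y - \<theta> y'\<bar> < \<delta> \<longrightarrow> dist y y' < e" if "0 < e" for e
  proof -
    obtain n where n: "\<And>y y'. (\<forall>k\<le>n. y \<in> B k \<longleftrightarrow> y' \<in> B k) \<Longrightarrow> dist y y' < e"
      using compact_basis_separates[OF comp B \<open>0 < e\<close>] by blast
    show ?thesis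
      by (intro exI[of _ "t n / 2"]) (use sep n in \<open>auto simp: t_def\<close>)
  qed
  have inj: "inj \<theta>"
  proof (rule injI, rule ccontr)
    fix y y' assume "\<theta> y = \<theta> y'" "y \<noteq> y'"
    with close_of[of "dist y y'"] show False by (auto, metis abs_zero cancel_comm_monoid_add_class.diff_cancel less_irrefl)
  qed
  have uc: "uniformly_continuous_on (range \<theta>) (inv \<theta>)"
    unfolding uniformly_continuous_on_def
  proof (intro allI impI)
    fix e :: real assume "0 < e"
    from close_of[OF this] obtain \<delta> where "\<delta> > 0" "\<And>y y'. \<bar>\<theta> y - \<theta> y'\<bar> < \<delta> \<Longrightarrow> dist y y' < e" by auto
    then show "\<exists>d>0. \<forall>x\<in>range \<theta>. \<forall>x'\<in>range \<theta>. dist x' x < d \<longrightarrow> dist (inv \<theta> x') (inv \<theta> x) < e"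
      by (intro exI[of _ \<delta>]) (auto simp: inv_f_f[OF inj] dist_real_def)
  qed
  \<comment> \<open>Weak limits of encoded laws may charge the closure of the range, so the inverse
    has to be extended there; uniform continuity makes this possible.\<close>
  obtain g where g: "uniformly_continuous_on (closure (range \<theta>)) g" "\<And>x. x \<in> range \<theta> \<Longrightarrow> inv \<theta> x = g x"
    using uniformly_continuous_on_extension_on_closure[OF uc] by metis
  define K where "K = closure (range \<theta>)"
  \<comment> \<open>The value outside \<open>K\<close> is irrelevant; it only makes the decoder a
    measurable function on the whole line.\<close>
  define D where "D r = (if r \<in> K then g r else undefined)" for r
  have gc: "continuous_on K g" unfolding K_def using g(1) by (rule uniformly_continuous_imp_continuous)
  have Kc: "closed K" by (simp add: K_def)
  have bd: "\<bar>\<theta> y\<bar> \<le> suminf t" for y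
    unfolding \<theta>_def real_norm_def[symmetric]
    by (rule norm_suminf_le[OF _ sum_t]) (auto simp: s_def t0)
  show ?thesis
  proof
    show "D \<in> borel \<rightarrow>\<^sub>M borel"
      unfolding D_def using Kc gc by (intro borel_measurable_continuous_on_if) auto
    show "compact K"
      unfolding K_def by (intro compact_closure[THEN iffD2] boundedI[of _ "suminf t"]) (use bd in auto)
    show "range \<theta> \<subseteq> K" unfolding K_def by (rule closure_subset)
    show "continuous_on K D"
      using gc by (rule continuous_on_cong[THEN iffD1, rotated 2]) (auto simp: D_def)
    show "D (\<theta> y) = y" for y
      using g(2)[of "\<theta> y"] closure_subset[of "range \<theta>"] by (auto simp: D_def K_def inv_f_f[OF inj])
  qed fact
qed

section \<open>The Wasserstein metric\<close>

lemma Prob_distr: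
  assumes "prob_space M" "f \<in> M \<rightarrow>\<^sub>M borel"
  shows "distr M borel f \<in> Prob"
  using assms by (simp add: space_prob_algebra prob_space.prob_space_distr)

lemma ProbD:
  assumes "\<mu> \<in> Prob"
  shows "prob_space \<mu>" "sets \<mu> = sets borel" "space \<mu> = UNIV"
  using assms sets_eq_imp_space_eq[of \<mu> borel] by (auto simp: space_prob_algebra)

text \<open>The density is constant on products of cells; only pairs lying in cells of the same index are
  charged.\<close>
lemma glue:
  fixes c1 :: "'p \<Rightarrow> nat" and c2 :: "'q \<Rightarrow> nat"
  assumes M1: "prob_space M1" and M2: "prob_space M2"
    and c1[measurable]: "c1 \<in> M1 \<rightarrow>\<^sub>M count_space UNIV"
    and c2[measurable]: "c2 \<in> M2 \<rightarrow>\<^sub>M count_space UNIV"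
    and eq: "distr M1 (count_space UNIV) c1 = distr M2 (count_space UNIV) c2"
  obtains N where "prob_space N" "sets N = sets (M1 \<Otimes>\<^sub>M M2)" "distr N M1 fst = M1" "distr N M2 snd = M2"
    "AE p in N. c1 (fst p) = c2 (snd p)"
proof -
  interpret M1: prob_space M1 by fact
  interpret M2: prob_space M2 by fact
  interpret P: pair_prob_space M1 M2 ..
  define w where "w i = emeasure M1 (c1 -` {i} \<inter> space M1)" for i
  have w2: "w i = emeasure M2 (c2 -` {i} \<inter> space M2)" for i
    using arg_cong[OF eq, of "\<lambda>N. emeasure N {i}"] by (simp add: w_def emeasure_distr)
  have wfin: "w i \<noteq> \<infinity>" for i by (simp add: w_def)
  \<comment> \<open>The product of the two cells of index \<open>i\<close> has mass
    \<open>w i * w i\<close>; dividing by \<open>w i\<close> leaves mass \<open>w i\<close> on it,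
    as both marginals require.\<close>
  define h where "h p = (if c1 (fst p) = c2 (snd p) then inverse (w (c1 (fst p))) else 0)" for p
  have [measurable]: "w \<in> borel_measurable (count_space UNIV)" by simp
  have [measurable]: "Measurable.pred (M1 \<Otimes>\<^sub>M M2) (\<lambda>p. c1 (fst p) = c2 (snd p))"
  proof -
    have "(\<lambda>p. c1 (fst p) = c2 (snd p)) = (\<lambda>p. \<exists>i. c1 (fst p) = i \<and> c2 (snd p) = i)" by auto
    then show ?thesis by (rule ssubst) measurable
  qed
  have [measurable]: "h \<in> borel_measurable (M1 \<Otimes>\<^sub>M M2)"
    unfolding h_def
    by (intro measurable_If borel_measurable_inverse
        measurable_compose[OF _ \<open>w \<in> borel_measurable (count_space UNIV)\<close>]) measurable
  \<comment> \<open>On a null cell the inverse in \<open>ennreal\<close> is infinite, so such cells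
    are discarded before the marginals are computed. They are countably many, hence jointly
    null.\<close>
  have AE1: "AE a in M1. w (c1 a) \<noteq> 0"
  proof -
    have "AE a in M1. w i = 0 \<longrightarrow> c1 a \<noteq> i" for i
    proof (cases "w i = 0")
      case True
      then show ?thesis by (intro AE_I[of _ _ "c1 -` {i} \<inter> space M1"]) (auto simp: w_def)
    qed auto
    then have "AE a in M1. \<forall>i. w i = 0 \<longrightarrow> c1 a \<noteq> i" unfolding AE_all_countable by auto
    then show ?thesis by eventually_elim auto
  qed
  have AE2: "AE a in M2. w (c2 a) \<noteq> 0"
  proof -
    have "AE a in M2. w i = 0 \<longrightarrow> c2 a \<noteq> i" for i
    proof (cases "w i = 0")
      case True
      then show ?thesis by (intro AE_I[of _ _ "c2 -` {i} \<inter> space M2"]) (auto simp: w2)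
    qed auto
    then have "AE a in M2. \<forall>i. w i = 0 \<longrightarrow> c2 a \<noteq> i" unfolding AE_all_countable by auto
    then show ?thesis by eventually_elim auto
  qed
  have inv1: "inverse (w i) * w i = 1" if "w i \<noteq> 0" for i
    using that wfin[of i] by (simp add: ennreal_inverse_mult' mult.commute ennreal_divide_self divide_ennreal_def[symmetric] top.not_eq_extremum)
  have marg1: "(\<integral>\<^sup>+b. h (a, b) \<partial>M2) = 1" if "w (c1 a) \<noteq> 0" for a
  proof -
    have "(\<integral>\<^sup>+b. h (a, b) \<partial>M2) = (\<integral>\<^sup>+b. inverse (w (c1 a)) * indicator (c2 -` {c1 a} \<inter> space M2) b \<partial>M2)"
      by (intro nn_integral_cong) (auto simp: h_def indicator_def)
    also have "\<dots> = inverse (w (c1 a)) * w (c1 a)"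
      by (subst nn_integral_cmult_indicator) (auto simp: w2)
    finally show ?thesis using inv1 that by simp
  qed
  have marg2: "(\<integral>\<^sup>+a. h (a, b) \<partial>M1) = 1" if "w (c2 b) \<noteq> 0" for b
  proof -
    have "(\<integral>\<^sup>+a. h (a, b) \<partial>M1) = (\<integral>\<^sup>+a. inverse (w (c2 b)) * indicator (c1 -` {c2 b} \<inter> space M1) a \<partial>M1)"
      by (intro nn_integral_cong) (auto simp: h_def indicator_def)
    also have "\<dots> = inverse (w (c2 b)) * w (c2 b)"
      by (subst nn_integral_cmult_indicator) (auto simp: w_def)
    finally show ?thesis using inv1 that by simp
  qed
  define N where "N = density (M1 \<Otimes>\<^sub>M M2) h"
  have sets_N[measurable_cong]: "sets N = sets (M1 \<Otimes>\<^sub>M M2)" by (simp add: N_def)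
  have d1: "distr N M1 fst = M1"
  proof (rule measure_eqI)
    fix A assume "A \<in> sets (distr N M1 fst)"
    then have [measurable]: "A \<in> sets M1" by simp
    have "emeasure (distr N M1 fst) A = (\<integral>\<^sup>+p. h p * indicator A (fst p) \<partial>(M1 \<Otimes>\<^sub>M M2))"
      by (subst emeasure_distr, measurable)
         (simp add: N_def emeasure_density, auto intro!: nn_integral_cong simp: indicator_def)
    also have "\<dots> = (\<integral>\<^sup>+a. (\<integral>\<^sup>+b. h (a, b) * indicator A a \<partial>M2) \<partial>M1)"
      by (subst M2.nn_integral_fst[symmetric]) auto
    also have "\<dots> = (\<integral>\<^sup>+a. (\<integral>\<^sup>+b. h (a, b) \<partial>M2) * indicator A a \<partial>M1)"
      by (intro nn_integral_cong nn_integral_multc) auto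
    also have "\<dots> = (\<integral>\<^sup>+a. indicator A a \<partial>M1)"
      using AE1 by (intro nn_integral_cong_AE) (auto simp: marg1)
    finally show "emeasure (distr N M1 fst) A = emeasure M1 A" by simp
  qed simp
  have d2: "distr N M2 snd = M2"
  proof (rule measure_eqI)
    fix A assume "A \<in> sets (distr N M2 snd)"
    then have [measurable]: "A \<in> sets M2" by simp
    have "emeasure (distr N M2 snd) A = (\<integral>\<^sup>+p. h p * indicator A (snd p) \<partial>(M1 \<Otimes>\<^sub>M M2))"
      by (subst emeasure_distr, measurable)
         (simp add: N_def emeasure_density, auto intro!: nn_integral_cong simp: indicator_def)
    also have "\<dots> = (\<integral>\<^sup>+b. (\<integral>\<^sup>+a. h (a, b) * indicator A b \<partial>M1) \<partial>M2)"
      by (subst P.nn_integral_snd[symmetric]) auto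
    also have "\<dots> = (\<integral>\<^sup>+b. (\<integral>\<^sup>+a. h (a, b) \<partial>M1) * indicator A b \<partial>M2)"
      by (intro nn_integral_cong nn_integral_multc) auto
    also have "\<dots> = (\<integral>\<^sup>+b. indicator A b \<partial>M2)"
      using AE2 by (intro nn_integral_cong_AE) (auto simp: marg2)
    finally show "emeasure (distr N M2 snd) A = emeasure M2 A" by simp
  qed simp
  show ?thesis
  proof
    have "prob_space (distr N M1 fst)" unfolding d1 by fact
    then show "prob_space N" by (rule prob_space_distrD[rotated]) measurable
    show "AE p in N. c1 (fst p) = c2 (snd p)"
      unfolding N_def by (subst AE_density) (auto simp: h_def split: if_splits)
  qed (fact sets_N d1 d2)+
qed

text \<open>Supplies the index functions for \<open>glue\<close>: two couplings with a common
  marginal are glued only up to the cell of the middle point, at a cost below \<delta>. This stands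
  in for a disintegration of the couplings.\<close>

lemma small_cells:
  assumes "0 < \<delta>"
  obtains c :: "'y::{metric_space, second_countable_topology} \<Rightarrow> nat"
  where "c \<in> borel \<rightarrow>\<^sub>M count_space UNIV" "\<And>y y'. c y = c y' \<Longrightarrow> dist y y' < \<delta>"
proof -
  obtain D :: "'y set" where D: "countable D" "\<And>X. open X \<Longrightarrow> X \<noteq> {} \<Longrightarrow> \<exists>d\<in>D. d \<in> X"
    using countable_dense_exists by metis
  have ne: "D \<noteq> {}" using D(2)[of UNIV] by auto
  define d where "d = from_nat_into D"
  have d: "\<exists>i. dist y (d i) < \<delta>/2" for y
  proof -
    obtain z where "z \<in> D" "z \<in> ball y (\<delta>/2)" using D(2)[of "ball y (\<delta>/2)"] assms by auto
    then show ?thesis using from_nat_into_surj[OF D(1)] unfolding d_def by (metis mem_ball)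
  qed
  define c where "c y = (LEAST i. dist y (d i) < \<delta>/2)" for y
  show ?thesis
  proof
    show "c \<in> borel \<rightarrow>\<^sub>M count_space UNIV" unfolding c_def by measurable
    fix y y' assume eq: "c y = c y'"
    have "dist y (d (c y)) < \<delta>/2" "dist y' (d (c y')) < \<delta>/2"
      unfolding c_def by (rule LeastI_ex[OF d])+
    with eq show "dist y y' < \<delta>" by (metis dist_triangle_half_l)
  qed
qed

text \<open>One development serves both metrics: \<open>dist\<close> on states and
  \<open>sum_dist\<close> on state-action pairs. The latter is not the metric of the product type,
  but is squeezed between it and its double.\<close>

locale comp_metric =
  fixes \<rho> :: "'y::polish_space \<Rightarrow> 'y \<Rightarrow> real"
  assumes comp: "compact (UNIV :: 'y set)"
    and sym: "\<rho> x y = \<rho> y x"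
    and tri: "\<rho> x z \<le> \<rho> x y + \<rho> y z"
    and lo: "dist x y \<le> \<rho> x y"
    and hi: "\<rho> x y \<le> 2 * dist x y"
begin

lemma rho_nonneg[simp]: "0 \<le> \<rho> x y" using lo[of x y] by (meson zero_le_dist order_trans)

lemma rho_refl[simp]: "\<rho> x x = 0" using hi[of x x] rho_nonneg[of x x] by simp

lemma rho_lipschitz: "\<bar>\<rho> x y - \<rho> x' y'\<bar> \<le> 2 * dist x x' + 2 * dist y y'"
  using tri[of x y x'] tri[of x' y y'] tri[of x' y' x] tri[of x y' y] hi[of x x'] hi[of y y']
  by (simp add: sym[of y' y] sym[of x' x])

lemma rho_measurable: "(\<lambda>p. \<rho> (fst p) (snd p)) \<in> borel_measurable borel"
proof (rule borel_measurable_continuous_onI, rule continuous_at_imp_continuous_on, rule ballI)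
  fix p :: "'y \<times> 'y"
  have "((\<lambda>q. \<rho> (fst q) (snd q)) \<longlongrightarrow> \<rho> (fst p) (snd p)) (at p)"
  proof (rule Lim_null_comparison[THEN LIM_zero_cancel])
    show "\<forall>\<^sub>F q in at p. norm (\<rho> (fst q) (snd q) - \<rho> (fst p) (snd p))
        \<le> 2 * dist (fst q) (fst p) + 2 * dist (snd q) (snd p)"
      using rho_lipschitz by (intro always_eventually) auto
    show "((\<lambda>q. 2 * dist (fst q) (fst p) + 2 * dist (snd q) (snd p)) \<longlongrightarrow> 0) (at p)"
      by (rule tendsto_eq_intros refl tendsto_dist tendsto_fst tendsto_snd tendsto_ident_at| simp)+
  qed
  then show "isCont (\<lambda>p. \<rho> (fst p) (snd p)) p" by (simp add: isCont_def)
qed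

lemma rho_measurable_comp[measurable (raw)]:
  assumes "f \<in> borel_measurable M" "g \<in> borel_measurable M"
  shows "(\<lambda>x. \<rho> (f x) (g x)) \<in> borel_measurable M"
  using measurable_compose[OF borel_measurable_Pair[OF assms] rho_measurable] by simp

lemma rho_bounded: "\<exists>B. \<forall>x y. \<rho> x y \<le> B"
proof -
  from compact_imp_bounded[OF comp] obtain x0 e where e: "\<And>y :: 'y. dist x0 y \<le> e"
    unfolding bounded_def by auto
  have "\<rho> x y \<le> 4 * e" for x y
    using hi[of x y] e[of x] e[of y] dist_triangle[of x y x0] by (simp add: dist_commute)
  then show ?thesis by auto
qed

lemma rho_integrable:
  assumes "finite_measure M" "f \<in> borel_measurable M" "g \<in> borel_measurable M"
  shows "integrable M (\<lambda>x. \<rho> (f x) (g x))"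
proof -
  obtain B where "\<And>x y. \<rho> x y \<le> B" using rho_bounded by auto
  then show ?thesis using assms
    by (intro finite_measure.integrable_const_bound[of _ _ B]) auto
qed

abbreviation "Wd \<equiv> wasserstein \<rho>"

text \<open>The definition takes the \<sigma>-algebras of the marginals themselves; they are Borel,
  and fixing the Borel product once makes measurability automatic afterwards.\<close>

lemma couplings_eq:
  fixes \<mu> \<nu> :: "'y measure"
  assumes "\<mu> \<in> Prob" "\<nu> \<in> Prob"
  shows "couplings \<mu> \<nu> = {\<gamma> \<in> space (prob_algebra (borel \<Otimes>\<^sub>M borel)). distr \<gamma> borel fst = \<mu> \<and> distr \<gamma> borel snd = \<nu>}"
proof -
  have s: "sets (\<mu> \<Otimes>\<^sub>M \<nu>) = sets (borel \<Otimes>\<^sub>M borel)" using ProbD[OF assms(1)] ProbD[OF assms(2)] by (intro sets_pair_measure_cong)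
  have "distr \<gamma> \<mu> fst = distr \<gamma> borel fst" "distr \<gamma> \<nu> snd = distr \<gamma> borel snd" for \<gamma> :: "('y \<times> 'y) measure"
    using ProbD[OF assms(1)] ProbD[OF assms(2)] by (auto intro: distr_cong)
  then show ?thesis unfolding couplings_def space_prob_algebra s by auto
qed

lemma couplings_integral_nonneg: "0 \<le> (\<integral>p. \<rho> (fst p) (snd p) \<partial>\<gamma>)"
  by (rule Bochner_Integration.integral_nonneg) simp

text \<open>Source of the quantitative upper bounds on the distance: two variables of the prescribed
  laws are put on one probability space and their mean distance is estimated.\<close>

lemma Wd_le:
  assumes M: "prob_space M" and [measurable]: "f \<in> M \<rightarrow>\<^sub>M borel" "g \<in> M \<rightarrow>\<^sub>M borel"
  shows "Wd (distr M borel f) (distr M borel g) \<le> (\<integral>x. \<rho> (f x) (g x) \<partial>M)"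
proof -
  interpret prob_space M by fact
  let ?\<gamma> = "distr M (borel \<Otimes>\<^sub>M borel) (\<lambda>x. (f x, g x))"
  have P: "distr M borel f \<in> Prob" "distr M borel g \<in> Prob" by (auto intro!: Prob_distr M)
  have "?\<gamma> \<in> couplings (distr M borel f) (distr M borel g)"
    unfolding couplings_eq[OF P]
    by (auto simp: space_prob_algebra distr_distr comp_def intro!: prob_space_distr)
  then have "Wd (distr M borel f) (distr M borel g) \<le> (\<integral>p. \<rho> (fst p) (snd p) \<partial>?\<gamma>)"
    unfolding wasserstein_def using P
    by (auto intro!: cINF_lower bdd_belowI2[of _ 0] couplings_integral_nonneg)
  also have "\<dots> = (\<integral>x. \<rho> (f x) (g x) \<partial>M)"
    by (subst integral_distr) auto
  finally show ?thesis .
qed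

lemma couplings_nonempty:
  fixes \<mu> \<nu> :: "'y measure"
  assumes P: "\<mu> \<in> Prob" "\<nu> \<in> Prob"
  shows "couplings \<mu> \<nu> \<noteq> {}"
proof -
  interpret m: prob_space \<mu> using ProbD[OF P(1)] by simp
  interpret n: prob_space \<nu> using ProbD[OF P(2)] by simp
  interpret pair_prob_space \<mu> \<nu> ..
  have s: "sets (\<mu> \<Otimes>\<^sub>M \<nu>) = sets (borel \<Otimes>\<^sub>M borel)" using ProbD[OF P(1)] ProbD[OF P(2)] by (intro sets_pair_measure_cong)
  have "distr (\<mu> \<Otimes>\<^sub>M \<nu>) \<nu> snd = \<nu>"
    using ProbD[OF P(2)]
    by (intro measure_eqI) (auto simp: emeasure_distr space_pair_measure m.emeasure_space_1
        n.emeasure_pair_measure_Times vimage_snd Times_Int_Times)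
  then have "\<mu> \<Otimes>\<^sub>M \<nu> \<in> couplings \<mu> \<nu>"
    unfolding couplings_def using n.distr_pair_fst prob_space_axioms
    by (simp add: space_prob_algebra)
  then show ?thesis by auto
qed

text \<open>Near-optimal couplings suffice, since every estimate that uses them ends with
  \<open>field_le_epsilon\<close> or leaves room for an error.\<close>

lemma Wd_coupling:
  assumes P: "\<mu> \<in> Prob" "\<nu> \<in> Prob" and e: "0 < e"
  obtains \<gamma> where "prob_space \<gamma>" "sets \<gamma> = sets (borel \<Otimes>\<^sub>M borel)"
    "distr \<gamma> borel fst = \<mu>" "distr \<gamma> borel snd = \<nu>" "(\<integral>p. \<rho> (fst p) (snd p) \<partial>\<gamma>) < Wd \<mu> \<nu> + e"
proof -
  have "\<exists>\<gamma>\<in>couplings \<mu> \<nu>. (\<integral>p. \<rho> (fst p) (snd p) \<partial>\<gamma>) < Wd \<mu> \<nu> + e"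
    using e P couplings_nonempty[OF P]
    by (subst cINF_less_iff[symmetric])
       (auto simp: wasserstein_def intro!: bdd_belowI2[of _ 0] couplings_integral_nonneg)
  then show ?thesis using that unfolding couplings_eq[OF P] space_prob_algebra by auto
qed

lemma Wd_nonneg: "0 \<le> Wd \<mu> \<nu>"
proof (cases "\<mu> \<in> Prob \<and> \<nu> \<in> Prob")
  case True
  then show ?thesis unfolding wasserstein_def
    using couplings_nonempty by (auto intro!: cINF_greatest couplings_integral_nonneg)
qed (auto simp: wasserstein_def)

lemma Wd_sym_le: "\<mu> \<in> Prob \<Longrightarrow> \<nu> \<in> Prob \<Longrightarrow> Wd \<nu> \<mu> \<le> Wd \<mu> \<nu>"
proof (rule field_le_epsilon)
  fix e :: real assume P: "\<mu> \<in> Prob" "\<nu> \<in> Prob" and "0 < e"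
  from Wd_coupling[OF this] obtain \<gamma> where g: "prob_space \<gamma>" and [measurable_cong]: "sets \<gamma> = sets (borel \<Otimes>\<^sub>M borel)"
    and m: "distr \<gamma> borel fst = \<mu>" "distr \<gamma> borel snd = \<nu>" and l: "(\<integral>p. \<rho> (fst p) (snd p) \<partial>\<gamma>) < Wd \<mu> \<nu> + e" .
  have "Wd \<nu> \<mu> \<le> (\<integral>p. \<rho> (snd p) (fst p) \<partial>\<gamma>)"
    unfolding m[symmetric] by (rule Wd_le[OF g]) auto
  with l show "Wd \<nu> \<mu> \<le> Wd \<mu> \<nu> + e" by (simp add: sym)
qed

lemma Wd_commute: "Wd \<mu> \<nu> = Wd \<nu> \<mu>"
proof (cases "\<mu> \<in> Prob \<and> \<nu> \<in> Prob")
  case True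
  then show ?thesis using Wd_sym_le[of \<mu> \<nu>] Wd_sym_le[of \<nu> \<mu>] by simp
next
  case False
  then have "Wd \<mu> \<nu> = 0" "Wd \<nu> \<mu> = 0" by (auto simp only: wasserstein_def if_False conj_commute)
  then show ?thesis by simp
qed

lemma Wd_self:
  assumes "\<mu> \<in> Prob" shows "Wd \<mu> \<mu> = 0"
proof -
  have "distr \<mu> borel (\<lambda>x. x) = \<mu>" using ProbD[OF assms] by (intro distr_id2) auto
  moreover have "Wd (distr \<mu> borel (\<lambda>x. x)) (distr \<mu> borel (\<lambda>x. x)) \<le> (\<integral>x. \<rho> x x \<partial>\<mu>)"
    using ProbD[OF assms] by (intro Wd_le) (auto simp: measurable_def)
  ultimately show ?thesis using Wd_nonneg[of \<mu> \<mu>] by simp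
qed

text \<open>The two near-optimal couplings share the marginal \<nu>. Gluing them over small cells
  makes the two copies of the middle point almost equal, and the pointwise triangle inequality is
  integrated.\<close>

lemma Wd_triangle:
  assumes P: "\<mu> \<in> Prob" "\<nu> \<in> Prob" "\<kappa> \<in> Prob"
  shows "Wd \<mu> \<kappa> \<le> Wd \<mu> \<nu> + Wd \<nu> \<kappa>"
proof (rule field_le_epsilon)
  fix e :: real assume "0 < e"
  \<comment> \<open>Each coupling loses \<open>e/4\<close>. The middle points are within
    \<open>e/4\<close> in \<open>dist\<close>, so within \<open>e/2\<close> in \<rho>; the losses
    add up to \<open>e\<close>.\<close>
  then have e: "0 < e/4" by simp
  obtain \<gamma>1 where g1: "prob_space \<gamma>1" and [measurable_cong]: "sets \<gamma>1 = sets (borel \<Otimes>\<^sub>M borel)"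
    and m1: "distr \<gamma>1 borel fst = \<mu>" "distr \<gamma>1 borel snd = \<nu>" and l1: "(\<integral>p. \<rho> (fst p) (snd p) \<partial>\<gamma>1) < Wd \<mu> \<nu> + e/4"
    using Wd_coupling[OF P(1,2) e] .
  obtain \<gamma>2 where g2: "prob_space \<gamma>2" and [measurable_cong]: "sets \<gamma>2 = sets (borel \<Otimes>\<^sub>M borel)"
    and m2: "distr \<gamma>2 borel fst = \<nu>" "distr \<gamma>2 borel snd = \<kappa>" and l2: "(\<integral>p. \<rho> (fst p) (snd p) \<partial>\<gamma>2) < Wd \<nu> \<kappa> + e/4"
    using Wd_coupling[OF P(2,3) e] .
  obtain c :: "'y \<Rightarrow> nat" where [measurable]: "c \<in> borel \<rightarrow>\<^sub>M count_space UNIV"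
    and c: "\<And>y y'. c y = c y' \<Longrightarrow> dist y y' < e/4" using small_cells[OF e] by metis
  have "distr \<gamma>1 (count_space UNIV) (\<lambda>p. c (snd p)) = distr (distr \<gamma>1 borel snd) (count_space UNIV) c"
    by (simp add: distr_distr comp_def)
  also have "\<dots> = distr (distr \<gamma>2 borel fst) (count_space UNIV) c" by (simp only: m1 m2)
  also have "\<dots> = distr \<gamma>2 (count_space UNIV) (\<lambda>p. c (fst p))"
    by (simp add: distr_distr comp_def)
  finally obtain N where N: "prob_space N" and [measurable_cong]: "sets N = sets (\<gamma>1 \<Otimes>\<^sub>M \<gamma>2)"
    and d1: "distr N \<gamma>1 fst = \<gamma>1" and d2: "distr N \<gamma>2 snd = \<gamma>2"
    and ae: "AE p in N. c (snd (fst p)) = c (fst (snd p))"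
    using glue[OF g1 g2, of "\<lambda>p. c (snd p)" "\<lambda>p. c (fst p)"] by (auto simp: measurable_split_conv)
  interpret N: prob_space N by fact
  have "\<mu> = distr N borel (\<lambda>p. fst (fst p))"
    unfolding m1(1)[symmetric] by (subst d1[symmetric], subst distr_distr) (auto simp: comp_def)
  moreover have "\<kappa> = distr N borel (\<lambda>p. snd (snd p))"
    unfolding m2(2)[symmetric] by (subst d2[symmetric], subst distr_distr) (auto simp: comp_def)
  ultimately have "Wd \<mu> \<kappa> \<le> (\<integral>p. \<rho> (fst (fst p)) (snd (snd p)) \<partial>N)"
    using Wd_le[OF N, of "\<lambda>p. fst (fst p)" "\<lambda>p. snd (snd p)"] by simp
  also have "\<dots> \<le> (\<integral>p. \<rho> (fst (fst p)) (snd (fst p)) + e/2 + \<rho> (fst (snd p)) (snd (snd p)) \<partial>N)"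
  proof (rule integral_mono_AE)
    show "AE p in N. \<rho> (fst (fst p)) (snd (snd p)) \<le> \<rho> (fst (fst p)) (snd (fst p)) + e/2 + \<rho> (fst (snd p)) (snd (snd p))"
      using ae
    proof eventually_elim
      case (elim p)
      from c[OF this] show ?case
        using hi[of "snd (fst p)" "fst (snd p)"] tri[of "fst (fst p)" "snd (snd p)" "snd (fst p)"]
          tri[of "snd (fst p)" "snd (snd p)" "fst (snd p)"] by linarith
    qed
  qed (auto intro!: rho_integrable N.finite_measure_axioms Bochner_Integration.integrable_add)
  also have "\<dots> = (\<integral>p. \<rho> (fst (fst p)) (snd (fst p)) \<partial>N) + e/2 + (\<integral>p. \<rho> (fst (snd p)) (snd (snd p)) \<partial>N)"
    by (simp add: rho_integrable N.finite_measure_axioms N.prob_space)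
  also have "(\<integral>p. \<rho> (fst (fst p)) (snd (fst p)) \<partial>N) = (\<integral>p. \<rho> (fst p) (snd p) \<partial>\<gamma>1)"
    by (subst d1[symmetric], subst integral_distr) auto
  also have "(\<integral>p. \<rho> (fst (snd p)) (snd (snd p)) \<partial>N) = (\<integral>p. \<rho> (fst p) (snd p) \<partial>\<gamma>2)"
    by (subst d2[symmetric], subst integral_distr) auto
  finally show "Wd \<mu> \<kappa> \<le> Wd \<mu> \<nu> + Wd \<nu> \<kappa> + e" using l1 l2 by simp
qed

end

section \<open>Continuous test functions and the Borel structure of the Wasserstein topology\<close>

definition cutoff :: "'y::metric_space set \<Rightarrow> nat \<Rightarrow> 'y \<Rightarrow> real" where
  "cutoff C n y = max 0 (1 - real n * infdist y C)"

lemma continuous_cutoff: "continuous_on UNIV (cutoff C n)"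
  unfolding cutoff_def by (intro continuous_intros)

text \<open>The cutoffs are 1 on \<open>C\<close> and vanish eventually at each point outside it.
  Nonemptiness matters because \<open>infdist\<close> to the empty set is 0, so the cutoffs would be
  constantly 1.\<close>

lemma integral_cutoff_tendsto:
  assumes C: "closed C" "C \<noteq> {}" and \<mu>: "\<mu> \<in> Prob"
  shows "(\<lambda>n. \<integral>y. cutoff C n y \<partial>\<mu>) \<longlonglongrightarrow> measure \<mu> C"
proof -
  interpret prob_space \<mu> using ProbD[OF \<mu>] by simp
  have [measurable_cong]: "sets \<mu> = sets borel" using ProbD[OF \<mu>] by simp
  have "(\<lambda>n. \<integral>y. cutoff C n y \<partial>\<mu>) \<longlonglongrightarrow> (\<integral>y. indicator C y \<partial>\<mu>)"
  proof (rule integral_dominated_convergence[where w = "\<lambda>_. 1"])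
    have "C \<in> sets borel" using C by simp
    then show "(indicat_real C) \<in> borel_measurable \<mu>" by measurable
    show "cutoff C n \<in> borel_measurable \<mu>" for n
      using borel_measurable_continuous_onI[OF continuous_cutoff] by measurable
    show "AE y in \<mu>. (\<lambda>n. cutoff C n y) \<longlonglongrightarrow> indicat_real C y"
    proof (rule AE_I2)
      fix y
      show "(\<lambda>n. cutoff C n y) \<longlonglongrightarrow> indicat_real C y"
      proof (cases "y \<in> C")
        case True
        then show ?thesis by (simp add: cutoff_def)
      next
        case False
        then have pos: "0 < infdist y C"
          using C infdist_pos_not_in_closed by blast
        obtain n0 :: nat where n0: "1 / infdist y C < real n0" using reals_Archimedean2 by blast
        have "cutoff C n y = 0" if "n \<ge> n0" for n
        proof -
          have "1 / infdist y C < real n" using n0 that by linarith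
          then have "1 < real n * infdist y C" using pos by (simp add: divide_less_eq)
          then show ?thesis by (simp add: cutoff_def)
        qed
        then have "\<forall>\<^sub>F n in sequentially. cutoff C n y = indicat_real C y"
          using False by (auto simp: eventually_sequentially)
        then show ?thesis by (rule tendsto_eventually)
      qed
    qed
    show "AE y in \<mu>. norm (cutoff C n y) \<le> 1" for n
      by (intro AE_I2) (auto simp: cutoff_def infdist_nonneg)
  qed simp
  then show ?thesis using C ProbD[OF \<mu>] by simp
qed

lemma prob_eq_continuous_test:
  fixes \<mu> \<nu> :: "'y::metric_space measure"
  assumes P: "\<mu> \<in> Prob" "\<nu> \<in> Prob"
    and eq: "\<And>g :: 'y \<Rightarrow> real. continuous_on UNIV g \<Longrightarrow> (\<integral>y. g y \<partial>\<mu>) = (\<integral>y. g y \<partial>\<nu>)"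
  shows "\<mu> = \<nu>"
proof -
  interpret m: prob_space \<mu> using ProbD[OF P(1)] by simp
  interpret n: prob_space \<nu> using ProbD[OF P(2)] by simp
  show ?thesis
  proof (rule measure_eqI_generator_eq[where E = "Collect closed" and \<Omega> = UNIV and A = "\<lambda>_. UNIV"])
    show "Int_stable (Collect closed)" by (auto simp: Int_stable_def)
    show "sets \<mu> = sigma_sets UNIV (Collect closed)" "sets \<nu> = sigma_sets UNIV (Collect closed)"
      using ProbD[OF P(1)] ProbD[OF P(2)] by (simp_all add: borel_eq_closed)
    fix C :: "'y set" assume "C \<in> Collect closed"
    then have C: "closed C" by simp
    show "emeasure \<mu> C = emeasure \<nu> C"
    proof (cases "C = {}")
      case False
      have "measure \<mu> C = measure \<nu> C"
        using integral_cutoff_tendsto[OF C False P(1)] integral_cutoff_tendsto[OF C False P(2)]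
        by (simp add: eq[OF continuous_cutoff] LIMSEQ_unique)
      then show ?thesis by (simp add: m.emeasure_eq_measure n.emeasure_eq_measure)
    qed simp
  qed auto
qed

text \<open>Masses of closed sets are limits of integrals of cutoffs, hence measurable in the
  parameter, and closed sets form an intersection-stable generator.\<close>

lemma prob_measurable_continuous_test:
  fixes K :: "'n \<Rightarrow> 'y::metric_space measure"
  assumes P: "\<And>a. a \<in> space N \<Longrightarrow> K a \<in> Prob"
    and meas: "\<And>g :: 'y \<Rightarrow> real. continuous_on UNIV g \<Longrightarrow> (\<lambda>a. \<integral>y. g y \<partial>K a) \<in> borel_measurable N"
  shows "K \<in> N \<rightarrow>\<^sub>M prob_algebra borel"
proof (rule measurable_prob_algebra_generated)
  show "sets borel = sigma_sets (UNIV :: 'y set) (Collect closed)" by (simp add: borel_eq_closed)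
  show "Int_stable (Collect closed :: 'y set set)" by (auto simp: Int_stable_def)
  fix C :: "'y set" assume "C \<in> Collect closed"
  then have C: "closed C" by simp
  have "(\<lambda>a. measure (K a) C) \<in> borel_measurable N"
  proof (cases "C = {}")
    case False
    show ?thesis
      by (rule borel_measurable_LIMSEQ_real[OF integral_cutoff_tendsto[OF C False P] meas[OF continuous_cutoff]])
  qed simp
  then have "(\<lambda>a. ennreal (measure (K a) C)) \<in> borel_measurable N" by simp
  moreover have "emeasure (K a) C = ennreal (measure (K a) C)" if "a \<in> space N" for a
  proof -
    interpret prob_space "K a" using ProbD[OF P[OF that]] by simp
    show ?thesis by (rule emeasure_eq_measure)
  qed
  ultimately show "(\<lambda>a. emeasure (K a) C) \<in> borel_measurable N"
    by (simp cong: measurable_cong)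
qed (use P ProbD in auto)

context comp_metric
begin

lemma Wd_continuous_test:
  fixes g :: "'y \<Rightarrow> real"
  assumes g: "continuous_on UNIV g" and e: "0 < e"
  shows "\<exists>\<delta>>0. \<forall>\<mu>\<in>Prob. \<forall>\<nu>\<in>Prob. Wd \<mu> \<nu> < \<delta> \<longrightarrow> \<bar>(\<integral>y. g y \<partial>\<mu>) - (\<integral>y. g y \<partial>\<nu>)\<bar> < e"
proof -
  have "uniformly_continuous_on UNIV g"
    by (rule compact_uniformly_continuous[OF g comp])
  then obtain d where d: "0 < d" "\<And>x y. dist x y < d \<Longrightarrow> \<bar>g x - g y\<bar> < e/2"
    unfolding uniformly_continuous_on_def dist_real_def using e by (meson UNIV_I half_gt_zero)
  have "compact (range g)" using compact_continuous_image[OF g comp] .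
  then obtain B where B: "0 < B" "\<And>x. \<bar>g x\<bar> \<le> B"
    using compact_imp_bounded[of "range g"] unfolding bounded_pos by auto
  have [measurable]: "g \<in> borel_measurable borel" by (rule borel_measurable_continuous_onI[OF g])
  \<comment> \<open>Close points are handled by uniform continuity. Points at distance at least
    \<open>d\<close> satisfy \<open>2 * B \<le> (2*B/d) * \<rho> x y\<close>, so the crude bound
    \<open>2 * B\<close> is absorbed by the cost.\<close>
  have ptw: "\<bar>g x - g y\<bar> \<le> e/2 + (2*B/d) * \<rho> x y" for x y
  proof (cases "dist x y < d")
    case True
    have "0 \<le> (2*B/d) * \<rho> x y" using B d by simp
    then show ?thesis using d(2)[OF True] by linarith
  next
    case False
    then have "d \<le> \<rho> x y" using lo[of x y] by simp
    then have "(2*B/d) * d \<le> (2*B/d) * \<rho> x y" using B d by (intro mult_left_mono) auto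
    then have "2 * B \<le> (2*B/d) * \<rho> x y" using d by simp
    then show ?thesis using B(2)[of x] B(2)[of y] e by linarith
  qed
  show ?thesis
  \<comment> \<open>With this radius the cost term \<open>(2*B/d) * \<rho>\<close> integrates to
    less than \<open>e/2\<close>.\<close>
  proof (intro exI[of _ "e * d / (4 * B)"] conjI ballI impI)
    show "0 < e * d / (4 * B)" using e d B by simp
    fix \<mu> \<nu> :: "'y measure" assume P: "\<mu> \<in> Prob" "\<nu> \<in> Prob" and l: "Wd \<mu> \<nu> < e * d / (4 * B)"
    then have "0 < e * d / (4 * B) - Wd \<mu> \<nu>" by simp
    from Wd_coupling[OF P this] obtain \<gamma> where \<gamma>: "prob_space \<gamma>"
      and [measurable_cong]: "sets \<gamma> = sets (borel \<Otimes>\<^sub>M borel)"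
      and m: "distr \<gamma> borel fst = \<mu>" "distr \<gamma> borel snd = \<nu>"
      and l: "(\<integral>p. \<rho> (fst p) (snd p) \<partial>\<gamma>) < e * d / (4 * B)" by auto
    interpret \<gamma>: prob_space \<gamma> by fact
    have int: "integrable \<gamma> (\<lambda>p. g (fst p))" "integrable \<gamma> (\<lambda>p. g (snd p))"
      using B by (auto intro!: \<gamma>.integrable_const_bound[where B=B])
    have int': "integrable \<gamma> (\<lambda>p. \<rho> (fst p) (snd p))"
      by (intro rho_integrable \<gamma>.finite_measure_axioms) auto
    have "(\<integral>y. g y \<partial>\<mu>) - (\<integral>y. g y \<partial>\<nu>) = (\<integral>p. g (fst p) - g (snd p) \<partial>\<gamma>)"
      unfolding m[symmetric] by (subst (1 2) integral_distr) (auto simp: int)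
    then have "\<bar>(\<integral>y. g y \<partial>\<mu>) - (\<integral>y. g y \<partial>\<nu>)\<bar> \<le> (\<integral>p. \<bar>g (fst p) - g (snd p)\<bar> \<partial>\<gamma>)"
      by (simp add: integral_abs_bound)
    also have "\<dots> \<le> (\<integral>p. e/2 + (2*B/d) * \<rho> (fst p) (snd p) \<partial>\<gamma>)"
      by (intro integral_mono ptw integrable_abs Bochner_Integration.integrable_diff
          Bochner_Integration.integrable_add int integrable_mult_right int') auto
    also have "\<dots> = e/2 + (2*B/d) * (\<integral>p. \<rho> (fst p) (snd p) \<partial>\<gamma>)"
      using int' by (subst Bochner_Integration.integral_add) (auto simp: \<gamma>.prob_space)
    also have "\<dots> < e/2 + (2*B/d) * (e * d / (4 * B))"
      using l B d by (intro add_strict_left_mono mult_strict_left_mono) auto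
    also have "\<dots> = e" using B d by (simp add: field_simps)
    finally show "\<bar>(\<integral>y. g y \<partial>\<mu>) - (\<integral>y. g y \<partial>\<nu>)\<bar> < e" .
  qed
qed

lemma Wd_zeroD:
  assumes P: "\<mu> \<in> Prob" "\<nu> \<in> Prob" and z: "Wd \<mu> \<nu> = 0"
  shows "\<mu> = \<nu>"
proof (rule prob_eq_continuous_test[OF P])
  fix g :: "'y \<Rightarrow> real" assume g: "continuous_on UNIV g"
  have "\<bar>(\<integral>y. g y \<partial>\<mu>) - (\<integral>y. g y \<partial>\<nu>)\<bar> < e" if "0 < e" for e
    using Wd_continuous_test[OF g that] P z by auto
  then have "\<bar>(\<integral>y. g y \<partial>\<mu>) - (\<integral>y. g y \<partial>\<nu>)\<bar> \<le> 0"
    by (meson not_le less_irrefl)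
  then show "(\<integral>y. g y \<partial>\<mu>) = (\<integral>y. g y \<partial>\<nu>)" by simp
qed

sublocale Wm: Metric_space Prob Wd
proof
  show "Wd \<mu> \<nu> = Wd \<nu> \<mu>" for \<mu> \<nu> by (rule Wd_commute)
  show "(Wd \<mu> \<nu> = 0) = (\<mu> = \<nu>)" if "\<mu> \<in> Prob" "\<nu> \<in> Prob" for \<mu> \<nu>
    using Wd_zeroD[OF that] Wd_self[OF that(1)] by blast
qed (fact Wd_nonneg Wd_triangle)+

lemma space_wass_borel[simp]: "space (wass_borel \<rho>) = Prob"
  unfolding wass_borel_def by (rule space_measure_of) (use Wm.openin_mtopology in auto)

lemma sets_wass_borel: "sets (wass_borel \<rho>) = sigma_sets Prob {B. openin Wm.mtopology B}"
  unfolding wass_borel_def by (rule sets_measure_of) (use Wm.openin_mtopology in auto)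

lemma openin_wass_borel: "openin Wm.mtopology U \<Longrightarrow> U \<in> sets (wass_borel \<rho>)"
  by (simp add: sets_wass_borel)

lemma closedin_wass_borel:
  assumes "closedin Wm.mtopology C" shows "C \<in> sets (wass_borel \<rho>)"
proof -
  have "openin Wm.mtopology (Prob - C)" "C \<subseteq> Prob"
    using assms by (auto simp: closedin_def)
  then have "space (wass_borel \<rho>) - (Prob - C) \<in> sets (wass_borel \<rho>)"
    by (intro sets.compl_sets openin_wass_borel)
  with \<open>C \<subseteq> Prob\<close> show ?thesis by (simp add: double_diff)
qed

lemma Wd_continuous_measurable:
  fixes \<phi> :: "'y measure \<Rightarrow> real"
  assumes c: "\<And>\<mu> e. \<mu> \<in> Prob \<Longrightarrow> 0 < e \<Longrightarrow> \<exists>\<delta>>0. \<forall>\<nu>\<in>Prob. Wd \<mu> \<nu> < \<delta> \<longrightarrow> \<bar>\<phi> \<mu> - \<phi> \<nu>\<bar> < e"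
  shows "\<phi> \<in> borel_measurable (wass_borel \<rho>)"
proof (rule borel_measurableI)
  fix S :: "real set" assume S: "open S"
  show "\<phi> -` S \<inter> space (wass_borel \<rho>) \<in> sets (wass_borel \<rho>)"
  proof (rule openin_wass_borel, unfold Wm.openin_mtopology, intro conjI allI impI)
    fix \<mu> assume \<mu>: "\<mu> \<in> \<phi> -` S \<inter> space (wass_borel \<rho>)"
    then obtain e where "0 < e" "ball (\<phi> \<mu>) e \<subseteq> S" using S openE by auto
    moreover obtain \<delta> where "0 < \<delta>" "\<forall>\<nu>\<in>Prob. Wd \<mu> \<nu> < \<delta> \<longrightarrow> \<bar>\<phi> \<mu> - \<phi> \<nu>\<bar> < e"
      using c[of \<mu> e] \<mu> \<open>0 < e\<close> by auto
    ultimately show "\<exists>r>0. Wm.mball \<mu> r \<subseteq> \<phi> -` S \<inter> space (wass_borel \<rho>)"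
      by (intro exI[of _ \<delta>]) (auto simp: dist_real_def subset_iff)
  qed auto
qed

text \<open>One inclusion between the two \<sigma>-algebras on laws: integrals of continuous
  functions are Wasserstein continuous.\<close>

lemma wass_borel_to_prob_algebra: "(\<lambda>\<mu>. \<mu>) \<in> wass_borel \<rho> \<rightarrow>\<^sub>M prob_algebra borel"
proof (rule prob_measurable_continuous_test)
  fix g :: "'y \<Rightarrow> real" assume g: "continuous_on UNIV g"
  show "(\<lambda>\<mu>. \<integral>y. g y \<partial>\<mu>) \<in> borel_measurable (wass_borel \<rho>)"
    using Wd_continuous_test[OF g] by (intro Wd_continuous_measurable) meson
qed auto

end

text \<open>Skorohod representation of the images under the encoding turns weak convergence into
  convergence of couplings.\<close>
lemma (in comp_metric) weak_conv_imp_Wd_tendsto: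
  fixes \<theta> :: "'y \<Rightarrow> real"
  assumes \<theta>[measurable]: "\<theta> \<in> borel_measurable borel" and D[measurable]: "D \<in> borel \<rightarrow>\<^sub>M borel"
    and K: "compact K" "range \<theta> \<subseteq> K" and Dc: "continuous_on K D" and inv: "\<And>y. D (\<theta> y) = y"
    and P: "\<And>n. \<mu> n \<in> Prob" and \<nu>: "real_distribution \<nu>"
    and conv: "weak_conv_m (\<lambda>n. distr (\<mu> n) borel \<theta>) \<nu>"
  shows "distr \<nu> borel D \<in> Prob" "(\<lambda>n. Wd (\<mu> n) (distr \<nu> borel D)) \<longlonglongrightarrow> 0"
proof -
  interpret \<nu>: real_distribution \<nu> by fact
  show PD: "distr \<nu> borel D \<in> Prob" by (rule Prob_distr) (auto intro: \<nu>.prob_space_axioms)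
  have ms: "sets (\<mu> n) = sets borel" for n using ProbD[OF P] by simp
  have \<theta>'[measurable]: "\<theta> \<in> borel_measurable (\<mu> n)" for n using \<theta> ms measurable_cong_sets by blast
  have rd: "real_distribution (distr (\<mu> n) borel \<theta>)" for n
    by (rule prob_space.real_distribution_distr) (use ProbD[OF P] \<theta>' in auto)
  from Skorohod[OF rd \<nu> conv] obtain \<Omega> :: "real measure" and Ys Y where \<Omega>: "prob_space \<Omega>"
    and Ys[measurable]: "\<And>n. Ys n \<in> borel_measurable \<Omega>" and Ysd: "\<And>n. distr \<Omega> borel (Ys n) = distr (\<mu> n) borel \<theta>"
    and "Y \<in> \<Omega> \<rightarrow>\<^sub>M lborel" and Yd: "distr \<Omega> borel Y = \<nu>"
    and lim: "\<And>x. x \<in> space \<Omega> \<Longrightarrow> (\<lambda>n. Ys n x) \<longlonglongrightarrow> Y x" by blast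
  then have Y[measurable]: "Y \<in> borel_measurable \<Omega>" by simp
  interpret \<Omega>: prob_space \<Omega> by fact
  have clK: "closed K" using K compact_imp_closed by blast
  \<comment> \<open>The Skorohod variables have the encoded laws, so they live in \<open>K\<close>
    almost surely; closedness puts their limit into \<open>K\<close> as well, where the decoder is
    continuous.\<close>
  have "AE x in \<Omega>. Ys n x \<in> K" for n
  proof -
    have "AE x in distr (\<mu> n) borel \<theta>. x \<in> K"
      using K clK by (subst AE_distr_iff) (auto simp: image_subset_iff)
    then show ?thesis unfolding Ysd[symmetric] using clK by (subst (asm) AE_distr_iff) auto
  qed
  then have ae: "AE x in \<Omega>. \<forall>n. Ys n x \<in> K" by (simp add: AE_all_countable)
  have "distr \<Omega> borel (\<lambda>x. D (Ys n x)) = \<mu> n" for n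
  proof -
    have "distr \<Omega> borel (\<lambda>x. D (Ys n x)) = distr (distr \<Omega> borel (Ys n)) borel D"
      by (simp add: distr_distr comp_def)
    also have "\<dots> = distr (\<mu> n) borel (\<lambda>x. x)"
      unfolding Ysd by (subst distr_distr) (auto simp: comp_def inv)
    also have "\<dots> = \<mu> n" by (rule distr_id2) (simp add: ms)
    finally show ?thesis .
  qed
  moreover have "distr \<Omega> borel (\<lambda>x. D (Y x)) = distr \<nu> borel D"
    unfolding Yd[symmetric] by (simp add: distr_distr comp_def)
  ultimately have le: "Wd (\<mu> n) (distr \<nu> borel D) \<le> (\<integral>x. \<rho> (D (Ys n x)) (D (Y x)) \<partial>\<Omega>)" for n
    using Wd_le[OF \<Omega>, of "\<lambda>x. D (Ys n x)" "\<lambda>x. D (Y x)"] by simp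
  obtain B where B: "\<And>x y. \<rho> x y \<le> B" using rho_bounded by auto
  have "(\<lambda>n. \<integral>x. \<rho> (D (Ys n x)) (D (Y x)) \<partial>\<Omega>) \<longlonglongrightarrow> (\<integral>x. 0 \<partial>\<Omega>)"
  proof (rule integral_dominated_convergence[where w = "\<lambda>_. B"])
    show "AE x in \<Omega>. (\<lambda>n. \<rho> (D (Ys n x)) (D (Y x))) \<longlonglongrightarrow> 0"
      using ae AE_space
    proof eventually_elim
      case (elim x)
      have YK: "Y x \<in> K" using closed_sequentially[OF clK _ lim] elim by auto
      have "(\<lambda>n. D (Ys n x)) \<longlonglongrightarrow> D (Y x)"
        using continuous_on_tendsto_compose[OF Dc lim YK] elim by auto
      then have "(\<lambda>n. 2 * dist (D (Ys n x)) (D (Y x))) \<longlonglongrightarrow> 2 * 0"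
        by (intro tendsto_mult tendsto_const) (simp add: tendsto_dist_iff[symmetric])
      then have "(\<lambda>n. 2 * dist (D (Ys n x)) (D (Y x))) \<longlonglongrightarrow> 0" by simp
      then show ?case by (rule Lim_null_comparison[rotated]) (use hi in \<open>auto intro!: always_eventually\<close>)
    qed
  qed (auto simp: B)
  then have "(\<lambda>n. \<integral>x. \<rho> (D (Ys n x)) (D (Y x)) \<partial>\<Omega>) \<longlonglongrightarrow> 0" by simp
  then show "(\<lambda>n. Wd (\<mu> n) (distr \<nu> borel D)) \<longlonglongrightarrow> 0"
    by (rule Lim_null_comparison[rotated]) (use le Wd_nonneg in \<open>auto intro!: always_eventually\<close>)
qed

lemma (in comp_metric) compact_Prob: "compact_space Wm.mtopology"
  unfolding Wm.compact_space_sequentially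
proof (intro allI impI)
  fix \<sigma> :: "nat \<Rightarrow> 'y measure" assume "range \<sigma> \<subseteq> Prob"
  then have P: "\<sigma> n \<in> Prob" for n by auto
  obtain \<theta> :: "'y \<Rightarrow> real" and D K where enc: "\<theta> \<in> borel_measurable borel" "D \<in> borel \<rightarrow>\<^sub>M borel" "compact K" "range \<theta> \<subseteq> K"
    "continuous_on K D" "\<And>y. D (\<theta> y) = y"
    using compact_encoding[OF comp] by blast
  define m where "m n = distr (\<sigma> n) borel \<theta>" for n
  have \<theta>'[measurable]: "\<theta> \<in> borel_measurable (\<sigma> n)" for n using enc(1) ProbD[OF P[of n]] measurable_cong_sets by blast
  have rd: "real_distribution (m n)" for n unfolding m_def
    by (rule prob_space.real_distribution_distr) (use ProbD[OF P] \<theta>' in auto)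
  obtain b where b: "0 < b" "\<And>x. x \<in> K \<Longrightarrow> \<bar>x\<bar> \<le> b"
    using compact_imp_bounded[OF enc(3)] unfolding bounded_pos by auto
  have "tight m"
    unfolding tight_def
  proof (intro conjI allI impI)
    fix e :: real assume "0 < e"
    show "\<exists>a c. a < c \<and> (\<forall>n. measure (m n) {a<..c} > 1 - e)"
    \<comment> \<open>The interval is open on the left, so its end must lie strictly below
      \<open>- b\<close>. It carries all the mass of every encoded law, which gives
      tightness.\<close>
    proof (rule exI[of _ "- b - 1"], rule exI[of _ b], intro conjI allI)
      show "- b - 1 < b" using b by simp
      fix n
      interpret prob_space "\<sigma> n" using ProbD[OF P[of n]] by simp
      have "\<bar>\<theta> y\<bar> \<le> b" for y using enc(4) b by (auto simp: image_subset_iff)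
      then have "- b - 1 < \<theta> y \<and> \<theta> y \<le> b" for y by (smt (verit))
      then have "\<theta> -` {- b - 1<..b} \<inter> space (\<sigma> n) = space (\<sigma> n)"
        by auto
      then have "measure (m n) {- b - 1<..b} = 1"
        unfolding m_def by (simp add: measure_distr prob_space)
      then show "1 - e < measure (m n) {- b - 1<..b}" using \<open>0 < e\<close> by simp
    qed
  qed (rule rd)
  from tight_imp_convergent_subsubsequence[OF this strict_mono_id] obtain r \<nu> where r: "strict_mono r"
    and \<nu>: "real_distribution \<nu>" and conv: "weak_conv_m (m \<circ> id \<circ> r) \<nu>" by blast
  have conv': "weak_conv_m (\<lambda>n. distr (\<sigma> (r n)) borel \<theta>) \<nu>" using conv by (simp add: m_def comp_def)
  note w = weak_conv_imp_Wd_tendsto[OF enc(1-6) P \<nu> conv']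
  show "\<exists>l r. l \<in> Prob \<and> strict_mono r \<and> limitin Wm.mtopology (\<sigma> \<circ> r) l sequentially"
    using w r P by (intro exI[of _ "distr \<nu> borel D"] exI[of _ r])
      (auto simp: Wm.limit_metric_sequentially lim_sequentially Wd_nonneg abs_of_nonneg)
qed

section \<open>The two \<sigma>-algebras on probability measures coincide\<close>

lemma weak_conv_m_rationals:
  assumes M: "\<And>n. real_distribution (M n)" and N: "real_distribution N"
    and conv: "\<And>q. q \<in> \<rat> \<Longrightarrow> (\<lambda>n. cdf (M n) q) \<longlonglongrightarrow> cdf N q"
  shows "weak_conv_m M N"
  unfolding weak_conv_m_def weak_conv_def
proof (intro allI impI)
  fix x :: real assume c: "isCont (cdf N) x"
  then have t: "(cdf N \<longlongrightarrow> cdf N x) (at x)" by (simp add: isCont_def)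
  have mono: "cdf (M n) y \<le> cdf (M n) z" if "y \<le> z" for n y z
    using real_distribution.finite_borel_measure_M[OF M[of n]] that
    by (rule finite_borel_measure.cdf_nondecreasing)
  \<comment> \<open>Distribution functions are monotone, so the value at a continuity point is
    squeezed between the values at rationals close to it on either side.\<close>
  show "(\<lambda>n. cdf (M n) x) \<longlonglongrightarrow> cdf N x"
  proof (rule order_tendstoI)
    fix a assume "a < cdf N x"
    with t have "\<forall>\<^sub>F y in at x. a < cdf N y" by (rule order_tendstoD)
    then obtain d where d: "0 < d" "\<And>y. y \<noteq> x \<Longrightarrow> dist y x < d \<Longrightarrow> a < cdf N y"
      unfolding eventually_at by auto
    obtain q where q: "q \<in> \<rat>" "x - d < q" "q < x" using Rats_dense_in_real[of "x - d" x] d by auto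
    then have "a < cdf N q" by (intro d) (auto simp: dist_real_def)
    with conv[OF q(1)] have "\<forall>\<^sub>F n in sequentially. a < cdf (M n) q" by (rule order_tendstoD)
    then show "\<forall>\<^sub>F n in sequentially. a < cdf (M n) x"
      by eventually_elim (use mono[of q x] q in \<open>meson less_le_trans less_imp_le\<close>)
  next
    fix a assume "cdf N x < a"
    with t have "\<forall>\<^sub>F y in at x. cdf N y < a" by (rule order_tendstoD)
    then obtain d where d: "0 < d" "\<And>y. y \<noteq> x \<Longrightarrow> dist y x < d \<Longrightarrow> cdf N y < a"
      unfolding eventually_at by auto
    obtain q where q: "q \<in> \<rat>" "x < q" "q < x + d" using Rats_dense_in_real[of x "x + d"] d by auto
    then have "cdf N q < a" by (intro d) (auto simp: dist_real_def)
    with conv[OF q(1)] have "\<forall>\<^sub>F n in sequentially. cdf (M n) q < a" by (rule order_tendstoD)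
    then show "\<forall>\<^sub>F n in sequentially. cdf (M n) x < a"
      by eventually_elim (use mono[of x q] q in \<open>meson le_less_trans less_imp_le\<close>)
  qed
qed

text \<open>The map \<open>w\<close> records countably many masses, so it is measurable into a
  sequence space. Convergence of these masses already forces Wasserstein convergence; hence a
  Wasserstein-open set is the preimage under \<open>w\<close> of an open set of sequences.\<close>

lemma (in comp_metric) openin_imp_prob_algebra:
  assumes U: "openin Wm.mtopology U"
  shows "U \<in> sets (prob_algebra borel)"
proof -
  obtain \<theta> :: "'y \<Rightarrow> real" and D K where enc: "\<theta> \<in> borel_measurable borel" "D \<in> borel \<rightarrow>\<^sub>M borel" "compact K" "range \<theta> \<subseteq> K"
    "continuous_on K D" "\<And>y. D (\<theta> y) = y"
    using compact_encoding[OF comp] by blast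
  note [measurable] = enc(1,2)
  define q where "q = from_nat_into (\<rat> :: real set)"
  have q: "range q = \<rat>" unfolding q_def by (rule range_from_nat_into) (auto simp: countable_rat)
  define w :: "'y measure \<Rightarrow> nat \<Rightarrow> real" where "w \<mu> n = measure \<mu> {y. \<theta> y \<le> q n}" for \<mu> n
  have \<theta>'[measurable]: "\<theta> \<in> borel_measurable \<mu>" if "\<mu> \<in> Prob" for \<mu>
    using enc(1) ProbD[OF that] measurable_cong_sets by blast
  have rd: "real_distribution (distr \<mu> borel \<theta>)" if "\<mu> \<in> Prob" for \<mu>
    by (rule prob_space.real_distribution_distr) (use ProbD[OF that] \<theta>'[OF that] in auto)
  have w_cdf: "w \<mu> n = cdf (distr \<mu> borel \<theta>) (q n)" if "\<mu> \<in> Prob" for \<mu> n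
    using \<theta>'[OF that] ProbD[OF that]
    by (auto simp: w_def cdf_def measure_distr vimage_def)
  have key: "\<exists>V. open V \<and> w \<mu> \<in> V \<and> (\<forall>\<nu>\<in>Prob. w \<nu> \<in> V \<longrightarrow> \<nu> \<in> U)" if \<mu>: "\<mu> \<in> U" for \<mu>
  proof (rule ccontr)
    assume "\<not> ?thesis"
    then have neg: "\<And>V. open V \<Longrightarrow> w \<mu> \<in> V \<Longrightarrow> \<exists>\<nu>\<in>Prob. w \<nu> \<in> V \<and> \<nu> \<notin> U" by blast
    have P\<mu>: "\<mu> \<in> Prob" using U \<mu> Wm.openin_mtopology by auto
    \<comment> \<open>The sequence space is first countable: if no neighbourhood of
      \<open>w \<mu>\<close> worked, a sequence outside \<open>U\<close> would have masses
      converging to those of \<mu>, hence would converge to \<mu>.\<close>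
    from countable_basis_at_decseq[of "w \<mu>"] obtain A where A:
      "\<And>i. open (A i)" "\<And>i. w \<mu> \<in> A i"
      "\<And>S. open S \<Longrightarrow> w \<mu> \<in> S \<Longrightarrow> eventually (\<lambda>i. A i \<subseteq> S) sequentially"
      by blast
    have "\<exists>\<nu>\<in>Prob. w \<nu> \<in> A i \<and> \<nu> \<notin> U" for i using neg[OF A(1,2)] .
    then obtain \<nu> where \<nu>: "\<And>i. \<nu> i \<in> Prob" "\<And>i. w (\<nu> i) \<in> A i" "\<And>i. \<nu> i \<notin> U" by metis
    have "(\<lambda>i. w (\<nu> i)) \<longlonglongrightarrow> w \<mu>"
    proof (rule topological_tendstoI)
      fix S assume "open S" "w \<mu> \<in> S"
      from A(3)[OF this] show "\<forall>\<^sub>F i in sequentially. w (\<nu> i) \<in> S"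
        by eventually_elim (use \<nu>(2) in auto)
    qed
    then have "(\<lambda>i. w (\<nu> i) n) \<longlonglongrightarrow> w \<mu> n" for n
      using continuous_on_tendsto_compose[OF continuous_on_product_coordinates] by fastforce
    then have "(\<lambda>i. cdf (distr (\<nu> i) borel \<theta>) (q n)) \<longlonglongrightarrow> cdf (distr \<mu> borel \<theta>) (q n)" for n
      by (simp add: w_cdf P\<mu> \<nu>(1))
    then have "(\<lambda>i. cdf (distr (\<nu> i) borel \<theta>) r) \<longlonglongrightarrow> cdf (distr \<mu> borel \<theta>) r" if "r \<in> \<rat>" for r
      using that unfolding q[symmetric] by auto
    then have "weak_conv_m (\<lambda>i. distr (\<nu> i) borel \<theta>) (distr \<mu> borel \<theta>)"
      by (intro weak_conv_m_rationals rd P\<mu> \<nu>(1))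
    from weak_conv_imp_Wd_tendsto(2)[OF enc(1-6) \<nu>(1) rd[OF P\<mu>] this]
    have "(\<lambda>i. Wd (\<nu> i) (distr (distr \<mu> borel \<theta>) borel D)) \<longlonglongrightarrow> 0" .
    moreover have "distr (distr \<mu> borel \<theta>) borel D = distr \<mu> borel (\<lambda>x. x)"
      using \<theta>'[OF P\<mu>] by (subst distr_distr) (auto simp: comp_def enc(6))
    moreover have "distr \<mu> borel (\<lambda>x. x) = \<mu>" using ProbD[OF P\<mu>] by (intro distr_id2) auto
    ultimately have lim: "(\<lambda>i. Wd (\<nu> i) \<mu>) \<longlonglongrightarrow> 0" by simp
    obtain r where r: "0 < r" "Wm.mball \<mu> r \<subseteq> U" using U \<mu> Wm.openin_mtopology by auto
    from lim r have "\<forall>\<^sub>F i in sequentially. Wd (\<nu> i) \<mu> < r" by (intro order_tendstoD(2))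
    then obtain i where "Wd (\<nu> i) \<mu> < r" by (meson eventually_happens' sequentially_bot)
    then have "\<nu> i \<in> Wm.mball \<mu> r" using \<nu>(1) P\<mu> by (simp add: Wd_commute)
    with r \<nu>(3) show False by auto
  qed
  \<comment> \<open>The largest open set whose preimage among the probability measures stays in
    \<open>U\<close>.\<close>
  define G where "G = \<Union>{V. open V \<and> (\<forall>\<nu>\<in>Prob. w \<nu> \<in> V \<longrightarrow> \<nu> \<in> U)}"
  have "U \<subseteq> Prob" using U Wm.openin_mtopology by auto
  then have "U = w -` G \<inter> space (prob_algebra borel)"
  proof (intro equalityI subsetI)
    fix \<mu> assume "\<mu> \<in> U"
    with key[OF this] \<open>U \<subseteq> Prob\<close> show "\<mu> \<in> w -` G \<inter> space (prob_algebra borel)"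
      unfolding G_def by blast
  qed (auto simp: G_def)
  moreover have "w \<in> borel_measurable (prob_algebra borel)"
    unfolding w_def by (rule measurable_coordinatewise_then_product) measurable
  moreover have "open G" unfolding G_def by auto
  ultimately show ?thesis by (metis borel_open measurable_sets)
qed

text \<open>The bridge between coefficients, given as measurable for Wasserstein-Borel sets, and
  kernels, which take values in \<open>prob_algebra\<close>.\<close>

lemma (in comp_metric) sets_wass_borel_eq: "sets (wass_borel \<rho>) = sets (prob_algebra borel)"
proof
  show "sets (wass_borel \<rho>) \<subseteq> sets (prob_algebra borel)"
    unfolding sets_wass_borel
    by (rule sets.sigma_sets_subset) (auto intro: openin_imp_prob_algebra)
  show "sets (prob_algebra borel) \<subseteq> sets (wass_borel \<rho>)"
  proof
    fix A :: "'y measure set" assume A: "A \<in> sets (prob_algebra borel)"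
    from measurable_sets[OF wass_borel_to_prob_algebra this] sets.sets_into_space[OF A]
    show "A \<in> sets (wass_borel \<rho>)" by (simp add: Int_absorb2 vimage_def)
  qed
qed

section \<open>Measurable selection\<close>

lemma (in Metric_space) dense_sequence:
  assumes comp: "compact_space mtopology" and ne: "M \<noteq> {}"
  obtains z :: "nat \<Rightarrow> 'a" where "\<And>i. z i \<in> M" "\<And>x e. x \<in> M \<Longrightarrow> 0 < e \<Longrightarrow> \<exists>i. d (z i) x < e"
proof -
  have "mtotally_bounded M"
    using compact_space_eq_mcomplete_mtotally_bounded comp by simp
  then have "\<exists>K. finite K \<and> K \<subseteq> M \<and> M \<subseteq> (\<Union>x\<in>K. mball x (inverse (Suc n)))" for n
    unfolding mtotally_bounded_def by (metis of_nat_0_less_iff positive_imp_inverse_positive zero_less_Suc)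
  then obtain F where F: "\<And>n. finite (F n)" "\<And>n. F n \<subseteq> M"
    "\<And>n. M \<subseteq> (\<Union>x\<in>F n. mball x (inverse (Suc n)))" by metis
  define Z where "Z = (\<Union>n. F n)"
  have Z: "countable Z" "Z \<subseteq> M" unfolding Z_def using F by (auto intro: countable_finite)
  have dense: "\<exists>z\<in>Z. d z x < e" if "x \<in> M" "0 < e" for x e
  proof -
    obtain n where n: "inverse (real (Suc n)) < e" using reals_Archimedean[OF \<open>0 < e\<close>] by auto
    obtain z where "z \<in> F n" "x \<in> mball z (inverse (Suc n))" using subsetD[OF F(3)[of n] \<open>x \<in> M\<close>] by (rule UN_E)
    then show ?thesis using n unfolding Z_def by (intro bexI[of _ z]) auto
  qed
  have neZ: "Z \<noteq> {}" using dense[of _ 1] ne by fastforce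
  show ?thesis
  proof
    show "from_nat_into Z i \<in> M" for i using from_nat_into[OF neZ] Z by auto
    show "\<exists>i. d (from_nat_into Z i) x < e" if "x \<in> M" "0 < e" for x e
      using dense[OF that] from_nat_into_surj[OF Z(1)] by metis
  qed
qed

text \<open>The value set at each parameter is cut down by the first ball of a shrinking cover that meets
  it. Each set stays compact and hits closed sets measurably; the sets shrink to the selected point.\<close>
lemma (in Metric_space) measurable_selection:
  fixes N :: "'n measure" and \<pi> :: "'a \<Rightarrow> 'n"
  assumes comp: "compact_space mtopology" and G: "closedin mtopology G"
    and meas: "\<And>C. closedin mtopology C \<Longrightarrow> C \<subseteq> G \<Longrightarrow> \<pi> ` C \<inter> space N \<in> sets N"
    and fib: "\<And>n. n \<in> space N \<Longrightarrow> closedin mtopology {x \<in> G. \<pi> x = n}"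
    and ne: "\<And>n. n \<in> space N \<Longrightarrow> \<exists>x\<in>G. \<pi> x = n"
  obtains s where "s \<in> N \<rightarrow>\<^sub>M sigma M {B. openin mtopology B}" "\<And>n. n \<in> space N \<Longrightarrow> s n \<in> G \<and> \<pi> (s n) = n"
proof (cases "M = {}")
  case True
  then have "space N = {}" using ne closedin_subset[OF G] unfolding topspace_mtopology by blast
  then show ?thesis using that[of "\<lambda>_. undefined"] by (auto simp: measurable_def)
next
  case False
  obtain z :: "nat \<Rightarrow> 'a" where z: "\<And>i. z i \<in> M" "\<And>x e. x \<in> M \<Longrightarrow> 0 < e \<Longrightarrow> \<exists>i. d (z i) x < e"
    using dense_sequence[OF comp False] by metis
  define \<epsilon> where "\<epsilon> k = (1/2::real)^k" for k
  define Bl where "Bl k i = mcball (z i) (\<epsilon> k)" for k i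
  define idx where "idx k S = (LEAST i. S \<inter> Bl k i \<noteq> {})" for k S
  define K where "K = (\<lambda>k n. rec_nat {x \<in> G. \<pi> x = n} (\<lambda>k S. S \<inter> Bl k (idx k S)) k)"
  have K0: "K 0 n = {x \<in> G. \<pi> x = n}" and KS: "K (Suc k) n = K k n \<inter> Bl k (idx k (K k n))" for k n
    unfolding K_def by simp_all
  have clB: "closedin mtopology (Bl k i)" for k i unfolding Bl_def by (rule closedin_mcball)
  have clK: "closedin mtopology (K k n)" if "n \<in> space N" for k n
    by (induction k) (auto simp: K0 KS fib that intro: closedin_Int clB)
  have KM: "K k n \<subseteq> M" if "n \<in> space N" for k n using closedin_subset[OF clK[OF that]] by simp
  have KG: "K k n \<subseteq> {x \<in> G. \<pi> x = n}" for k n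
    by (induction k) (auto simp: K0 KS)
  have hit: "\<exists>i. S \<inter> Bl k i \<noteq> {}" if "S \<noteq> {}" "S \<subseteq> M" for S k
  proof -
    obtain x where x: "x \<in> S" "x \<in> M" using \<open>S \<noteq> {}\<close> \<open>S \<subseteq> M\<close> by auto
    then obtain i where "d (z i) x < \<epsilon> k" using z(2)[of x "\<epsilon> k"] by (auto simp: \<epsilon>_def)
    then show ?thesis using x z unfolding Bl_def by (intro exI[of _ i]) force
  qed
  have neK: "K k n \<noteq> {}" if n: "n \<in> space N" for k n
  proof (induction k)
    case 0
    then show ?case using ne[OF n] by (auto simp: K0)
  next
    case (Suc k)
    show ?case unfolding KS idx_def by (rule LeastI_ex[OF hit[OF Suc KM[OF n]]])
  qed
  have dec: "decseq (\<lambda>k. K k n)" for n by (rule decseq_SucI) (auto simp: KS)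
  \<comment> \<open>The induction must run over all closed \<open>C\<close> at once, since the step
    from \<open>k\<close> to \<open>k + 1\<close> uses the claim for
    \<open>Bl k i \<inter> C\<close>.\<close>
  have measK: "{n \<in> space N. K k n \<inter> C \<noteq> {}} \<in> sets N" if "closedin mtopology C" for k C
    using that
  proof (induction k arbitrary: C)
    case 0
    have "{n \<in> space N. K 0 n \<inter> C \<noteq> {}} = \<pi> ` (G \<inter> C) \<inter> space N" by (auto simp: K0)
    then show ?case using meas[of "G \<inter> C"] closedin_Int[OF G 0] by simp
  next
    case (Suc k)
    have [measurable]: "{n \<in> space N. K k n \<inter> Bl k i \<noteq> {}} \<in> sets N" "{n \<in> space N. K k n \<inter> (Bl k i \<inter> C) \<noteq> {}} \<in> sets N" for i
      using Suc.IH[OF clB] Suc.IH[OF closedin_Int[OF clB Suc.prems]] by auto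
    \<comment> \<open>Splitting by the index \<open>i\<close> of the chosen ball: being the least
      index is a statement about which balls \<open>K k n\<close> hits, so the induction hypothesis
      applies to every piece.\<close>
    have "{n \<in> space N. K (Suc k) n \<inter> C \<noteq> {}} =
      {n \<in> space N. \<exists>i. (K k n \<inter> Bl k i \<noteq> {} \<and> (\<forall>j<i. \<not> K k n \<inter> Bl k j \<noteq> {})) \<and> K k n \<inter> (Bl k i \<inter> C) \<noteq> {}}"
    proof (intro Collect_cong conj_cong refl)
      fix n assume n: "n \<in> space N"
      have i: "(K k n \<inter> Bl k i \<noteq> {} \<and> (\<forall>j<i. \<not> K k n \<inter> Bl k j \<noteq> {})) \<longleftrightarrow> i = idx k (K k n)" for i
        using LeastI_ex[OF hit[OF neK[OF n, of k] KM[OF n], of k]]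
          not_less_Least[of _ "\<lambda>i. K k n \<inter> Bl k i \<noteq> {}"] unfolding idx_def
        by (metis (no_types, lifting) linorder_neqE_nat)
      show "(K (Suc k) n \<inter> C \<noteq> {}) = (\<exists>i. (K k n \<inter> Bl k i \<noteq> {} \<and> (\<forall>j<i. \<not> K k n \<inter> Bl k j \<noteq> {})) \<and> K k n \<inter> (Bl k i \<inter> C) \<noteq> {})"
        unfolding i by (auto simp: KS)
    qed
    also have "\<dots> \<in> sets N" by measurable
    finally show ?case .
  qed
  have nest: "\<exists>x. \<forall>k. x \<in> K k n \<inter> C" if n: "n \<in> space N" and C: "closedin mtopology C" and i: "\<And>k. K k n \<inter> C \<noteq> {}" for n C
  proof -
    have "(\<forall>k. closedin mtopology (K k n \<inter> C)) \<and> (\<forall>k. K k n \<inter> C \<noteq> {}) \<and> decseq (\<lambda>k. K k n \<inter> C)"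
    proof (intro conjI allI i closedin_Int clK[OF n] C)
      show "decseq (\<lambda>k. K k n \<inter> C)" using dec[of n] unfolding decseq_def by blast
    qed
    then have "\<Inter>(range (\<lambda>k. K k n \<inter> C)) \<noteq> {}"
      by (rule compact_space_nest[THEN iffD1, OF comp, THEN spec, THEN mp])
    then show ?thesis by auto
  qed
  define s where "s n = (SOME x. \<forall>k. x \<in> K k n)" for n
  have s: "s n \<in> K k n" if n: "n \<in> space N" for n k
  proof -
    have "closedin mtopology M" by (metis closedin_topspace topspace_mtopology)
    from nest[OF n this] have "\<exists>x. \<forall>k. x \<in> K k n"
      using neK[OF n] KM[OF n] by (metis Int_absorb2 Int_iff)
    then have "\<forall>k. s n \<in> K k n" unfolding s_def by (rule someI_ex)
    then show ?thesis by auto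
  qed
  \<comment> \<open>Two points that survive all cuts lie in common balls of radius
    \<open>\<epsilon> k\<close> for every \<open>k\<close>, so the choice operator in
    \<open>s\<close> has exactly one candidate.\<close>
  have uniq: "x = s n" if n: "n \<in> space N" and x: "\<And>k. x \<in> K k n" for x n
  proof -
    have xM: "x \<in> M" "s n \<in> M" using x[of 0] s[OF n, of 0] KM[OF n] by auto
    have "d x (s n) \<le> 2 * \<epsilon> k" for k
    proof -
      have "x \<in> Bl k (idx k (K k n))" "s n \<in> Bl k (idx k (K k n))"
        using x[of "Suc k"] s[OF n, of "Suc k"] by (auto simp: KS)
      then have "d (z (idx k (K k n))) x \<le> \<epsilon> k" "d (z (idx k (K k n))) (s n) \<le> \<epsilon> k" unfolding Bl_def by auto
      then show ?thesis using triangle''[of x "z (idx k (K k n))" "s n"] triangle[OF xM(1) z(1) xM(2)] commute by (smt (verit, best))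
    qed
    note le = this
    have "(\<lambda>k. 2 * \<epsilon> k) \<longlonglongrightarrow> 2 * 0" unfolding \<epsilon>_def
      by (intro tendsto_mult tendsto_const LIMSEQ_power_zero) simp
    then have "d x (s n) \<le> 2 * 0" by (rule LIMSEQ_le_const) (use le in blast)
    then have "d x (s n) \<le> 0" by simp
    then show ?thesis using xM by (metis nonneg order_antisym zero)
  qed
  \<comment> \<open>If every \<open>K k n\<close> meets \<open>C\<close>, compactness gives a common
    point of all \<open>K k n \<inter> C\<close>, and by uniqueness this is \<open>s n\<close>.
    Membership of \<open>s n\<close> in \<open>C\<close> thus becomes a countable intersection of
    hitting conditions.\<close>
  have cls: "{n \<in> space N. s n \<in> C} \<in> sets N" if C: "closedin mtopology C" for C
  proof -
    have "{n \<in> space N. s n \<in> C} = {n \<in> space N. \<forall>k. K k n \<inter> C \<noteq> {}}"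
    proof (intro Collect_cong conj_cong refl iffI)
      fix n assume n: "n \<in> space N"
      show "\<forall>k. K k n \<inter> C \<noteq> {}" if "s n \<in> C" using s[OF n] that by blast
      show "s n \<in> C" if "\<forall>k. K k n \<inter> C \<noteq> {}"
        using nest[OF n C] that uniq[OF n] by (metis Int_iff)
    qed
    also have "\<dots> = (\<Inter>k. {n \<in> space N. K k n \<inter> C \<noteq> {}})" by auto
    also have "\<dots> \<in> sets N" using measK[OF C] by auto
    finally show ?thesis .
  qed
  show ?thesis
  proof
    show "s \<in> N \<rightarrow>\<^sub>M sigma M {B. openin mtopology B}"
    proof (rule measurable_measure_of)
      show "{B. openin mtopology B} \<subseteq> Pow M" using openin_mtopology by auto
      show "s \<in> space N \<rightarrow> M" using s KM by blast
      fix U assume "U \<in> {B. openin mtopology B}"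
      then have U: "openin mtopology U" by simp
      then have "closedin mtopology (M - U)" by (metis closedin_diff closedin_topspace topspace_mtopology)
      from sets.compl_sets[OF cls[OF this]]
      have "space N - {n \<in> space N. s n \<in> M - U} \<in> sets N" .
      also have "space N - {n \<in> space N. s n \<in> M - U} = s -` U \<inter> space N"
        using s[of _ 0] KM[of _ 0] openin_subset[OF U] by auto
      finally show "s -` U \<inter> space N \<in> sets N" .
    qed
    show "s n \<in> G \<and> \<pi> (s n) = n" if "n \<in> space N" for n
      using s[OF that, of 0] by (auto simp: K0)
  qed
qed

section \<open>Jointly measurable conditional probabilities\<close>

text \<open>Attaching the parameter to the point turns a parametric integral into the integral of
  one fixed function against a kernel on the product.\<close>

lemma measurable_integral_kernel:
  fixes f :: "'n \<Rightarrow> 'z \<Rightarrow> real"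
  assumes \<kappa>: "\<kappa> \<in> N \<rightarrow>\<^sub>M prob_algebra Z" and f[measurable]: "(\<lambda>(n, z). f n z) \<in> borel_measurable (N \<Otimes>\<^sub>M Z)"
  shows "(\<lambda>n. \<integral>z. f n z \<partial>\<kappa> n) \<in> borel_measurable N"
proof -
  note \<kappa>' = measurable_prob_algebraD[OF \<kappa>]
  have "(\<lambda>n. distr (\<kappa> n) (N \<Otimes>\<^sub>M Z) (Pair n)) \<in> N \<rightarrow>\<^sub>M subprob_algebra (N \<Otimes>\<^sub>M Z)"
    by (rule measurable_distr2[OF _ \<kappa>']) simp
  from measurable_compose[OF this integral_measurable_subprob_algebra[OF f]]
  have "(\<lambda>n. \<integral>p. (case p of (n, z) \<Rightarrow> f n z) \<partial>distr (\<kappa> n) (N \<Otimes>\<^sub>M Z) (Pair n)) \<in> borel_measurable N" .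
  also have "?this \<longleftrightarrow> ?thesis"
  proof (rule measurable_cong)
    fix n assume n: "n \<in> space N"
    have [measurable]: "Pair n \<in> \<kappa> n \<rightarrow>\<^sub>M N \<Otimes>\<^sub>M Z"
      using n subprob_measurableD[OF \<kappa>' n] by auto
    show "(\<integral>p. (case p of (n, z) \<Rightarrow> f n z) \<partial>distr (\<kappa> n) (N \<Otimes>\<^sub>M Z) (Pair n)) = (\<integral>z. f n z \<partial>\<kappa> n)"
      by (subst integral_distr) auto
  qed
  finally show ?thesis .
qed

definition dyadic :: "nat \<Rightarrow> real \<Rightarrow> int" where
  "dyadic k r = \<lfloor>2 ^ k * r\<rfloor>"

lemma dyadic_coarsen: "k \<le> l \<Longrightarrow> dyadic k r = dyadic l r div 2 ^ (l - k)"
proof -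
  assume "k \<le> l"
  then have "(2::real) ^ l = 2 ^ (l - k) * 2 ^ k" by (simp add: power_add[symmetric])
  then have "2 ^ k * r = (2 ^ l * r) / of_int (2 ^ (l - k))" by simp
  then show ?thesis unfolding dyadic_def using floor_divide_real_eq_div[of "2 ^ (l - k)" "2 ^ l * r"] by simp
qed

lemma dyadic_measurable[measurable]: "dyadic k \<in> borel \<rightarrow>\<^sub>M count_space UNIV"
  unfolding dyadic_def by measurable

lemma dyadic_greater: "dyadic k t < dyadic k r \<Longrightarrow> t < r"
  unfolding dyadic_def by (metis floor_mono linorder_not_less mult_left_mono zero_le_numeral zero_le_power)

lemma eventually_dyadic_greater:
  assumes "t < r" shows "\<forall>\<^sub>F k in sequentially. dyadic k t < dyadic k r"
proof -
  obtain k0 where k0: "inverse (r - t) < 2 ^ k0" using real_arch_pow[of 2] by auto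
  have "dyadic k t < dyadic k r" if "k0 \<le> k" for k
  proof -
    have "inverse (r - t) < 2 ^ k" using k0 power_increasing[OF that, of "2::real"] by linarith
    then have "1 < 2 ^ k * (r - t)" using assms by (simp add: field_simps)
    then show ?thesis unfolding dyadic_def by (simp add: algebra_simps) linarith
  qed
  then show ?thesis by (auto simp: eventually_sequentially)
qed

context
  fixes N :: "'n measure" and \<kappa> :: "'n \<Rightarrow> 'z measure" and Z :: "'z measure" and \<theta> :: "'z \<Rightarrow> real" and B :: "'z set" and b :: real
  assumes \<kappa>[measurable]: "\<kappa> \<in> N \<rightarrow>\<^sub>M prob_algebra Z" and \<theta>[measurable]: "\<theta> \<in> borel_measurable Z"
    and bd: "\<And>z. \<bar>\<theta> z\<bar> \<le> b" and B[measurable]: "B \<in> sets Z"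
begin

definition cell_mass where "cell_mass k n i = measure (\<kappa> n) {z \<in> space Z. dyadic k (\<theta> z) = i}"
definition cell_part where "cell_part k n i = measure (\<kappa> n) {z \<in> space Z. z \<in> B \<and> dyadic k (\<theta> z) = i}"
text \<open>The conditional probability of \<open>B\<close> given the dyadic cell of \<theta> at
  scale \<open>k\<close>, a martingale in \<open>k\<close> under each \<open>\<kappa> n\<close>. On
  null cells division by zero gives 0.\<close>

definition cell_ratio where "cell_ratio k n r = cell_part k n (dyadic k r) / cell_mass k n (dyadic k r)"

lemma kappaD: "n \<in> space N \<Longrightarrow> prob_space (\<kappa> n)" "n \<in> space N \<Longrightarrow> sets (\<kappa> n) = sets Z" "n \<in> space N \<Longrightarrow> space (\<kappa> n) = space Z"
  using measurable_space[OF \<kappa>, of n] by (auto simp: space_prob_algebra dest: sets_eq_imp_space_eq)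

lemma cell_measurable[measurable]:
  "(\<lambda>n. cell_mass k n i) \<in> borel_measurable N" "(\<lambda>n. cell_part k n i) \<in> borel_measurable N"
  unfolding cell_mass_def cell_part_def
  by (rule measurable_compose[OF \<kappa> measurable_measure_prob_algebra], measurable)+

lemma cell_ratio_measurable[measurable]: "(\<lambda>(n, r). cell_ratio k n r) \<in> borel_measurable (N \<Otimes>\<^sub>M borel)"
proof -
  have "(\<lambda>(i, n). cell_part k n i / cell_mass k n i) \<in> borel_measurable (count_space (UNIV :: int set) \<Otimes>\<^sub>M N)"
    by (rule measurable_pair_measure_countable1) auto
  from measurable_compose[OF _ this, of "\<lambda>(n, r). (dyadic k r, n)" "N \<Otimes>\<^sub>M borel"]
  show ?thesis unfolding cell_ratio_def by (simp add: case_prod_beta')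
qed

lemma cell_part_le: assumes n: "n \<in> space N" shows "cell_part k n i \<le> cell_mass k n i"
proof -
  interpret prob_space "\<kappa> n" by (rule kappaD[OF n])
  show ?thesis unfolding cell_part_def cell_mass_def
    by (rule finite_measure_mono) (auto simp: kappaD[OF n])
qed

lemma cell_part_nonneg: "0 \<le> cell_part k n i" and cell_mass_nonneg: "0 \<le> cell_mass k n i"
  by (simp_all add: cell_part_def cell_mass_def)

lemma cell_ratio_bounds: assumes n: "n \<in> space N" shows "0 \<le> cell_ratio k n r" "cell_ratio k n r \<le> 1"
  using cell_part_le[OF n] cell_part_nonneg[of k n] cell_mass_nonneg[of k n]
  by (auto simp: cell_ratio_def divide_le_eq_1 intro: order_antisym dest: order.not_eq_order_implies_strict)

lemma dyadic_greater_measurable[measurable]: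
  "(\<lambda>z. indicator {i<..} (dyadic k (\<theta> z)) :: real) \<in> borel_measurable Z"
  by (rule measurable_compose[where N = "count_space UNIV"]) measurable

lemma cell_ratio_comp_measurable[measurable]:
  assumes n: "n \<in> space N" shows "(\<lambda>r. cell_ratio k n r) \<in> borel_measurable borel"
  using measurable_compose[OF measurable_Pair1'[OF n] cell_ratio_measurable] by simp

text \<open>The averaging property of a conditional expectation. It reduces to a finite sum because
  bounded \<theta> meets only finitely many cells.\<close>

lemma integral_cell_ratio:
  fixes g :: "int \<Rightarrow> real"
  assumes n: "n \<in> space N"
  shows "(\<integral>z. g (dyadic k (\<theta> z)) * cell_ratio k n (\<theta> z) \<partial>\<kappa> n) = (\<integral>z. g (dyadic k (\<theta> z)) * indicator B z \<partial>\<kappa> n)"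
proof -
  interpret prob_space "\<kappa> n" by (rule kappaD[OF n])
  have [measurable_cong]: "sets (\<kappa> n) = sets Z" by (rule kappaD[OF n])
  have sp: "space (\<kappa> n) = space Z" by (rule kappaD[OF n])
  define I where "I = {dyadic k (-b) .. dyadic k b}"
  have I: "dyadic k (\<theta> z) \<in> I" for z
  proof -
    have "- b \<le> \<theta> z" "\<theta> z \<le> b" using bd[of z] by auto
    then have "2 ^ k * (- b) \<le> 2 ^ k * \<theta> z" "2 ^ k * \<theta> z \<le> 2 ^ k * b" by (intro mult_left_mono; simp)+
    then show ?thesis unfolding I_def dyadic_def by (auto intro!: floor_mono)
  qed
  have finI: "finite I" by (simp add: I_def)
  have split: "g (dyadic k (\<theta> z)) * f z = (\<Sum>i\<in>I. g i * (indicator {z \<in> space Z. dyadic k (\<theta> z) = i} z * f z))"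
    if "z \<in> space Z" for f :: "'z \<Rightarrow> real" and z
  proof -
    have "(\<Sum>i\<in>I. g i * (indicator {z \<in> space Z. dyadic k (\<theta> z) = i} z * f z)) = (\<Sum>i\<in>I. if i = dyadic k (\<theta> z) then g i * f z else 0)"
      using that by (intro sum.cong) auto
    then show ?thesis using finI I by simp
  qed
  have 1: "(\<integral>z. g (dyadic k (\<theta> z)) * cell_ratio k n (\<theta> z) \<partial>\<kappa> n) = (\<Sum>i\<in>I. g i * cell_part k n i)"
  proof -
    define c where "c i = cell_part k n i / cell_mass k n i" for i
    have "(\<integral>z. g (dyadic k (\<theta> z)) * cell_ratio k n (\<theta> z) \<partial>\<kappa> n)
      = (\<integral>z. (\<Sum>i\<in>I. g i * (indicator {z \<in> space Z. dyadic k (\<theta> z) = i} z * c i)) \<partial>\<kappa> n)"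
      by (intro Bochner_Integration.integral_cong refl, subst split)
         (auto simp: sp cell_ratio_def c_def intro!: sum.cong split: split_indicator)
    also have "\<dots> = (\<Sum>i\<in>I. g i * (cell_mass k n i * c i))"
      by (subst Bochner_Integration.integral_sum) (auto simp: cell_mass_def sp emeasure_eq_measure)
    \<comment> \<open>On a cell of zero mass the part in \<open>B\<close> is zero too, so the
      default value of the quotient does no harm.\<close>
    also have "\<dots> = (\<Sum>i\<in>I. g i * cell_part k n i)"
    proof (intro sum.cong refl)
      fix i
      show "g i * (cell_mass k n i * c i) = g i * cell_part k n i"
        using cell_part_le[OF n, of k i] cell_part_nonneg[of k n i]
        by (cases "cell_mass k n i = 0") (auto simp: c_def)
    qed
    finally show ?thesis .
  qed
  have 2: "(\<integral>z. g (dyadic k (\<theta> z)) * indicator B z \<partial>\<kappa> n) = (\<Sum>i\<in>I. g i * cell_part k n i)"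
  proof -
    have "(\<integral>z. g (dyadic k (\<theta> z)) * indicator B z \<partial>\<kappa> n)
      = (\<integral>z. (\<Sum>i\<in>I. g i * indicator {z \<in> space Z. z \<in> B \<and> dyadic k (\<theta> z) = i} z) \<partial>\<kappa> n)"
      by (intro Bochner_Integration.integral_cong refl, subst split)
         (auto simp: sp intro!: sum.cong split: split_indicator)
    also have "\<dots> = (\<Sum>i\<in>I. g i * cell_part k n i)"
      by (subst Bochner_Integration.integral_sum) (auto simp: cell_part_def sp emeasure_eq_measure)
    finally show ?thesis .
  qed
  show ?thesis unfolding 1 2 ..
qed

lemma integral_cell_ratio_later:
  fixes g :: "int \<Rightarrow> real"
  assumes n: "n \<in> space N" and kl: "k \<le> l"
  shows "(\<integral>z. g (dyadic k (\<theta> z)) * cell_ratio l n (\<theta> z) \<partial>\<kappa> n) = (\<integral>z. g (dyadic k (\<theta> z)) * indicator B z \<partial>\<kappa> n)"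
  using integral_cell_ratio[OF n, of "\<lambda>i. g (i div 2 ^ (l - k))" l] unfolding dyadic_coarsen[OF kl] .

text \<open>The squared norm of the martingale. It increases with the scale and is at most 1, so the
  energy still to come controls the later oscillation of the martingale by a quantity measurable in
  \<open>n\<close>.\<close>

definition energy where "energy k n = (\<integral>z. (cell_ratio k n (\<theta> z))\<^sup>2 \<partial>\<kappa> n)"

lemma energy_measurable[measurable]: "energy k \<in> borel_measurable N"
  unfolding energy_def
  by (rule measurable_integral_kernel[OF \<kappa>]) measurable

lemma cell_ratio_integrable:
  assumes n: "n \<in> space N"
  shows "integrable (\<kappa> n) (\<lambda>z. cell_ratio k n (\<theta> z) * cell_ratio l n (\<theta> z))" "integrable (\<kappa> n) (\<lambda>z. (cell_ratio k n (\<theta> z))\<^sup>2)"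
proof -
  interpret prob_space "\<kappa> n" by (rule kappaD[OF n])
  have [measurable_cong]: "sets (\<kappa> n) = sets Z" by (rule kappaD[OF n])
  note [measurable] = cell_ratio_comp_measurable[OF n]
  show "integrable (\<kappa> n) (\<lambda>z. cell_ratio k n (\<theta> z) * cell_ratio l n (\<theta> z))"
    using cell_ratio_bounds[OF n]
    by (intro integrable_const_bound[of _ 1]) (auto simp: abs_mult intro!: mult_le_one)
  show "integrable (\<kappa> n) (\<lambda>z. (cell_ratio k n (\<theta> z))\<^sup>2)"
    using cell_ratio_bounds[OF n]
    by (intro integrable_const_bound[of _ 1]) (auto simp: power2_eq_square abs_mult intro!: mult_le_one)
qed

text \<open>Pythagoras: the finer ratio minus the coarser one is orthogonal to the coarser one,
  which is a function of the coarse cell.\<close>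

lemma energy_diff:
  assumes n: "n \<in> space N" and kl: "k \<le> l"
  shows "(\<integral>z. (cell_ratio l n (\<theta> z) - cell_ratio k n (\<theta> z))\<^sup>2 \<partial>\<kappa> n) = energy l n - energy k n"
proof -
  have orth: "(\<integral>z. cell_ratio k n (\<theta> z) * cell_ratio l n (\<theta> z) \<partial>\<kappa> n) = energy k n"
    unfolding energy_def power2_eq_square
    using integral_cell_ratio_later[OF n kl, of "\<lambda>i. cell_part k n i / cell_mass k n i"]
      integral_cell_ratio[OF n, of "\<lambda>i. cell_part k n i / cell_mass k n i" k]
    by (simp add: cell_ratio_def[symmetric])
  have "(\<integral>z. (cell_ratio l n (\<theta> z) - cell_ratio k n (\<theta> z))\<^sup>2 \<partial>\<kappa> n)
    = (\<integral>z. (cell_ratio l n (\<theta> z))\<^sup>2 + (cell_ratio k n (\<theta> z))\<^sup>2 - 2 * (cell_ratio k n (\<theta> z) * cell_ratio l n (\<theta> z)) \<partial>\<kappa> n)"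
    by (simp add: power2_diff algebra_simps)
  also have "\<dots> = energy l n + energy k n - 2 * energy k n"
    using cell_ratio_integrable[OF n] by (simp add: orth energy_def)
  finally show ?thesis by simp
qed

lemma energy_mono: "n \<in> space N \<Longrightarrow> k \<le> l \<Longrightarrow> energy k n \<le> energy l n"
proof -
  assume a: "n \<in> space N" "k \<le> l"
  have "0 \<le> (\<integral>z. (cell_ratio l n (\<theta> z) - cell_ratio k n (\<theta> z))\<^sup>2 \<partial>\<kappa> n)"
    by (rule Bochner_Integration.integral_nonneg) simp
  then show ?thesis unfolding energy_diff[OF a] by simp
qed

lemma energy_le_1: assumes n: "n \<in> space N" shows "energy k n \<le> 1"
proof -
  interpret prob_space "\<kappa> n" by (rule kappaD[OF n])
  have "energy k n \<le> (\<integral>z. 1 \<partial>\<kappa> n)" unfolding energy_def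
    using cell_ratio_bounds[OF n] cell_ratio_integrable[OF n]
    by (intro integral_mono) (auto simp: power2_eq_square intro!: mult_le_one)
  then show ?thesis by (simp add: prob_space)
qed

text \<open>The subsequence: from the \<open>j\<close>-th level on, at most \<open>(1/4) ^ j\<close>
  of energy remains. As a least index with countably many conditions on energies it is measurable in
  the law; the requirement \<open>j \<le> k\<close> makes the levels pass every dyadic
  scale.\<close>

definition level where "level j n = (LEAST k. j \<le> k \<and> (\<forall>l\<ge>k. energy l n - energy k n \<le> (1/4) ^ j))"

lemma level_measurable[measurable]: "level j \<in> N \<rightarrow>\<^sub>M count_space UNIV"
  unfolding level_def by measurable

lemma level_ex: assumes n: "n \<in> space N" shows "\<exists>k. j \<le> k \<and> (\<forall>l\<ge>k. energy l n - energy k n \<le> (1/4) ^ j)"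
proof -
  have "incseq (\<lambda>k. energy k n)" using energy_mono[OF n] by (auto simp: incseq_def)
  then have "convergent (\<lambda>k. energy k n)"
    using energy_le_1[OF n] incseq_convergent convergent_def by blast
  then have "Cauchy (\<lambda>k. energy k n)" by (simp add: Cauchy_convergent_iff)
  then obtain M where M: "\<And>k l. k \<ge> M \<Longrightarrow> l \<ge> M \<Longrightarrow> \<bar>energy k n - energy l n\<bar> < (1/4) ^ j"
    unfolding Cauchy_def dist_real_def by (metis zero_less_divide_1_iff zero_less_numeral zero_less_power)
  show ?thesis
  proof (intro exI[of _ "max j M"] conjI allI impI)
    fix l assume "max j M \<le> l"
    then show "energy l n - energy (max j M) n \<le> (1/4) ^ j" using M[of l "max j M"] by auto
  qed simp
qed

lemma level_props:
  assumes n: "n \<in> space N"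
  shows "j \<le> level j n" "level j n \<le> l \<Longrightarrow> energy l n - energy (level j n) n \<le> (1/4) ^ j" "level j n \<le> level (Suc j) n"
proof -
  have L: "j \<le> level j n \<and> (\<forall>l\<ge>level j n. energy l n - energy (level j n) n \<le> (1/4) ^ j)" for j
    unfolding level_def by (rule LeastI_ex[OF level_ex[OF n]])
  then show "j \<le> level j n" "level j n \<le> l \<Longrightarrow> energy l n - energy (level j n) n \<le> (1/4) ^ j" by auto
  show "level j n \<le> level (Suc j) n"
    unfolding level_def[of j]
  proof (rule Least_le, intro conjI allI impI)
    show "j \<le> level (Suc j) n" using L[of "Suc j"] by simp
    fix l assume "level (Suc j) n \<le> l"
    then have "energy l n - energy (level (Suc j) n) n \<le> (1/4) ^ Suc j" using L[of "Suc j"] by auto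
    also have "\<dots> \<le> (1/4) ^ j" by simp
    finally show "energy l n - energy (level (Suc j) n) n \<le> (1/4) ^ j" .
  qed
qed

definition sub_ratio where "sub_ratio j n r = cell_ratio (level j n) n r"

lemma sub_ratio_measurable[measurable]: "(\<lambda>(n, r). sub_ratio j n r) \<in> borel_measurable (N \<Otimes>\<^sub>M borel)"
proof -
  have "(\<lambda>p. (\<lambda>k. case p of (n, r) \<Rightarrow> cell_ratio k n r) (level j (fst p))) \<in> borel_measurable (N \<Otimes>\<^sub>M borel)"
    by (rule measurable_compose_countable) measurable
  then show ?thesis unfolding sub_ratio_def by (simp add: case_prod_beta')
qed

text \<open>Where the sequence diverges, \<open>lim\<close> has no controlled value; clipping keeps
  the result in the unit interval at every point, so no exceptional set has to be removed.\<close>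

definition cond_ratio where "cond_ratio n r = max 0 (min 1 (lim (\<lambda>j. sub_ratio j n r)))"

lemma cond_ratio_measurable[measurable]: "(\<lambda>(n, r). cond_ratio n r) \<in> borel_measurable (N \<Otimes>\<^sub>M borel)"
  unfolding cond_ratio_def using borel_measurable_lim_metric[OF sub_ratio_measurable]
  by (simp add: case_prod_beta')

text \<open>Along the levels the differences have summable \<open>L\<^sup>1\<close> norms, by \<open>\<bar>x\<bar> \<le> (2\<^sup>j x\<^sup>2 + 2\<^sup>-\<^sup>j) / 2\<close>.\<close>
lemma AE_sub_ratio_tendsto:
  assumes n: "n \<in> space N"
  shows "AE z in \<kappa> n. (\<lambda>j. sub_ratio j n (\<theta> z)) \<longlonglongrightarrow> cond_ratio n (\<theta> z)"
proof -
  interpret prob_space "\<kappa> n" by (rule kappaD[OF n])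
  have [measurable_cong]: "sets (\<kappa> n) = sets Z" by (rule kappaD[OF n])
  note [measurable] = cell_ratio_comp_measurable[OF n]
  define D where "D j z = sub_ratio (Suc j) n (\<theta> z) - sub_ratio j n (\<theta> z)" for j z
  have Dm[measurable]: "D j \<in> borel_measurable (\<kappa> n)" for j unfolding D_def sub_ratio_def by measurable
  have bD: "\<bar>D j z\<bar> \<le> 1" for j z
    unfolding D_def sub_ratio_def using cell_ratio_bounds[OF n, of "level j n" "\<theta> z"] cell_ratio_bounds[OF n, of "level (Suc j) n" "\<theta> z"] by auto
  then have bD2: "(D j z)\<^sup>2 \<le> 1" for j z by (simp add: abs_square_le_1)
  have intD: "integrable (\<kappa> n) (\<lambda>z. \<bar>D j z\<bar>)" "integrable (\<kappa> n) (\<lambda>z. (D j z)\<^sup>2)" for j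
    using bD bD2 by (auto intro!: integrable_const_bound[of _ 1])
  have L1: "(\<integral>z. \<bar>D j z\<bar> \<partial>\<kappa> n) \<le> (1/2) ^ j" for j
  proof -
    have sq: "(\<integral>z. (D j z)\<^sup>2 \<partial>\<kappa> n) \<le> (1/4) ^ j"
      unfolding D_def sub_ratio_def
      by (subst energy_diff[OF n level_props(3)[OF n]]) (rule level_props(2)[OF n level_props(3)[OF n]])
    have "\<bar>x\<bar> \<le> (2 ^ j * x\<^sup>2 + (1/2) ^ j) / 2" for x :: real
    proof -
      have "0 \<le> 2 ^ j * (\<bar>x\<bar> - (1/2) ^ j)\<^sup>2" by simp
      also have "\<dots> = 2 ^ j * x\<^sup>2 - 2 * \<bar>x\<bar> * (2 ^ j * (1/2) ^ j) + (2 ^ j * (1/2) ^ j) * (1/2) ^ j"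
        by (simp add: power2_eq_square algebra_simps)
      also have "(2::real) ^ j * (1/2) ^ j = 1" by (simp add: power_mult_distrib[symmetric])
      finally show ?thesis by simp
    qed
    then have "(\<integral>z. \<bar>D j z\<bar> \<partial>\<kappa> n) \<le> (\<integral>z. (2 ^ j * (D j z)\<^sup>2 + (1/2) ^ j) / 2 \<partial>\<kappa> n)"
      using intD by (intro integral_mono) auto
    also have "\<dots> = (2 ^ j * (\<integral>z. (D j z)\<^sup>2 \<partial>\<kappa> n) + (1/2) ^ j) / 2"
      using intD by (simp add: prob_space)
    also have "\<dots> \<le> (2 ^ j * (1/4) ^ j + (1/2) ^ j) / 2"
      using sq by (intro divide_right_mono add_right_mono mult_left_mono) auto
    also have "\<dots> = (1/2) ^ j" by (simp add: power_mult_distrib[symmetric])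
    finally show ?thesis .
  qed
  have "(\<integral>\<^sup>+z. (\<Sum>j. ennreal \<bar>D j z\<bar>) \<partial>\<kappa> n) = (\<Sum>j. \<integral>\<^sup>+z. ennreal \<bar>D j z\<bar> \<partial>\<kappa> n)"
    by (rule nn_integral_suminf) auto
  also have "\<dots> = (\<Sum>j. ennreal (\<integral>z. \<bar>D j z\<bar> \<partial>\<kappa> n))"
    using intD by (intro arg_cong[where f = suminf] ext nn_integral_eq_integral) auto
  also have "\<dots> \<le> (\<Sum>j. ennreal ((1/2) ^ j))"
    by (intro suminf_le ennreal_leI L1) auto
  also have "\<dots> = ennreal (\<Sum>j. (1/2) ^ j)"
    by (rule suminf_ennreal2) (auto intro: summable_geometric)
  finally have "(\<integral>\<^sup>+z. (\<Sum>j. ennreal \<bar>D j z\<bar>) \<partial>\<kappa> n) \<noteq> \<infinity>" by (auto simp: top_unique)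
  then have "AE z in \<kappa> n. (\<Sum>j. ennreal \<bar>D j z\<bar>) \<noteq> \<infinity>"
    by (intro nn_integral_noteq_infinite) auto
  then show ?thesis
  proof eventually_elim
    case (elim z)
    then have "summable (\<lambda>j. \<bar>D j z\<bar>)" by (intro summable_suminf_not_top) auto
    then have "summable (\<lambda>j. D j z)" by (rule summable_rabs_cancel)
    then have "convergent (\<lambda>m. \<Sum>j<m. D j z)" by (simp add: summable_iff_convergent)
    then obtain L where "(\<lambda>m. \<Sum>j<m. D j z) \<longlonglongrightarrow> L" by (auto simp: convergent_def)
    then have "(\<lambda>m. sub_ratio m n (\<theta> z) - sub_ratio 0 n (\<theta> z)) \<longlonglongrightarrow> L"
      unfolding D_def sum_lessThan_telescope[of "\<lambda>j. sub_ratio j n (\<theta> z)"] .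
    from tendsto_add[OF this tendsto_const[of "sub_ratio 0 n (\<theta> z)"]]
    have "convergent (\<lambda>j. sub_ratio j n (\<theta> z))" by (auto simp: convergent_def)
    then have lim: "(\<lambda>j. sub_ratio j n (\<theta> z)) \<longlonglongrightarrow> lim (\<lambda>j. sub_ratio j n (\<theta> z))"
      by (simp add: convergent_LIMSEQ_iff)
    have b: "0 \<le> sub_ratio j n (\<theta> z)" "sub_ratio j n (\<theta> z) \<le> 1" for j
      unfolding sub_ratio_def using cell_ratio_bounds[OF n] by auto
    have "0 \<le> lim (\<lambda>j. sub_ratio j n (\<theta> z))" by (rule LIMSEQ_le_const[OF lim]) (use b in auto)
    moreover have "lim (\<lambda>j. sub_ratio j n (\<theta> z)) \<le> 1" by (rule LIMSEQ_le_const2[OF lim]) (use b in auto)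
    ultimately have "0 \<le> lim (\<lambda>j. sub_ratio j n (\<theta> z))" "lim (\<lambda>j. sub_ratio j n (\<theta> z)) \<le> 1" .
    then show ?case using lim by (simp add: cond_ratio_def)
  qed
qed

lemma cond_ratio_bounds: "0 \<le> cond_ratio n r" "cond_ratio n r \<le> 1"
  by (auto simp: cond_ratio_def)

lemma cond_ratio_comp_measurable[measurable]:
  assumes n: "n \<in> space N" shows "(\<lambda>r. cond_ratio n r) \<in> borel_measurable borel"
  using measurable_compose[OF measurable_Pair1'[OF n] cond_ratio_measurable] by simp

lemma integral_cond_ratio_dyadic:
  assumes n: "n \<in> space N"
  shows "(\<integral>z. indicator {i<..} (dyadic k (\<theta> z)) * cond_ratio n (\<theta> z) \<partial>\<kappa> n) = (\<integral>z. indicator {i<..} (dyadic k (\<theta> z)) * indicator B z \<partial>\<kappa> n)"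
proof -
  interpret prob_space "\<kappa> n" by (rule kappaD[OF n])
  have [measurable_cong]: "sets (\<kappa> n) = sets Z" by (rule kappaD[OF n])
  note [measurable] = cell_ratio_comp_measurable[OF n] cond_ratio_comp_measurable[OF n]
  have "(\<lambda>j. \<integral>z. indicator {i<..} (dyadic k (\<theta> z)) * sub_ratio j n (\<theta> z) \<partial>\<kappa> n)
    \<longlonglongrightarrow> (\<integral>z. indicator {i<..} (dyadic k (\<theta> z)) * cond_ratio n (\<theta> z) \<partial>\<kappa> n)"
  proof (rule integral_dominated_convergence[where w = "\<lambda>_. 1"])
    show "AE z in \<kappa> n. (\<lambda>j. indicator {i<..} (dyadic k (\<theta> z)) * sub_ratio j n (\<theta> z)) \<longlonglongrightarrow> indicator {i<..} (dyadic k (\<theta> z)) * cond_ratio n (\<theta> z)"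
      using AE_sub_ratio_tendsto[OF n] by eventually_elim (intro tendsto_mult tendsto_const)
    show "AE z in \<kappa> n. norm (indicator {i<..} (dyadic k (\<theta> z)) * sub_ratio j n (\<theta> z)) \<le> 1" for j
      using cell_ratio_bounds[OF n] by (auto simp: sub_ratio_def abs_mult split: split_indicator)
  qed (auto simp: sub_ratio_def)
  \<comment> \<open>The \<open>j\<close>-th level is at least \<open>j\<close>, so once
    \<open>j\<close> passes \<open>k\<close> these integrals no longer depend on
    \<open>j\<close>.\<close>
  moreover have "(\<lambda>j. \<integral>z. indicator {i<..} (dyadic k (\<theta> z)) * sub_ratio j n (\<theta> z) \<partial>\<kappa> n)
    \<longlonglongrightarrow> (\<integral>z. indicator {i<..} (dyadic k (\<theta> z)) * indicator B z \<partial>\<kappa> n)"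
  proof (rule tendsto_eventually, rule eventually_mono[OF eventually_ge_at_top[of k]])
    fix j assume "k \<le> j"
    then have "k \<le> level j n" using level_props(1)[OF n, of j] by simp
    from integral_cell_ratio_later[OF n this]
    show "(\<integral>z. indicator {i<..} (dyadic k (\<theta> z)) * sub_ratio j n (\<theta> z) \<partial>\<kappa> n)
      = (\<integral>z. indicator {i<..} (dyadic k (\<theta> z)) * indicator B z \<partial>\<kappa> n)"
      unfolding sub_ratio_def .
  qed
  ultimately show ?thesis by (rule LIMSEQ_unique)
qed

text \<open>Both sides are finite measures in \<open>C\<close> on the line, so half-lines suffice,
  and these are limits of unions of dyadic cells.\<close>

lemma measure_cond_ratio:
  assumes n: "n \<in> space N" and C: "C \<in> sets borel"
  shows "(\<integral>z. indicator C (\<theta> z) * cond_ratio n (\<theta> z) \<partial>\<kappa> n) = measure (\<kappa> n) {z \<in> space Z. \<theta> z \<in> C \<and> z \<in> B}"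
proof -
  interpret prob_space "\<kappa> n" by (rule kappaD[OF n])
  have [measurable_cong]: "sets (\<kappa> n) = sets Z" by (rule kappaD[OF n])
  have sp: "space (\<kappa> n) = space Z" by (rule kappaD[OF n])
  note [measurable] = cond_ratio_comp_measurable[OF n]
  define M1 where "M1 = distr (density (\<kappa> n) (\<lambda>z. ennreal (cond_ratio n (\<theta> z)))) borel \<theta>"
  define M2 where "M2 = distr (density (\<kappa> n) (\<lambda>z. ennreal (indicator B z))) borel \<theta>"
  have e1: "emeasure M1 A = ennreal (\<integral>z. indicator A (\<theta> z) * cond_ratio n (\<theta> z) \<partial>\<kappa> n)" if [measurable]: "A \<in> sets borel" for A
  proof -
    have "emeasure M1 A = (\<integral>\<^sup>+z. ennreal (indicator A (\<theta> z) * cond_ratio n (\<theta> z)) \<partial>\<kappa> n)"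
      unfolding M1_def by (subst emeasure_distr, measurable)
        (auto simp: emeasure_density sp intro!: nn_integral_cong split: split_indicator)
    also have "\<dots> = ennreal (\<integral>z. indicator A (\<theta> z) * cond_ratio n (\<theta> z) \<partial>\<kappa> n)"
      by (intro nn_integral_eq_integral integrable_const_bound[of _ 1])
         (auto simp: cond_ratio_bounds split: split_indicator)
    finally show ?thesis .
  qed
  have e2: "emeasure M2 A = ennreal (\<integral>z. indicator A (\<theta> z) * indicator B z \<partial>\<kappa> n)" if [measurable]: "A \<in> sets borel" for A
  proof -
    have "emeasure M2 A = (\<integral>\<^sup>+z. ennreal (indicator A (\<theta> z) * indicator B z) \<partial>\<kappa> n)"
      unfolding M2_def by (subst emeasure_distr, measurable)
        (auto simp: emeasure_density sp intro!: nn_integral_cong split: split_indicator)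
    also have "\<dots> = ennreal (\<integral>z. indicator A (\<theta> z) * indicator B z \<partial>\<kappa> n)"
      by (intro nn_integral_eq_integral integrable_const_bound[of _ 1])
         (auto split: split_indicator)
    finally show ?thesis .
  qed
  have lim: "(\<lambda>k. \<integral>z. indicator {dyadic k t<..} (dyadic k (\<theta> z)) * f z \<partial>\<kappa> n) \<longlonglongrightarrow> (\<integral>z. indicator {t<..} (\<theta> z) * f z \<partial>\<kappa> n)"
    if [measurable]: "f \<in> borel_measurable Z" and f: "\<And>z. \<bar>f z\<bar> \<le> 1" for f :: "'z \<Rightarrow> real" and t :: real
  proof (rule integral_dominated_convergence[where w = "\<lambda>_. 1"])
    \<comment> \<open>The cell that contains \<open>t\<close> is left out. Points up to
      \<open>t\<close> are therefore never counted, and any \<open>r\<close> above \<open>t\<close>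
      eventually lies in a later cell.\<close>
    have "(\<lambda>k. indicator {dyadic k t<..} (dyadic k r)::real) \<longlonglongrightarrow> indicator {t<..} r" for r
    proof (cases "t < r")
      case True
      from eventually_dyadic_greater[OF this] show ?thesis
        using True by (intro tendsto_eventually) (auto elim: eventually_mono)
    next
      case False
      then have "\<not> dyadic k t < dyadic k r" for k using dyadic_greater by blast
      then show ?thesis using False by simp
    qed
    then show "AE z in \<kappa> n. (\<lambda>k. indicator {dyadic k t<..} (dyadic k (\<theta> z)) * f z) \<longlonglongrightarrow> indicator {t<..} (\<theta> z) * f z"
      by (intro AE_I2 tendsto_mult tendsto_const)
    show "AE z in \<kappa> n. norm (indicator {dyadic k t<..} (dyadic k (\<theta> z)) * f z) \<le> 1" for k
      using f by (auto simp: abs_mult split: split_indicator)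
  qed auto
  have "(\<integral>z. indicator {t<..} (\<theta> z) * cond_ratio n (\<theta> z) \<partial>\<kappa> n) = (\<integral>z. indicator {t<..} (\<theta> z) * indicator B z \<partial>\<kappa> n)" for t
  proof (rule LIMSEQ_unique)
    show "(\<lambda>k. \<integral>z. indicator {dyadic k t<..} (dyadic k (\<theta> z)) * indicat_real B z \<partial>\<kappa> n) \<longlonglongrightarrow> (\<integral>z. indicator {t<..} (\<theta> z) * indicator B z \<partial>\<kappa> n)"
      by (rule lim[of "indicat_real B" t]) (auto split: split_indicator)
    show "(\<lambda>k. \<integral>z. indicator {dyadic k t<..} (dyadic k (\<theta> z)) * indicat_real B z \<partial>\<kappa> n) \<longlonglongrightarrow> (\<integral>z. indicator {t<..} (\<theta> z) * cond_ratio n (\<theta> z) \<partial>\<kappa> n)"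
      unfolding integral_cond_ratio_dyadic[OF n, symmetric]
      by (rule lim) (auto simp: cond_ratio_bounds)
  qed
  then have "M1 = M2"
    by (intro measure_eqI_lessThan) (auto simp: e1 e2, auto simp: M1_def M2_def)
  then have "ennreal (\<integral>z. indicator C (\<theta> z) * cond_ratio n (\<theta> z) \<partial>\<kappa> n) = ennreal (\<integral>z. indicator C (\<theta> z) * indicator B z \<partial>\<kappa> n)"
    using e1[OF C] e2[OF C] by simp
  then have "(\<integral>z. indicator C (\<theta> z) * cond_ratio n (\<theta> z) \<partial>\<kappa> n) = (\<integral>z. indicator C (\<theta> z) * indicator B z \<partial>\<kappa> n)"
    by (subst (asm) ennreal_inj) (auto intro!: Bochner_Integration.integral_nonneg simp: cond_ratio_bounds)
  also have "\<dots> = (\<integral>z. indicator {z \<in> space Z. \<theta> z \<in> C \<and> z \<in> B} z \<partial>\<kappa> n)"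
    by (intro Bochner_Integration.integral_cong) (auto simp: sp split: split_indicator)
  also have "\<dots> = measure (\<kappa> n) {z \<in> space Z. \<theta> z \<in> C \<and> z \<in> B}"
    using C by (simp add: sp Int_def) (metis (no_types, lifting) Collect_cong)
  finally show ?thesis .
qed

end

lemma measurable_conditional_probability:
  fixes N :: "'n measure" and \<theta> :: "'z \<Rightarrow> real"
  assumes "\<kappa> \<in> N \<rightarrow>\<^sub>M prob_algebra Z" "\<theta> \<in> borel_measurable Z" "\<And>z. \<bar>\<theta> z\<bar> \<le> b" "B \<in> sets Z"
  obtains h :: "'n \<Rightarrow> real \<Rightarrow> real" where "(\<lambda>(n, r). h n r) \<in> borel_measurable (N \<Otimes>\<^sub>M borel)"
    "\<And>n r. 0 \<le> h n r \<and> h n r \<le> 1"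
    "\<And>n C. n \<in> space N \<Longrightarrow> C \<in> sets borel \<Longrightarrow>
       (\<integral>z. indicator C (\<theta> z) * h n (\<theta> z) \<partial>\<kappa> n) = measure (\<kappa> n) {z \<in> space Z. \<theta> z \<in> C \<and> z \<in> B}"
proof (rule that)
  show "(\<lambda>(n, r). cond_ratio \<kappa> Z \<theta> B n r) \<in> borel_measurable (N \<Otimes>\<^sub>M borel)"
    by (rule cond_ratio_measurable[OF assms])
  show "0 \<le> cond_ratio \<kappa> Z \<theta> B n r \<and> cond_ratio \<kappa> Z \<theta> B n r \<le> 1" for n r
    by (simp add: cond_ratio_def[OF assms])
qed (rule measure_cond_ratio[OF assms])

section \<open>Realization of a joint law by a uniform variable\<close>

lemma unif_prob_space: "prob_space unif"
  by (rule prob_spaceI) (simp add: emeasure_restrict_space space_restrict_space)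

lemma space_unif[simp]: "space unif = {0..1}"
  by (simp add: space_restrict_space)

lemma unif_to_borel: "(\<lambda>u. u) \<in> unif \<rightarrow>\<^sub>M borel"
  by (intro measurable_restrict_space1) simp

lemma integral_unif_le:
  assumes "0 \<le> c" "c \<le> 1"
  shows "(\<integral>u. indicator {..c} u \<partial>unif) = (c::real)"
proof -
  have "(\<integral>u. indicator {..c} u \<partial>unif) = (\<integral>u. indicat_real {0..c} u \<partial>unif)"
    using assms by (intro Bochner_Integration.integral_cong) (auto split: split_indicator)
  also have "\<dots> = measure unif ({0..c} \<inter> {0..1})" by simp
  also have "{0..c} \<inter> {0..1} = {0..c}" using assms by auto
  also have "measure unif {0..c} = measure lborel {0..c}"
    using assms by (intro measure_restrict_space) auto
  also have "\<dots> = c"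
    using assms by simp
  finally show ?thesis .
qed

text \<open>The action is the generalized inverse of the conditional survival function, decoded.\<close>
lemma measurable_randomization:
  fixes N :: "'n measure" and \<gamma> :: "'n \<Rightarrow> ('x::polish_space \<times> 'a::polish_space) measure"
  assumes cX: "compact (UNIV :: 'x set)" and cA: "compact (UNIV :: 'a set)"
    and \<gamma>[measurable]: "\<gamma> \<in> N \<rightarrow>\<^sub>M prob_algebra borel"
  obtains \<aa> where "\<aa> \<in> N \<Otimes>\<^sub>M borel \<Otimes>\<^sub>M unif \<rightarrow>\<^sub>M borel"
    "\<And>n. n \<in> space N \<Longrightarrow> distr (distr (\<gamma> n) borel fst \<Otimes>\<^sub>M unif) borel (\<lambda>(x, u). (x, \<aa> (n, x, u))) = \<gamma> n"
proof -
  obtain \<theta> :: "'x \<Rightarrow> real" and D K where X: "\<theta> \<in> borel_measurable borel" "D \<in> borel \<rightarrow>\<^sub>M borel" "compact K" "range \<theta> \<subseteq> K"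
    "\<And>y. D (\<theta> y) = y" using compact_encoding[OF cX] by metis
  obtain \<eta> :: "'a \<Rightarrow> real" and E L where A: "\<eta> \<in> borel_measurable borel" "E \<in> borel \<rightarrow>\<^sub>M borel" "compact L" "range \<eta> \<subseteq> L"
    "\<And>y. E (\<eta> y) = y" using compact_encoding[OF cA] by metis
  note [measurable] = X(1,2) A(1,2)
  obtain b1 where b1: "\<And>x. x \<in> K \<Longrightarrow> \<bar>x\<bar> \<le> b1" using compact_imp_bounded[OF X(3)] unfolding bounded_real by auto
  obtain b where "\<And>x. x \<in> L \<Longrightarrow> \<bar>x\<bar> \<le> b" using compact_imp_bounded[OF A(3)] unfolding bounded_real by auto
  then have b: "\<bar>\<eta> a\<bar> \<le> b" for a using A(4) by auto
  then have b0: "0 \<le> b" by (meson abs_ge_zero order_trans)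
  have \<theta>b: "\<bar>\<theta> (fst z)\<bar> \<le> b1" for z :: "'x \<times> 'a" using X(4) b1 by auto
  define B where "B q = {z :: 'x \<times> 'a. q < \<eta> (snd z)}" for q
  have Bm[measurable]: "B q \<in> sets (borel \<Otimes>\<^sub>M borel)" for q
  proof -
    have "{z \<in> space (borel \<Otimes>\<^sub>M borel). q < \<eta> (snd z)} \<in> sets ((borel :: 'x measure) \<Otimes>\<^sub>M borel)" by measurable
    then show ?thesis by (simp add: B_def space_pair_measure)
  qed
  have CBm[measurable]: "{z :: 'x \<times> 'a. \<theta> (fst z) \<in> C \<and> q < \<eta> (snd z)} \<in> sets (borel \<Otimes>\<^sub>M borel)"
    if [measurable]: "C \<in> sets borel" for q C
  proof -
    have "{z \<in> space (borel \<Otimes>\<^sub>M borel). \<theta> (fst z) \<in> C \<and> q < \<eta> (snd z)} \<in> sets ((borel :: 'x measure) \<Otimes>\<^sub>M borel)" by measurable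
    then show ?thesis by (simp add: space_pair_measure)
  qed
  have \<gamma>': "\<gamma> \<in> N \<rightarrow>\<^sub>M prob_algebra (borel \<Otimes>\<^sub>M borel)" using \<gamma> by (simp add: borel_prod)
  define cp where "cp q h' \<longleftrightarrow> (\<lambda>(n, r). h' n r) \<in> borel_measurable (N \<Otimes>\<^sub>M borel) \<and>
    (\<forall>n r. 0 \<le> h' n r \<and> h' n r \<le> 1) \<and>
    (\<forall>n C. n \<in> space N \<longrightarrow> C \<in> sets borel \<longrightarrow>
       (\<integral>z. indicator C (\<theta> (fst z)) * h' n (\<theta> (fst z)) \<partial>\<gamma> n) = measure (\<gamma> n) {z. \<theta> (fst z) \<in> C \<and> z \<in> B q})"
    for q and h' :: "'n \<Rightarrow> real \<Rightarrow> real"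
  have "\<exists>h'. cp q h'" for q
  proof (rule measurable_conditional_probability[OF \<gamma>', of "\<lambda>z. \<theta> (fst z)" b1 "B q"])
    fix h' :: "'n \<Rightarrow> real \<Rightarrow> real"
    assume "(\<lambda>(n, r). h' n r) \<in> borel_measurable (N \<Otimes>\<^sub>M borel)" "\<And>n r. 0 \<le> h' n r \<and> h' n r \<le> 1"
      "\<And>n C. n \<in> space N \<Longrightarrow> C \<in> sets borel \<Longrightarrow> (\<integral>z. indicator C (\<theta> (fst z)) * h' n (\<theta> (fst z)) \<partial>\<gamma> n)
        = measure (\<gamma> n) {z \<in> space (borel \<Otimes>\<^sub>M borel). \<theta> (fst z) \<in> C \<and> z \<in> B q}"
    then show ?thesis by (intro exI[of _ h']) (simp add: cp_def space_pair_measure)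
  qed (use \<theta>b in auto)
  \<comment> \<open>\<open>h q n r\<close> is a version of the conditional probability, under
    \<open>\<gamma> n\<close>, that the encoded action exceeds \<open>q\<close> when the encoded
    state is \<open>r\<close>. The versions for different \<open>q\<close> are chosen independently
    of each other.\<close>
  then obtain h where "\<And>q. cp q (h q)" by metis
  then have h[measurable]: "\<And>q. (\<lambda>(n, r). h q n r) \<in> borel_measurable (N \<Otimes>\<^sub>M borel)"
    and hb: "\<And>q n r. 0 \<le> h q n r" "\<And>q n r. h q n r \<le> 1"
    and hi: "\<And>q n C. n \<in> space N \<Longrightarrow> C \<in> sets borel \<Longrightarrow>
       (\<integral>z. indicator C (\<theta> (fst z)) * h q n (\<theta> (fst z)) \<partial>\<gamma> n) = measure (\<gamma> n) {z. \<theta> (fst z) \<in> C \<and> z \<in> B q}"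
    unfolding cp_def by blast+
  \<comment> \<open>Values are clipped to the range of the code, with \<open>- b\<close> as default,
    so the supremum defining \<open>Q\<close> exists for all arguments, including those where the
    versions are not monotone in \<open>q\<close>.\<close>
  define c where "c q n r u = (if u \<le> h q n r then max (-b) (min q b) else - b)" for q n r u
  define Q where "Q n r u = (SUP q\<in>\<rat>. c q n r u)" for n r u
  have cb: "c q n r u \<le> b" "- b \<le> c q n r u" for q n r u using b0 by (auto simp: c_def)
  then have bdd: "bdd_above ((\<lambda>q. c q n r u) ` S)" for n r u S by (auto intro!: bdd_aboveI2)
  have Rne: "(\<rat> :: real set) \<noteq> {}" using Rats_0 by blast
  have Qless: "s < Q n r u \<longleftrightarrow> (\<exists>q\<in>\<rat>. s < c q n r u)" for s n r u
    unfolding Q_def by (rule less_cSUP_iff[OF Rne bdd])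
  have Qiff: "s < Q n r u \<longleftrightarrow> (\<exists>q\<in>\<rat>. s < q \<and> u \<le> h q n r)" if "- b \<le> s" "s < b" for s n r u
    unfolding Qless using that b0 by (intro bex_cong refl) (auto simp: c_def)
  have Q_le: "Q n r u \<le> b" for n r u unfolding Q_def by (rule cSUP_least[OF Rne cb(1)])
  have Q_ge: "- b \<le> Q n r u" for n r u unfolding Q_def by (rule cSUP_upper2[OF bdd Rats_0 cb(2)])
  have Qm[measurable]: "(\<lambda>(n, r, u). Q n r u) \<in> borel_measurable (N \<Otimes>\<^sub>M borel \<Otimes>\<^sub>M borel)"
  proof -
    have "(\<lambda>(n, r, u). c q n r u) \<in> borel_measurable (N \<Otimes>\<^sub>M borel \<Otimes>\<^sub>M borel)" for q
      unfolding c_def using measurable_compose[OF _ h[of q], of "\<lambda>(n, r, u). (n, r)" "N \<Otimes>\<^sub>M borel \<Otimes>\<^sub>M borel"]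
      by (simp add: case_prod_beta')
    then have "(\<lambda>x. SUP q\<in>\<rat>. (case x of (n, r, u) \<Rightarrow> c q n r u)) \<in> borel_measurable (N \<Otimes>\<^sub>M borel \<Otimes>\<^sub>M borel)"
      using bdd by (intro borel_measurable_cSUP) (auto simp: countable_rat)
    then show ?thesis unfolding Q_def by (simp add: case_prod_beta')
  qed
  define \<aa> where "\<aa> = (\<lambda>(n, x, u). E (Q n (\<theta> x) u))"
  have am[measurable]: "\<aa> \<in> N \<Otimes>\<^sub>M borel \<Otimes>\<^sub>M unif \<rightarrow>\<^sub>M borel"
  proof -
    have [measurable]: "(\<lambda>x. snd (snd x)) \<in> borel_measurable (N \<Otimes>\<^sub>M (borel :: 'x measure) \<Otimes>\<^sub>M unif)"
      by (rule measurable_compose[OF _ unif_to_borel]) measurable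
    have "(\<lambda>(n, x, u). (n, \<theta> x, u)) \<in> N \<Otimes>\<^sub>M borel \<Otimes>\<^sub>M unif \<rightarrow>\<^sub>M N \<Otimes>\<^sub>M borel \<Otimes>\<^sub>M borel"
      unfolding case_prod_beta' by (intro measurable_Pair) measurable
    from measurable_compose[OF measurable_compose[OF this Qm] A(2)]
    show ?thesis by (simp add: \<aa>_def case_prod_beta')
  qed
  show ?thesis
  proof (rule that[OF am])
    fix n assume n: "n \<in> space N"
    have Pn: "\<gamma> n \<in> Prob" by (rule measurable_space[OF \<gamma> n])
    interpret G: prob_space "\<gamma> n" by (rule ProbD[OF Pn])
    have [measurable_cong]: "sets (\<gamma> n) = sets (borel \<Otimes>\<^sub>M borel)" unfolding borel_prod by (rule ProbD[OF Pn])
    have spG: "space (\<gamma> n) = UNIV" using ProbD[OF Pn] by simp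
    interpret U: prob_space unif by (rule unif_prob_space)
    define \<mu> where "\<mu> = distr (\<gamma> n) borel fst"
    have P\<mu>: "\<mu> \<in> Prob" unfolding \<mu>_def by (rule Prob_distr) (auto intro: G.prob_space_axioms)
    interpret M: prob_space \<mu> using ProbD[OF P\<mu>] by simp
    have [measurable_cong]: "sets \<mu> = sets borel" using ProbD[OF P\<mu>] by simp
    have spM: "space \<mu> = UNIV" using ProbD[OF P\<mu>] by simp
    interpret P: pair_prob_space \<mu> unif ..
    have hm[measurable]: "(\<lambda>r. h q n r) \<in> borel_measurable borel" for q
      using measurable_compose[OF measurable_Pair1'[OF n] h[of q]] by simp
    have Qnm[measurable]: "(\<lambda>p. Q n (\<theta> (fst p)) (snd p)) \<in> borel_measurable (\<mu> \<Otimes>\<^sub>M unif)"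
    proof -
      have [measurable]: "(\<lambda>p. snd p) \<in> borel_measurable (\<mu> \<Otimes>\<^sub>M unif)"
        by (rule measurable_compose[OF _ unif_to_borel]) measurable
      have "(\<lambda>p. (n, \<theta> (fst p), snd p)) \<in> \<mu> \<Otimes>\<^sub>M unif \<rightarrow>\<^sub>M N \<Otimes>\<^sub>M borel \<Otimes>\<^sub>M borel"
        using n by (intro measurable_Pair) measurable
      from measurable_compose[OF this Qm] show ?thesis by simp
    qed
    have hmu: "(\<integral>x. indicator C (\<theta> x) * h q n (\<theta> x) \<partial>\<mu>) = measure (\<gamma> n) {z. \<theta> (fst z) \<in> C \<and> q < \<eta> (snd z)}"
      if [measurable]: "C \<in> sets borel" for C q
      unfolding \<mu>_def by (subst integral_distr) (auto simp: hi[OF n that] B_def)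
    \<comment> \<open>Separately chosen versions decrease in \<open>q\<close> only almost surely;
      one null set serves all pairs of rationals.\<close>
    have mono: "AE x in \<mu>. \<forall>q\<in>\<rat>. \<forall>q'\<in>\<rat>. q \<le> q' \<longrightarrow> h q' n (\<theta> x) \<le> h q n (\<theta> x)"
    proof -
      have "AE x in \<mu>. h q' n (\<theta> x) \<le> h q n (\<theta> x)" if "q \<le> q'" for q q'
      proof -
        \<comment> \<open>Over the set where monotonicity fails the integral of the positive excess
          equals a difference of two masses that is at most 0, so the excess vanishes almost
          surely.\<close>
        define C where "C = {r. h q n r < h q' n r}"
        have Cm[measurable]: "C \<in> sets borel" unfolding C_def by measurable
        define f where "f x = indicator C (\<theta> x) * (h q' n (\<theta> x) - h q n (\<theta> x))" for x
        have int: "integrable \<mu> (\<lambda>x. indicator C (\<theta> x) * h q n (\<theta> x))" for q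
          using hb by (intro M.integrable_const_bound[of _ 1]) (auto split: split_indicator)
        have fint: "integrable \<mu> f" unfolding f_def right_diff_distrib using int by auto
        have f0: "0 \<le> f x" for x by (auto simp: f_def C_def split: split_indicator)
        have "(\<integral>x. f x \<partial>\<mu>) = measure (\<gamma> n) {z. \<theta> (fst z) \<in> C \<and> q' < \<eta> (snd z)} - measure (\<gamma> n) {z. \<theta> (fst z) \<in> C \<and> q < \<eta> (snd z)}"
          unfolding f_def right_diff_distrib using int by (simp add: hmu)
        also have "\<dots> \<le> 0"
          using that by (simp, intro G.finite_measure_mono) (auto, measurable)
        finally have "(\<integral>x. f x \<partial>\<mu>) = 0" using f0 by (simp add: antisym Bochner_Integration.integral_nonneg)
        then have "AE x in \<mu>. f x = 0" using integral_nonneg_eq_0_iff_AE[OF fint] f0 by simp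
        then show ?thesis by eventually_elim (auto simp: f_def C_def split: split_indicator_asm)
      qed
      then show ?thesis by (intro AE_ball_countable'[OF _ countable_rat]) auto
    qed
    have monoP: "AE p in \<mu> \<Otimes>\<^sub>M unif. \<forall>q\<in>\<rat>. \<forall>q'\<in>\<rat>. q \<le> q' \<longrightarrow> h q' n (\<theta> (fst p)) \<le> h q n (\<theta> (fst p))"
    proof -
      have eq: "distr (\<mu> \<Otimes>\<^sub>M unif) \<mu> fst = \<mu>" by (rule U.distr_pair_fst)
      show ?thesis by (rule AE_distrD[of fst _ \<mu>]) (simp, subst eq, rule mono)
    qed
    \<comment> \<open>Outside the range of the code both events are trivial. Inside it,
      \<open>s < Q\<close> holds exactly when \<open>u\<close> is at most \<open>h q\<close> for
      some rational \<open>q\<close> above \<open>s\<close>, an event reached along rationals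
      tending to \<open>s\<close>.\<close>
    have key: "measure (\<mu> \<Otimes>\<^sub>M unif) {p \<in> space (\<mu> \<Otimes>\<^sub>M unif). \<theta> (fst p) \<in> C \<and> s < Q n (\<theta> (fst p)) (snd p)}
      = measure (\<gamma> n) {z. \<theta> (fst z) \<in> C \<and> s < \<eta> (snd z)}" if [measurable]: "C \<in> sets borel" for C s
    proof -
      consider "s < - b" | "b \<le> s" | "- b \<le> s" "s < b" by linarith
      then show ?thesis
      proof cases
        case 1
        have "s < Q n r u" for r u using Q_ge[of n r u] 1 by linarith
        moreover have "s < \<eta> a" for a using b[of a] 1 by (auto simp: abs_le_iff)
        moreover have "{p \<in> space (\<mu> \<Otimes>\<^sub>M unif). \<theta> (fst p) \<in> C} = {x. \<theta> x \<in> C} \<times> space unif"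
          by (auto simp: space_pair_measure spM)
        moreover have "measure (\<mu> \<Otimes>\<^sub>M unif) ({x. \<theta> x \<in> C} \<times> space unif) = measure \<mu> {x. \<theta> x \<in> C}"
        proof -
          have "{x. \<theta> x \<in> C} \<in> sets \<mu>" by measurable
          from U.emeasure_pair_measure_Times[OF this sets.top] show ?thesis
            unfolding Sigma_Algebra.measure_def by (simp only: U.emeasure_space_1 mult_1_right)
        qed
        moreover have "measure \<mu> {x. \<theta> x \<in> C} = measure (\<gamma> n) {z. \<theta> (fst z) \<in> C}"
          unfolding \<mu>_def by (subst measure_distr) (auto simp: vimage_def spG)
        ultimately show ?thesis by simp
      next
        case 2
        have "\<not> s < Q n r u" for r u using Q_le[of n r u] 2 by linarith
        moreover have "\<not> s < \<eta> a" for a using b[of a] 2 by (auto simp: abs_le_iff)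
        ultimately show ?thesis by simp
      next
        case 3
        have "\<exists>q. q \<in> \<rat> \<and> s < q \<and> q < s + inverse (real (Suc m))" for m
          using Rats_dense_in_real[of s "s + inverse (real (Suc m))"] by auto
        then obtain q where q: "\<And>m. q m \<in> \<rat>" "\<And>m. s < q m" "\<And>m. q m < s + inverse (real (Suc m))" by metis
        have qlim: "\<forall>\<^sub>F m in sequentially. q m < t" if "s < t" for t
        proof -
          obtain m0 where m0: "inverse (real (Suc m0)) < t - s" using reals_Archimedean[of "t - s"] \<open>s < t\<close> by auto
          have "q m < t" if "m0 \<le> m" for m
          proof -
            have "inverse (real (Suc m)) \<le> inverse (real (Suc m0))" using that by (intro le_imp_inverse_le) auto
            then show ?thesis using q(3)[of m] m0 by linarith
          qed
          then show ?thesis by (auto simp: eventually_sequentially)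
        qed
        define I where "I p = indicat_real {p. \<theta> (fst p) \<in> C \<and> s < Q n (\<theta> (fst p)) (snd p)} p" for p
        define J where "J m p = indicator C (\<theta> (fst p)) * indicat_real {..h (q m) n (\<theta> (fst p))} (snd p)" for m p
        have um[measurable]: "(\<lambda>p. snd p) \<in> borel_measurable (\<mu> \<Otimes>\<^sub>M unif)"
          by (rule measurable_compose[OF _ unif_to_borel]) measurable
        have Jm[measurable]: "J m \<in> borel_measurable (\<mu> \<Otimes>\<^sub>M unif)" for m
          unfolding J_def indicator_def[of "{..(_::real)}"] atMost_iff by measurable
        have Im[measurable]: "I \<in> borel_measurable (\<mu> \<Otimes>\<^sub>M unif)"
          unfolding I_def indicator_def mem_Collect_eq by measurable
        have lim1: "(\<lambda>m. \<integral>p. J m p \<partial>(\<mu> \<Otimes>\<^sub>M unif)) \<longlonglongrightarrow> (\<integral>p. I p \<partial>(\<mu> \<Otimes>\<^sub>M unif))"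
        proof (rule integral_dominated_convergence[where w = "\<lambda>_. 1"])
          show "AE p in \<mu> \<Otimes>\<^sub>M unif. (\<lambda>m. J m p) \<longlonglongrightarrow> I p"
            using monoP
          proof eventually_elim
            case (elim p)
            show ?case
            proof (cases "\<theta> (fst p) \<in> C \<and> s < Q n (\<theta> (fst p)) (snd p)")
              case True
              then obtain t where t: "t \<in> \<rat>" "s < t" "snd p \<le> h t n (\<theta> (fst p))" using Qiff[OF 3] by auto
              from qlim[OF t(2)] have "\<forall>\<^sub>F m in sequentially. J m p = 1"
              proof eventually_elim
                case (elim m)
                then have "h t n (\<theta> (fst p)) \<le> h (q m) n (\<theta> (fst p))"
                  using \<open>\<forall>q\<in>\<rat>. \<forall>q'\<in>\<rat>. q \<le> q' \<longrightarrow> h q' n (\<theta> (fst p)) \<le> h q n (\<theta> (fst p))\<close> t(1) q(1)[of m] by auto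
                then show ?case using True t by (auto simp: J_def)
              qed
              then show ?thesis using True by (intro tendsto_eventually) (simp add: I_def)
            next
              \<comment> \<open>No rational above \<open>s\<close> qualifies, so every approximating
                indicator already vanishes.\<close>
              case False
              then have "J m p = I p" for m using Qiff[OF 3] q(1,2)[of m] by (auto simp: J_def I_def split: split_indicator)
              then show ?thesis by simp
            qed
          qed
          show "AE p in \<mu> \<Otimes>\<^sub>M unif. norm (J m p) \<le> 1" for m
            by (auto simp: J_def split: split_indicator)
        qed (simp_all add: Jm Im)
        have "(\<integral>p. J m p \<partial>(\<mu> \<Otimes>\<^sub>M unif)) = measure (\<gamma> n) {z. \<theta> (fst z) \<in> C \<and> q m < \<eta> (snd z)}" for m
        proof -
          have "(\<integral>p. J m p \<partial>(\<mu> \<Otimes>\<^sub>M unif)) = (\<integral>x. (\<integral>u. J m (x, u) \<partial>unif) \<partial>\<mu>)"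
          proof (rule P.integral_fst'[symmetric], rule P.integrable_const_bound[of _ 1])
            show "AE p in \<mu> \<Otimes>\<^sub>M unif. norm (J m p) \<le> 1"
              by (auto simp: J_def split: split_indicator)
          qed (rule Jm)
          also have "\<dots> = (\<integral>x. indicator C (\<theta> x) * h (q m) n (\<theta> x) \<partial>\<mu>)"
            by (simp only: J_def fst_conv snd_conv integral_mult_right_zero integral_unif_le[OF hb])
          finally show ?thesis by (simp add: hmu)
        qed
        with lim1 have l1: "(\<lambda>m. measure (\<gamma> n) {z. \<theta> (fst z) \<in> C \<and> q m < \<eta> (snd z)}) \<longlonglongrightarrow> (\<integral>p. I p \<partial>(\<mu> \<Otimes>\<^sub>M unif))" by simp
        have "(\<lambda>m. \<integral>z. indicat_real {z. \<theta> (fst z) \<in> C \<and> q m < \<eta> (snd z)} z \<partial>\<gamma> n) \<longlonglongrightarrow> (\<integral>z. indicat_real {z. \<theta> (fst z) \<in> C \<and> s < \<eta> (snd z)} z \<partial>\<gamma> n)"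
        proof (rule integral_dominated_convergence[where w = "\<lambda>_. 1"])
          show "AE z in \<gamma> n. (\<lambda>m. indicat_real {z. \<theta> (fst z) \<in> C \<and> q m < \<eta> (snd z)} z) \<longlonglongrightarrow> indicat_real {z. \<theta> (fst z) \<in> C \<and> s < \<eta> (snd z)} z"
          proof (rule AE_I2, rule tendsto_eventually)
            fix z
            show "\<forall>\<^sub>F m in sequentially. indicat_real {z. \<theta> (fst z) \<in> C \<and> q m < \<eta> (snd z)} z = indicat_real {z. \<theta> (fst z) \<in> C \<and> s < \<eta> (snd z)} z"
            proof (cases "s < \<eta> (snd z)")
              case True
              from qlim[OF this] show ?thesis by eventually_elim (use True in \<open>auto simp: indicator_def\<close>)
            next
              case False
              then have "\<not> q m < \<eta> (snd z)" for m using q(2)[of m] by auto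
              then show ?thesis using False by (simp add: indicator_def)
            qed
          qed
        qed auto
        then have "(\<lambda>m. measure (\<gamma> n) {z. \<theta> (fst z) \<in> C \<and> q m < \<eta> (snd z)}) \<longlonglongrightarrow> measure (\<gamma> n) {z. \<theta> (fst z) \<in> C \<and> s < \<eta> (snd z)}"
          by (simp add: spG)
        from LIMSEQ_unique[OF l1 this]
        have "(\<integral>p. I p \<partial>(\<mu> \<Otimes>\<^sub>M unif)) = measure (\<gamma> n) {z. \<theta> (fst z) \<in> C \<and> s < \<eta> (snd z)}" .
        moreover have "(\<integral>p. I p \<partial>(\<mu> \<Otimes>\<^sub>M unif)) = measure (\<mu> \<Otimes>\<^sub>M unif) {p \<in> space (\<mu> \<Otimes>\<^sub>M unif). \<theta> (fst p) \<in> C \<and> s < Q n (\<theta> (fst p)) (snd p)}"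
          unfolding I_def integral_indicator by (auto intro!: arg_cong[where f = "measure _"])
        ultimately show ?thesis by simp
      qed
    qed
    define W1 where "W1 = distr (\<mu> \<Otimes>\<^sub>M unif) (borel \<Otimes>\<^sub>M borel) (\<lambda>p. (\<theta> (fst p), Q n (\<theta> (fst p)) (snd p)))"
    define W2 where "W2 = distr (\<gamma> n) (borel \<Otimes>\<^sub>M borel) (\<lambda>z. (\<theta> (fst z), \<eta> (snd z)))"
    have pW: "prob_space W1" "prob_space W2" unfolding W1_def W2_def
      by (rule P.prob_space_distr G.prob_space_distr, measurable)+
    interpret W1: prob_space W1 by fact
    interpret W2: prob_space W2 by fact
    have sW: "sets W1 = sets (borel \<Otimes>\<^sub>M borel)" "sets W2 = sets (borel \<Otimes>\<^sub>M borel)" by (auto simp: W1_def W2_def)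
    have spW: "space W1 = UNIV" "space W2 = UNIV" by (auto simp: W1_def W2_def space_pair_measure)
    have rect0: "emeasure W1 (C \<times> {s<..}) = emeasure W2 (C \<times> {s<..})" if [measurable]: "C \<in> sets borel" for C s
    proof -
      have "measure W1 (C \<times> {s<..}) = measure W2 (C \<times> {s<..})"
        unfolding W1_def W2_def using key[OF that, of s]
        by (subst (1 2) measure_distr) (auto simp: vimage_def Int_def spG conj_commute)
      then show ?thesis by (simp add: W1.emeasure_eq_measure W2.emeasure_eq_measure)
    qed
    \<comment> \<open>For fixed \<open>C\<close>, the second marginals of the two laws restricted to
      \<open>C \<times> UNIV\<close> agree on half-lines, hence on all Borel sets.\<close>
    have rect: "emeasure W1 (C \<times> C') = emeasure W2 (C \<times> C')" if [measurable]: "C \<in> sets borel" and C'[measurable]: "C' \<in> sets borel" for C C'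
    proof -
      define R where "R W = distr (density W (indicator (C \<times> UNIV))) borel snd" for W :: "(real \<times> real) measure"
      have R: "emeasure (R W) T = emeasure W (C \<times> T)" if sets[measurable_cong]: "sets W = sets (borel \<Otimes>\<^sub>M borel)" and [measurable]: "T \<in> sets borel" for W T
      proof -
        have sp: "space W = UNIV" using sets_eq_imp_space_eq[OF sets] by (simp add: space_pair_measure)
        have [measurable]: "C \<times> T \<in> sets W" "C \<times> UNIV \<in> sets W" by measurable
        have sm: "snd \<in> W \<rightarrow>\<^sub>M borel" by measurable
        have [measurable]: "snd -` T \<in> sets W" using measurable_sets[OF sm, of T] sp by simp
        have "emeasure (R W) T = (\<integral>\<^sup>+w. indicator (C \<times> UNIV) w * indicator (snd -` T) w \<partial>W)"
          unfolding R_def by (subst emeasure_distr, measurable) (simp add: emeasure_density sp)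
        also have "\<dots> = (\<integral>\<^sup>+w. indicator (C \<times> T) w \<partial>W)"
          by (intro nn_integral_cong) (auto split: split_indicator)
        finally show ?thesis by simp
      qed
      have "R W1 = R W2"
        by (rule measure_eqI_lessThan) (auto simp: R sW rect0 W2.emeasure_eq_measure, auto simp: R_def)
      then show ?thesis using R[OF sW(1) C'] R[OF sW(2) C'] by simp
    qed
    have "W1 = W2"
    proof (rule measure_eqI_generator_eq[where E = "{a \<times> b |a b. a \<in> sets borel \<and> b \<in> sets borel}" and \<Omega> = UNIV and A = "\<lambda>_. UNIV"])
      show "Int_stable {a \<times> b |a b. a \<in> sets (borel :: real measure) \<and> b \<in> sets (borel :: real measure)}"
        by (rule Int_stable_pair_measure_generator)
      show "sets W1 = sigma_sets UNIV {a \<times> b |a b. a \<in> sets borel \<and> b \<in> sets borel}"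
        "sets W2 = sigma_sets UNIV {a \<times> b |a b. a \<in> sets borel \<and> b \<in> sets borel}"
        unfolding sW sets_pair_measure by (auto simp: UNIV_Times_UNIV)
      show "range (\<lambda>_. UNIV) \<subseteq> {a \<times> b |a b. a \<in> sets (borel :: real measure) \<and> b \<in> sets (borel :: real measure)}"
        by (auto intro!: exI[of _ UNIV])
    qed (auto simp: rect)
    \<comment> \<open>Decoding both coordinates turns the equality of encoded laws into the required
      equality of laws of state and action.\<close>
    then have eq: "distr W1 borel (\<lambda>(r, t). (D r, E t)) = distr W2 borel (\<lambda>(r, t). (D r, E t))" by simp
    have "distr W1 borel (\<lambda>(r, t). (D r, E t)) = distr (\<mu> \<Otimes>\<^sub>M unif) borel (\<lambda>(x, u). (x, \<aa> (n, x, u)))"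
      unfolding W1_def by (subst distr_distr) (auto simp: comp_def X(5) \<aa>_def case_prod_beta')
    moreover have "distr W2 borel (\<lambda>(r, t). (D r, E t)) = distr (\<gamma> n) borel (\<lambda>z. z)"
      unfolding W2_def by (subst distr_distr) (auto simp: comp_def X(5) A(5))
    moreover have "distr (\<gamma> n) borel (\<lambda>z. z) = \<gamma> n" using ProbD(2)[OF Pn] by (intro distr_id2) simp
    ultimately show "distr (distr (\<gamma> n) borel fst \<Otimes>\<^sub>M unif) borel (\<lambda>(x, u). (x, \<aa> (n, x, u))) = \<gamma> n"
      using eq unfolding \<mu>_def by simp
  qed
qed

section \<open>The lifted Bellman equation\<close>

instance prod :: (polish_space, polish_space) polish_space ..

lemma comp_metric_dist: "compact (UNIV :: 'y::polish_space set) \<Longrightarrow> comp_metric (dist :: 'y \<Rightarrow> 'y \<Rightarrow> real)"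
proof
  show "dist x z \<le> dist x y + dist y z" for x y z :: 'y by (rule dist_triangle)
qed (auto simp: dist_commute)

lemma comp_metric_sum_dist:
  assumes "compact (UNIV :: 'x::polish_space set)" "compact (UNIV :: 'a::polish_space set)"
  shows "comp_metric (sum_dist :: 'x \<times> 'a \<Rightarrow> 'x \<times> 'a \<Rightarrow> real)"
proof
  show "compact (UNIV :: ('x \<times> 'a) set)" using compact_Times[OF assms] by simp
  fix p q r :: "'x \<times> 'a"
  show "sum_dist p q = sum_dist q p" by (simp add: sum_dist_def dist_commute)
  show "sum_dist p r \<le> sum_dist p q + sum_dist q r"
    using dist_triangle[of "fst p" "fst r" "fst q"] dist_triangle[of "snd p" "snd r" "snd q"] by (simp add: sum_dist_def)
  show "dist p q \<le> sum_dist p q" unfolding sum_dist_def dist_prod_def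
    by (rule sqrt_sum_squares_le_sum) auto
  show "sum_dist p q \<le> 2 * dist p q"
    using dist_fst_le[of p q] dist_snd_le[of p q] by (simp add: sum_dist_def)
qed

text \<open>Quantified over \<open>Prob\<close> only: functions on the full type of measures carry
  no information elsewhere.\<close>

definition unif_cont :: "('y \<Rightarrow> 'y \<Rightarrow> real) \<Rightarrow> ('y::topological_space measure \<Rightarrow> real) \<Rightarrow> bool" where
  "unif_cont \<rho> \<phi> \<longleftrightarrow>
     (\<forall>e>0. \<exists>\<delta>>0. \<forall>\<mu>\<in>Prob. \<forall>\<nu>\<in>Prob. wasserstein \<rho> \<mu> \<nu> < \<delta> \<longrightarrow> \<bar>\<phi> \<mu> - \<phi> \<nu>\<bar> < e)"

lemma (in comp_metric) unif_cont_measurable: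
  assumes uc: "unif_cont \<rho> \<phi>" shows "\<phi> \<in> borel_measurable (prob_algebra borel)"
proof -
  have "\<phi> \<in> borel_measurable (wass_borel \<rho>)"
  proof (rule Wd_continuous_measurable)
    fix \<mu> :: "'y measure" and e :: real assume "\<mu> \<in> Prob" "0 < e"
    with uc[unfolded unif_cont_def, rule_format, OF \<open>0 < e\<close>]
    show "\<exists>\<delta>>0. \<forall>\<nu>\<in>Prob. Wd \<mu> \<nu> < \<delta> \<longrightarrow> \<bar>\<phi> \<mu> - \<phi> \<nu>\<bar> < e" by blast
  qed
  then show ?thesis using measurable_cong_sets[OF sets_wass_borel_eq refl] by blast
qed

section \<open>The lifted transition and reward\<close>

context cmkv_mdp
begin

sublocale Xm: comp_metric "dist :: 'x \<Rightarrow> 'x \<Rightarrow> real"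
  by (rule comp_metric_dist[OF compact_state])

sublocale Pm: comp_metric "sum_dist :: 'x \<times> 'a \<Rightarrow> 'x \<times> 'a \<Rightarrow> real"
  by (rule comp_metric_sum_dist[OF compact_state compact_action])

definition nlaw where "nlaw = distr (prb S) (nsp S) (noise S 1)"
definition claw where "claw = distr (prb S) (csp S) (common S 1)"

lemma noise_measurable[measurable]: "1 \<le> t \<Longrightarrow> noise S t \<in> prb S \<rightarrow>\<^sub>M nsp S"
  using noise_indep by (auto simp: indep_vars_def)

lemma common_measurable[measurable]: "1 \<le> t \<Longrightarrow> common S t \<in> prb S \<rightarrow>\<^sub>M csp S"
  using common_indep by (auto simp: indep_vars_def)

lemma rnd_measurable[measurable]: "rnd S t \<in> prb S \<rightarrow>\<^sub>M unif"
  using rnd_indep by (auto simp: indep_vars_def)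

lemma nlaw_prob: "prob_space nlaw" and claw_prob: "prob_space claw"
  unfolding nlaw_def claw_def by (auto intro!: prob_space_distr)

lemma sets_nlaw[measurable_cong, simp]: "sets nlaw = sets (nsp S)" and space_nlaw[simp]: "space nlaw = space (nsp S)"
  and sets_claw[measurable_cong, simp]: "sets claw = sets (csp S)" and space_claw[simp]: "space claw = space (csp S)"
  by (auto simp: nlaw_def claw_def)

lemma trans_measurable':
  "(\<lambda>(x, a, \<mu>, e, e0). trans_fun S x a \<mu> e e0)
     \<in> borel \<Otimes>\<^sub>M borel \<Otimes>\<^sub>M prob_algebra borel \<Otimes>\<^sub>M nsp S \<Otimes>\<^sub>M csp S \<rightarrow>\<^sub>M borel"
proof -
  have "sets ((borel :: 'x measure) \<Otimes>\<^sub>M (borel :: 'a measure) \<Otimes>\<^sub>M wass_borel (sum_dist :: 'x \<times> 'a \<Rightarrow> _) \<Otimes>\<^sub>M nsp S \<Otimes>\<^sub>M csp S)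
    = sets (borel \<Otimes>\<^sub>M borel \<Otimes>\<^sub>M prob_algebra borel \<Otimes>\<^sub>M nsp S \<Otimes>\<^sub>M csp S)"
    by (intro sets_pair_measure_cong refl Pm.sets_wass_borel_eq)
  from measurable_cong_sets[OF this refl] show ?thesis using trans_measurable by blast
qed

lemma reward_measurable':
  "(\<lambda>(x, a, \<mu>). reward S x a \<mu>) \<in> borel \<Otimes>\<^sub>M borel \<Otimes>\<^sub>M prob_algebra borel \<rightarrow>\<^sub>M borel"
proof -
  have "sets ((borel :: 'x measure) \<Otimes>\<^sub>M (borel :: 'a measure) \<Otimes>\<^sub>M wass_borel (sum_dist :: 'x \<times> 'a \<Rightarrow> _))
    = sets (borel \<Otimes>\<^sub>M borel \<Otimes>\<^sub>M prob_algebra borel)"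
    by (intro sets_pair_measure_cong refl Pm.sets_wass_borel_eq)
  from measurable_cong_sets[OF this refl] show ?thesis using reward_measurable by blast
qed

lemma trans_comp[measurable (raw)]:
  assumes "X \<in> M \<rightarrow>\<^sub>M borel" "A \<in> M \<rightarrow>\<^sub>M borel" "m \<in> M \<rightarrow>\<^sub>M prob_algebra borel" "n \<in> M \<rightarrow>\<^sub>M nsp S" "c \<in> M \<rightarrow>\<^sub>M csp S"
  shows "(\<lambda>\<omega>. trans_fun S (X \<omega>) (A \<omega>) (m \<omega>) (n \<omega>) (c \<omega>)) \<in> M \<rightarrow>\<^sub>M borel"
proof -
  have "(\<lambda>\<omega>. (X \<omega>, A \<omega>, m \<omega>, n \<omega>, c \<omega>)) \<in> M \<rightarrow>\<^sub>M borel \<Otimes>\<^sub>M borel \<Otimes>\<^sub>M prob_algebra borel \<Otimes>\<^sub>M nsp S \<Otimes>\<^sub>M csp S"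
    using assms by (intro measurable_Pair)
  from measurable_compose[OF this trans_measurable'] show ?thesis by simp
qed

lemma reward_comp[measurable (raw)]:
  assumes "X \<in> M \<rightarrow>\<^sub>M borel" "A \<in> M \<rightarrow>\<^sub>M borel" "m \<in> M \<rightarrow>\<^sub>M prob_algebra borel"
  shows "(\<lambda>\<omega>. reward S (X \<omega>) (A \<omega>) (m \<omega>)) \<in> M \<rightarrow>\<^sub>M borel"
proof -
  have "(\<lambda>\<omega>. (X \<omega>, A \<omega>, m \<omega>)) \<in> M \<rightarrow>\<^sub>M borel \<Otimes>\<^sub>M borel \<Otimes>\<^sub>M prob_algebra borel"
    using assms by (intro measurable_Pair)
  from measurable_compose[OF this reward_measurable'] show ?thesis by simp
qed

lemma fst_borel[measurable]: "fst \<in> (borel :: ('x \<times> 'a) measure) \<rightarrow>\<^sub>M borel"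
  and snd_borel[measurable]: "snd \<in> (borel :: ('x \<times> 'a) measure) \<rightarrow>\<^sub>M borel"
  unfolding borel_prod[symmetric] by measurable

definition Fhat :: "('x \<times> 'a) measure \<Rightarrow> 'e0 \<Rightarrow> 'x measure" where
  "Fhat \<gamma> e0 = distr (\<gamma> \<Otimes>\<^sub>M nlaw) borel (\<lambda>(p, e). trans_fun S (fst p) (snd p) \<gamma> e e0)"

definition fhat :: "('x \<times> 'a) measure \<Rightarrow> real" where
  "fhat \<gamma> = (\<integral>p. reward S (fst p) (snd p) \<gamma> \<partial>\<gamma>)"

definition pr1 :: "('x \<times> 'a) measure \<Rightarrow> 'x measure" where
  "pr1 \<gamma> = distr \<gamma> borel fst"

definition J :: "('x measure \<Rightarrow> real) \<Rightarrow> ('x \<times> 'a) measure \<Rightarrow> real" where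
  "J w \<gamma> = fhat \<gamma> + disc S * (\<integral>e0. w (Fhat \<gamma> e0) \<partial>claw)"

definition T :: "('x measure \<Rightarrow> real) \<Rightarrow> 'x measure \<Rightarrow> real" where
  "T w \<mu> = (SUP \<gamma>\<in>{\<gamma>\<in>Prob. pr1 \<gamma> = \<mu>}. J w \<gamma>)"

lemma Fhat_measurable: "(\<lambda>(\<gamma>, e0). Fhat \<gamma> e0) \<in> prob_algebra borel \<Otimes>\<^sub>M csp S \<rightarrow>\<^sub>M prob_algebra borel"
proof -
  have nl: "nlaw \<in> space (prob_algebra (nsp S))" by (simp add: space_prob_algebra nlaw_prob)
  have "(\<lambda>x. fst x \<Otimes>\<^sub>M nlaw) \<in> prob_algebra (borel :: ('x \<times> 'a) measure) \<Otimes>\<^sub>M csp S \<rightarrow>\<^sub>M prob_algebra (borel \<Otimes>\<^sub>M nsp S)"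
    using nl by measurable
  moreover have "(\<lambda>(x, y). (\<lambda>(p, e). trans_fun S (fst p) (snd p) (fst x) e (snd x)) y)
    \<in> (prob_algebra (borel :: ('x \<times> 'a) measure) \<Otimes>\<^sub>M csp S) \<Otimes>\<^sub>M (borel \<Otimes>\<^sub>M nsp S) \<rightarrow>\<^sub>M borel"
    unfolding case_prod_beta' by measurable
  ultimately have "(\<lambda>x. distr (fst x \<Otimes>\<^sub>M nlaw) borel (\<lambda>(p, e). trans_fun S (fst p) (snd p) (fst x) e (snd x)))
    \<in> prob_algebra (borel :: ('x \<times> 'a) measure) \<Otimes>\<^sub>M csp S \<rightarrow>\<^sub>M prob_algebra borel"
    by (rule measurable_distr_prob_space2)
  then show ?thesis by (simp add: Fhat_def case_prod_beta')
qed

lemma Fhat_Prob: "\<gamma> \<in> Prob \<Longrightarrow> e0 \<in> space (csp S) \<Longrightarrow> Fhat \<gamma> e0 \<in> Prob"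
  using measurable_space[OF Fhat_measurable, of "(\<gamma>, e0)"] by (simp add: space_pair_measure)

lemma pr1_measurable: "pr1 \<in> prob_algebra borel \<rightarrow>\<^sub>M prob_algebra borel"
  unfolding pr1_def by (rule measurable_distr_prob_space2[where M = borel]) (auto simp: case_prod_beta')

lemma pr1_Prob: "\<gamma> \<in> Prob \<Longrightarrow> pr1 \<gamma> \<in> Prob"
  by (rule measurable_space[OF pr1_measurable])

lemma fhat_measurable: "fhat \<in> borel_measurable (prob_algebra borel)"
  unfolding fhat_def by (rule measurable_integral_kernel[where Z = borel]) (auto simp: case_prod_beta')

text \<open>Both transitions are run with the same noise along a near-optimal coupling of the joint
  laws. The factor 2 arises because the distance enters twice: as the cost of the coupling and
  through the measure argument of the transition. The bound is uniform in the common noise.\<close>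

lemma Fhat_lipschitz:
  "\<exists>K>0. \<forall>\<gamma>\<in>Prob. \<forall>\<gamma>'\<in>Prob. \<forall>e0\<in>space (csp S).
     wasserstein dist (Fhat \<gamma> e0) (Fhat \<gamma>' e0) \<le> K * wasserstein sum_dist \<gamma> \<gamma>'"
proof -
  obtain K where K: "0 < K" "\<And>x x' a a' \<mu> \<mu>' e0. \<mu> \<in> Prob \<Longrightarrow> \<mu>' \<in> Prob \<Longrightarrow> e0 \<in> space (csp S) \<Longrightarrow>
      expectation (\<lambda>\<omega>. dist (trans_fun S x a \<mu> (noise S 1 \<omega>) e0) (trans_fun S x' a' \<mu>' (noise S 1 \<omega>) e0))
           \<le> K * (sum_dist (x, a) (x', a') + wasserstein sum_dist \<mu> \<mu>')"
    using trans_lipschitz by blast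
  show ?thesis
  proof (intro exI[of _ "2 * K"] conjI ballI)
    show "0 < 2 * K" using K by simp
    fix \<gamma> \<gamma>' :: "('x \<times> 'a) measure" and e0 assume P: "\<gamma> \<in> Prob" "\<gamma>' \<in> Prob" and e0: "e0 \<in> space (csp S)"
    show "wasserstein dist (Fhat \<gamma> e0) (Fhat \<gamma>' e0) \<le> 2 * K * wasserstein sum_dist \<gamma> \<gamma>'"
    proof (rule field_le_epsilon)
      fix d :: real assume "0 < d"
      then have "0 < d / K" using K by simp
      from Pm.Wd_coupling[OF P this] obtain \<pi> where \<pi>: "prob_space \<pi>" and s\<pi>[measurable_cong]: "sets \<pi> = sets (borel \<Otimes>\<^sub>M borel)"
        and m: "distr \<pi> borel fst = \<gamma>" "distr \<pi> borel snd = \<gamma>'"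
        and cost: "(\<integral>p. sum_dist (fst p) (snd p) \<partial>\<pi>) < wasserstein sum_dist \<gamma> \<gamma>' + d / K" .
      interpret \<pi>: prob_space \<pi> by fact
      interpret nl: prob_space nlaw by (rule nlaw_prob)
      interpret P: pair_prob_space \<pi> nlaw ..
      have fm: "fst \<in> \<pi> \<rightarrow>\<^sub>M borel" and sm: "snd \<in> \<pi> \<rightarrow>\<^sub>M borel" by measurable
      have nid: "distr nlaw (nsp S) (\<lambda>x. x) = nlaw" by (rule distr_id2) simp
      \<comment> \<open>Rewrites each of the two laws as an image of the one product of coupling and
        noise, so that \<open>Wd_le\<close> applies on that space.\<close>
      have lift: "Fhat (distr \<pi> borel h) e0 = distr (\<pi> \<Otimes>\<^sub>M nlaw) borel (\<lambda>(p, e). trans_fun S (fst (h p)) (snd (h p)) (distr \<pi> borel h) e e0)"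
        if h[measurable]: "h \<in> \<pi> \<rightarrow>\<^sub>M borel" for h
      proof -
        have [measurable]: "distr \<pi> borel h \<in> space (prob_algebra borel)" by (rule Prob_distr[OF \<pi> h])
        have e: "distr \<pi> borel h \<Otimes>\<^sub>M nlaw = distr (\<pi> \<Otimes>\<^sub>M nlaw) (borel \<Otimes>\<^sub>M nsp S) (\<lambda>(p, e). (h p, e))"
          by (subst nid[symmetric], subst pair_measure_distr)
             (auto simp: nid nl.sigma_finite_measure_axioms)
        show ?thesis unfolding Fhat_def e using e0
          by (subst distr_distr) (auto simp: comp_def case_prod_beta')
      qed
      have Pm: "\<gamma> \<in> space (prob_algebra borel)" "\<gamma>' \<in> space (prob_algebra borel)" using P by auto
      define D where "D q = dist (trans_fun S (fst (fst (fst q))) (snd (fst (fst q))) \<gamma> (snd q) e0)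
        (trans_fun S (fst (snd (fst q))) (snd (snd (fst q))) \<gamma>' (snd q) e0)" for q
      have [measurable]: "(\<lambda>q. trans_fun S (fst (fst (fst q))) (snd (fst (fst q))) \<gamma> (snd q) e0) \<in> \<pi> \<Otimes>\<^sub>M nlaw \<rightarrow>\<^sub>M borel"
        "(\<lambda>q. trans_fun S (fst (snd (fst q))) (snd (snd (fst q))) \<gamma>' (snd q) e0) \<in> \<pi> \<Otimes>\<^sub>M nlaw \<rightarrow>\<^sub>M borel"
        using Pm e0 by measurable
      have "wasserstein dist (Fhat \<gamma> e0) (Fhat \<gamma>' e0) \<le> (\<integral>q. D q \<partial>(\<pi> \<Otimes>\<^sub>M nlaw))"
        using Xm.Wd_le[OF P.prob_space_axioms, of "\<lambda>q. trans_fun S (fst (fst (fst q))) (snd (fst (fst q))) \<gamma> (snd q) e0"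
            "\<lambda>q. trans_fun S (fst (snd (fst q))) (snd (snd (fst q))) \<gamma>' (snd q) e0"]
          lift[OF fm] lift[OF sm]
        by (simp add: m D_def case_prod_beta')
      also have Dint: "integrable (\<pi> \<Otimes>\<^sub>M nlaw) D"
        unfolding D_def by (rule Xm.rho_integrable[OF P.finite_measure_axioms]) measurable
      have "(\<integral>q. D q \<partial>(\<pi> \<Otimes>\<^sub>M nlaw)) = (\<integral>p. (\<integral>e. D (p, e) \<partial>nlaw) \<partial>\<pi>)"
        by (rule P.integral_fst'[OF Dint, symmetric])
      also have "\<dots> \<le> (\<integral>p. K * (sum_dist (fst p) (snd p) + wasserstein sum_dist \<gamma> \<gamma>') \<partial>\<pi>)"
      proof (rule integral_mono)
        show "integrable \<pi> (\<lambda>p. \<integral>e. D (p, e) \<partial>nlaw)" by (rule P.integrable_fst'[OF Dint])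
        show "integrable \<pi> (\<lambda>p. K * (sum_dist (fst p) (snd p) + wasserstein sum_dist \<gamma> \<gamma>'))"
          by (intro integrable_mult_right Bochner_Integration.integrable_add Pm.rho_integrable[OF \<pi>.finite_measure_axioms]) auto
        fix p
        have "(\<integral>e. D (p, e) \<partial>nlaw) = expectation (\<lambda>\<omega>. dist (trans_fun S (fst (fst p)) (snd (fst p)) \<gamma> (noise S 1 \<omega>) e0)
          (trans_fun S (fst (snd p)) (snd (snd p)) \<gamma>' (noise S 1 \<omega>) e0))"
          unfolding D_def nlaw_def using Pm e0 by (subst integral_distr) auto
        also have "\<dots> \<le> K * (sum_dist (fst p) (snd p) + wasserstein sum_dist \<gamma> \<gamma>')"
          using K(2)[OF P e0, of "fst (fst p)" "snd (fst p)" "fst (snd p)" "snd (snd p)"] by simp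
        finally show "(\<integral>e. D (p, e) \<partial>nlaw) \<le> K * (sum_dist (fst p) (snd p) + wasserstein sum_dist \<gamma> \<gamma>')" .
      qed
      also have "\<dots> = K * ((\<integral>p. sum_dist (fst p) (snd p) \<partial>\<pi>) + wasserstein sum_dist \<gamma> \<gamma>')"
        using Pm.rho_integrable[OF \<pi>.finite_measure_axioms fm sm] by (simp add: \<pi>.prob_space)
      also have "\<dots> \<le> K * ((wasserstein sum_dist \<gamma> \<gamma>' + d / K) + wasserstein sum_dist \<gamma> \<gamma>')"
        using K cost by (intro mult_left_mono add_right_mono) auto
      also have "\<dots> = 2 * K * wasserstein sum_dist \<gamma> \<gamma>' + d" using K by (simp add: field_simps)
      finally show "wasserstein dist (Fhat \<gamma> e0) (Fhat \<gamma>' e0) \<le> 2 * K * wasserstein sum_dist \<gamma> \<gamma>' + d" .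
    qed
  qed
qed

lemma reward_integrable:
  assumes "\<gamma> \<in> Prob" "prob_space M" "X \<in> M \<rightarrow>\<^sub>M borel" "A \<in> M \<rightarrow>\<^sub>M borel"
  shows "integrable M (\<lambda>\<omega>. reward S (X \<omega>) (A \<omega>) \<gamma>)"
proof -
  obtain C where C: "\<And>x a \<mu>. \<mu> \<in> Prob \<Longrightarrow> \<bar>reward S x a \<mu>\<bar> \<le> C" using reward_bounded by blast
  interpret M: prob_space M by fact
  show ?thesis using C[OF assms(1)] assms
    by (intro M.integrable_const_bound[of _ C]) auto
qed

text \<open>The same double count as for \<open>Fhat\<close>: one contribution from the coupled
  points, one from the measure argument of the reward.\<close>

lemma fhat_lipschitz:
  "\<exists>K>0. \<forall>\<gamma>\<in>Prob. \<forall>\<gamma>'\<in>Prob. \<bar>fhat \<gamma> - fhat \<gamma>'\<bar> \<le> K * wasserstein sum_dist \<gamma> \<gamma>'"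
proof -
  obtain K where K: "0 < K" "\<And>x x' a a' \<mu> \<mu>'. \<mu> \<in> Prob \<Longrightarrow> \<mu>' \<in> Prob \<Longrightarrow>
      \<bar>reward S x a \<mu> - reward S x' a' \<mu>'\<bar> \<le> K * (sum_dist (x, a) (x', a') + wasserstein sum_dist \<mu> \<mu>')"
    using reward_lipschitz by blast
  show ?thesis
  proof (intro exI[of _ "2 * K"] conjI ballI)
    show "0 < 2 * K" using K by simp
    fix \<gamma> \<gamma>' :: "('x \<times> 'a) measure" assume P: "\<gamma> \<in> Prob" "\<gamma>' \<in> Prob"
    show "\<bar>fhat \<gamma> - fhat \<gamma>'\<bar> \<le> 2 * K * wasserstein sum_dist \<gamma> \<gamma>'"
    proof (rule field_le_epsilon)
      fix d :: real assume "0 < d"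
      then have "0 < d / K" using K by simp
      from Pm.Wd_coupling[OF P this] obtain \<pi> where \<pi>: "prob_space \<pi>" and s\<pi>[measurable_cong]: "sets \<pi> = sets (borel \<Otimes>\<^sub>M borel)"
        and m: "distr \<pi> borel fst = \<gamma>" "distr \<pi> borel snd = \<gamma>'"
        and cost: "(\<integral>p. sum_dist (fst p) (snd p) \<partial>\<pi>) < wasserstein sum_dist \<gamma> \<gamma>' + d / K" .
      interpret \<pi>: prob_space \<pi> by fact
      have fm: "fst \<in> \<pi> \<rightarrow>\<^sub>M borel" and sm: "snd \<in> \<pi> \<rightarrow>\<^sub>M borel" by measurable
      have Pm: "\<gamma> \<in> space (prob_algebra borel)" "\<gamma>' \<in> space (prob_algebra borel)" using P by auto
      have i1: "integrable \<pi> (\<lambda>p. reward S (fst (fst p)) (snd (fst p)) \<gamma>)"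
        by (rule reward_integrable[OF P(1) \<pi>]) measurable
      have i2: "integrable \<pi> (\<lambda>p. reward S (fst (snd p)) (snd (snd p)) \<gamma>')"
        by (rule reward_integrable[OF P(2) \<pi>]) measurable
      have "fhat \<gamma> = (\<integral>p. reward S (fst (fst p)) (snd (fst p)) \<gamma> \<partial>\<pi>)"
      proof -
        have "fhat \<gamma> = (\<integral>p. reward S (fst p) (snd p) \<gamma> \<partial>distr \<pi> borel fst)" unfolding m fhat_def ..
        also have "\<dots> = (\<integral>p. reward S (fst (fst p)) (snd (fst p)) \<gamma> \<partial>\<pi>)"
          by (rule integral_distr) (use Pm in measurable)
        finally show ?thesis .
      qed
      moreover have "fhat \<gamma>' = (\<integral>p. reward S (fst (snd p)) (snd (snd p)) \<gamma>' \<partial>\<pi>)"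
      proof -
        have "fhat \<gamma>' = (\<integral>p. reward S (fst p) (snd p) \<gamma>' \<partial>distr \<pi> borel snd)" unfolding m fhat_def ..
        also have "\<dots> = (\<integral>p. reward S (fst (snd p)) (snd (snd p)) \<gamma>' \<partial>\<pi>)"
          by (rule integral_distr) (use Pm in measurable)
        finally show ?thesis .
      qed
      ultimately have "\<bar>fhat \<gamma> - fhat \<gamma>'\<bar> = \<bar>\<integral>p. reward S (fst (fst p)) (snd (fst p)) \<gamma> - reward S (fst (snd p)) (snd (snd p)) \<gamma>' \<partial>\<pi>\<bar>"
        using i1 i2 by simp
      also have "\<dots> \<le> (\<integral>p. \<bar>reward S (fst (fst p)) (snd (fst p)) \<gamma> - reward S (fst (snd p)) (snd (snd p)) \<gamma>'\<bar> \<partial>\<pi>)"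
        by (rule integral_abs_bound)
      also have "\<dots> \<le> (\<integral>p. K * (sum_dist (fst p) (snd p) + wasserstein sum_dist \<gamma> \<gamma>') \<partial>\<pi>)"
      proof (rule integral_mono)
        show "integrable \<pi> (\<lambda>p. K * (sum_dist (fst p) (snd p) + wasserstein sum_dist \<gamma> \<gamma>'))"
          by (intro integrable_mult_right Bochner_Integration.integrable_add Pm.rho_integrable[OF \<pi>.finite_measure_axioms]) auto
        show "\<bar>reward S (fst (fst p)) (snd (fst p)) \<gamma> - reward S (fst (snd p)) (snd (snd p)) \<gamma>'\<bar> \<le> K * (sum_dist (fst p) (snd p) + wasserstein sum_dist \<gamma> \<gamma>')" for p
          using K(2)[OF P, of "fst (fst p)" "snd (fst p)" "fst (snd p)" "snd (snd p)"] by simp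
      qed (use i1 i2 in auto)
      also have "\<dots> = K * ((\<integral>p. sum_dist (fst p) (snd p) \<partial>\<pi>) + wasserstein sum_dist \<gamma> \<gamma>')"
        using Pm.rho_integrable[OF \<pi>.finite_measure_axioms fm sm] by (simp add: \<pi>.prob_space)
      also have "\<dots> \<le> K * ((wasserstein sum_dist \<gamma> \<gamma>' + d / K) + wasserstein sum_dist \<gamma> \<gamma>')"
        using K cost by (intro mult_left_mono add_right_mono) auto
      also have "\<dots> = 2 * K * wasserstein sum_dist \<gamma> \<gamma>' + d" using K by (simp add: field_simps)
      finally show "\<bar>fhat \<gamma> - fhat \<gamma>'\<bar> \<le> 2 * K * wasserstein sum_dist \<gamma> \<gamma>' + d" .
    qed
  qed
qed

lemma w_Fhat_integrable:
  fixes B :: real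
  assumes w: "w \<in> borel_measurable (prob_algebra borel)" and B: "\<And>\<mu>. \<mu> \<in> Prob \<Longrightarrow> \<bar>w \<mu>\<bar> \<le> B" and P: "\<gamma> \<in> Prob"
  shows "integrable claw (\<lambda>e0. w (Fhat \<gamma> e0))"
proof -
  interpret cl: prob_space claw by (rule claw_prob)
  have "(\<lambda>e0. w (Fhat \<gamma> e0)) \<in> borel_measurable (csp S)"
    using measurable_compose[OF measurable_compose[OF measurable_Pair1'[OF P] Fhat_measurable] w] by simp
  then show ?thesis
    by (intro cl.integrable_const_bound[of _ B]) (auto intro!: B Fhat_Prob[OF P] AE_I2)
qed

lemma J_unif_cont:
  fixes B :: real
  assumes uc: "unif_cont dist w" and B: "\<And>\<mu>. \<mu> \<in> Prob \<Longrightarrow> \<bar>w \<mu>\<bar> \<le> B"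
  shows "unif_cont sum_dist (J w)"
  unfolding unif_cont_def
proof (intro allI impI)
  fix e :: real assume "0 < e"
  interpret cl: prob_space claw by (rule claw_prob)
  note wm = Xm.unif_cont_measurable[OF uc]
  obtain K1 where K1: "0 < K1" "\<And>\<gamma> \<gamma>' e0. \<gamma> \<in> Prob \<Longrightarrow> \<gamma>' \<in> Prob \<Longrightarrow> e0 \<in> space (csp S) \<Longrightarrow>
     wasserstein dist (Fhat \<gamma> e0) (Fhat \<gamma>' e0) \<le> K1 * wasserstein sum_dist \<gamma> \<gamma>'" using Fhat_lipschitz by blast
  obtain K2 where K2: "0 < K2" "\<And>\<gamma> \<gamma>'. \<gamma> \<in> Prob \<Longrightarrow> \<gamma>' \<in> Prob \<Longrightarrow> \<bar>fhat \<gamma> - fhat \<gamma>'\<bar> \<le> K2 * wasserstein sum_dist \<gamma> \<gamma>'"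
    using fhat_lipschitz by blast
  obtain \<delta> where \<delta>: "0 < \<delta>" "\<And>\<mu> \<nu>. \<mu> \<in> Prob \<Longrightarrow> \<nu> \<in> Prob \<Longrightarrow> wasserstein dist \<mu> \<nu> < \<delta> \<Longrightarrow> \<bar>w \<mu> - w \<nu>\<bar> < e/2"
    using uc \<open>0 < e\<close> unfolding unif_cont_def by (meson half_gt_zero)
  show "\<exists>\<delta>>0. \<forall>\<mu>\<in>Prob. \<forall>\<nu>\<in>Prob. wasserstein sum_dist \<mu> \<nu> < \<delta> \<longrightarrow> \<bar>J w \<mu> - J w \<nu>\<bar> < e"
  \<comment> \<open>The first radius makes the next laws \<delta>-close for every common noise, the
    second makes the rewards differ by less than \<open>e/2\<close>.\<close>
  proof (intro exI[of _ "min (\<delta> / K1) (e / (2 * K2))"] conjI ballI impI)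
    show "0 < min (\<delta> / K1) (e / (2 * K2))" using \<delta> K1 K2 \<open>0 < e\<close> by simp
    fix \<gamma> \<gamma>' :: "('x \<times> 'a) measure" assume P: "\<gamma> \<in> Prob" "\<gamma>' \<in> Prob"
      and l: "wasserstein sum_dist \<gamma> \<gamma>' < min (\<delta> / K1) (e / (2 * K2))"
    have "K2 * wasserstein sum_dist \<gamma> \<gamma>' < e / 2" using l K2 by (simp add: field_simps)
    then have 1: "\<bar>fhat \<gamma> - fhat \<gamma>'\<bar> < e/2" using K2(2)[OF P] by linarith
    have "K1 * wasserstein sum_dist \<gamma> \<gamma>' < \<delta>" using l K1 by (simp add: field_simps)
    then have ptw: "\<bar>w (Fhat \<gamma> e0) - w (Fhat \<gamma>' e0)\<bar> \<le> e/2" if "e0 \<in> space (csp S)" for e0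
      using K1(2)[OF P that] \<delta>(2)[OF Fhat_Prob[OF P(1) that] Fhat_Prob[OF P(2) that]] by linarith
    note i = w_Fhat_integrable[OF wm B P(1)] w_Fhat_integrable[OF wm B P(2)]
    have "\<bar>(\<integral>e0. w (Fhat \<gamma> e0) \<partial>claw) - (\<integral>e0. w (Fhat \<gamma>' e0) \<partial>claw)\<bar> = \<bar>\<integral>e0. w (Fhat \<gamma> e0) - w (Fhat \<gamma>' e0) \<partial>claw\<bar>"
      using i by simp
    also have "\<dots> \<le> (\<integral>e0. \<bar>w (Fhat \<gamma> e0) - w (Fhat \<gamma>' e0)\<bar> \<partial>claw)" by (rule integral_abs_bound)
    also have "\<dots> \<le> (\<integral>e0. e/2 \<partial>claw)" using i ptw by (intro integral_mono) auto
    finally have "\<bar>(\<integral>e0. w (Fhat \<gamma> e0) \<partial>claw) - (\<integral>e0. w (Fhat \<gamma>' e0) \<partial>claw)\<bar> \<le> e/2" using cl.prob_space by simp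
    then have "disc S * \<bar>(\<integral>e0. w (Fhat \<gamma> e0) \<partial>claw) - (\<integral>e0. w (Fhat \<gamma>' e0) \<partial>claw)\<bar> \<le> 1 * (e/2)"
      using disc \<open>0 < e\<close> by (intro mult_mono) auto
    moreover have "\<bar>disc S * (\<integral>e0. w (Fhat \<gamma> e0) \<partial>claw) - disc S * (\<integral>e0. w (Fhat \<gamma>' e0) \<partial>claw)\<bar>
      = disc S * \<bar>(\<integral>e0. w (Fhat \<gamma> e0) \<partial>claw) - (\<integral>e0. w (Fhat \<gamma>' e0) \<partial>claw)\<bar>"
      using disc by (simp add: right_diff_distrib[symmetric] abs_mult)
    ultimately show "\<bar>J w \<gamma> - J w \<gamma>'\<bar> < e" using 1 unfolding J_def by linarith
  qed
qed

text \<open>The state coordinate of \<gamma> is replaced by a nearby \<mu>-distributed one while the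
  action is kept. The action then costs nothing in \<open>sum_dist\<close>, and only the distance of
  the state laws is paid.\<close>

lemma fiber_lift:
  assumes P: "\<gamma> \<in> Prob" "\<mu> \<in> Prob" and e: "0 < e"
  shows "\<exists>\<gamma>'\<in>Prob. pr1 \<gamma>' = \<mu> \<and> wasserstein sum_dist \<gamma> \<gamma>' < wasserstein dist (pr1 \<gamma>) \<mu> + e"
proof -
  have e2: "0 < e/2" using e by simp
  from Xm.Wd_coupling[OF P(2) pr1_Prob[OF P(1)] e2] obtain \<pi> where \<pi>: "prob_space \<pi>"
    and s\<pi>[measurable_cong]: "sets \<pi> = sets (borel \<Otimes>\<^sub>M borel)"
    and m: "distr \<pi> borel fst = \<mu>" "distr \<pi> borel snd = pr1 \<gamma>"
    and cost: "(\<integral>p. dist (fst p) (snd p) \<partial>\<pi>) < wasserstein dist \<mu> (pr1 \<gamma>) + e/2" .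
  interpret G: prob_space \<gamma> by (rule ProbD[OF P(1)])
  have sG[measurable_cong]: "sets \<gamma> = sets borel" by (rule ProbD[OF P(1)])
  obtain c :: "'x \<Rightarrow> nat" where c[measurable]: "c \<in> borel \<rightarrow>\<^sub>M count_space UNIV"
    and cd: "\<And>y y'. c y = c y' \<Longrightarrow> dist y y' < e/2" using small_cells[OF e2] by metis
  have "distr \<pi> (count_space UNIV) (\<lambda>p. c (snd p)) = distr (distr \<pi> borel snd) (count_space UNIV) c"
    by (simp add: distr_distr comp_def)
  also have "\<dots> = distr \<gamma> (count_space UNIV) (\<lambda>p. c (fst p))"
    unfolding m pr1_def by (simp add: distr_distr comp_def)
  finally obtain N where N: "prob_space N" and sN[measurable_cong]: "sets N = sets (\<pi> \<Otimes>\<^sub>M \<gamma>)"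
    and d1: "distr N \<pi> fst = \<pi>" and d2: "distr N \<gamma> snd = \<gamma>"
    and ae: "AE p in N. c (snd (fst p)) = c (fst (snd p))"
    using glue[OF \<pi> G.prob_space_axioms, of "\<lambda>p. c (snd p)" "\<lambda>p. c (fst p)"] by (auto simp: measurable_split_conv)
  interpret N: prob_space N by fact
  have [measurable]: "fst \<in> N \<rightarrow>\<^sub>M \<pi>" "snd \<in> N \<rightarrow>\<^sub>M borel" by measurable
  \<comment> \<open>State from the coupling, action from \<gamma>; the two copies of the original
    state agree up to a cell of diameter \<open>e/2\<close>, and the other \<open>e/2\<close> is the
    loss of the coupling.\<close>
  define \<gamma>' where "\<gamma>' = distr N borel (\<lambda>p. (fst (fst p), snd (snd p)))"
  have P': "\<gamma>' \<in> Prob" unfolding \<gamma>'_def by (rule Prob_distr[OF N]) measurable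
  have "pr1 \<gamma>' = distr N borel (\<lambda>p. fst (fst p))"
    unfolding pr1_def \<gamma>'_def by (subst distr_distr) (auto simp: comp_def)
  also have "\<dots> = distr (distr N \<pi> fst) borel fst" by (subst distr_distr) (auto simp: comp_def)
  finally have pr: "pr1 \<gamma>' = \<mu>" unfolding d1 m .
  have "distr N borel snd = distr N \<gamma> snd" by (rule distr_cong) (auto simp: sG)
  then have g: "\<gamma> = distr N borel snd" using d2 by simp
  have "wasserstein sum_dist \<gamma> \<gamma>' \<le> (\<integral>p. sum_dist (snd p) (fst (fst p), snd (snd p)) \<partial>N)"
    unfolding g \<gamma>'_def by (rule Pm.Wd_le[OF N]) measurable
  also have "\<dots> = (\<integral>p. dist (fst (snd p)) (fst (fst p)) \<partial>N)" by (simp add: sum_dist_def)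
  also have "\<dots> \<le> (\<integral>p. dist (fst (fst p)) (snd (fst p)) + e/2 \<partial>N)"
  proof (rule integral_mono_AE)
    show "AE p in N. dist (fst (snd p)) (fst (fst p)) \<le> dist (fst (fst p)) (snd (fst p)) + e/2"
      using ae
    proof eventually_elim
      case (elim p)
      from cd[OF this] show ?case
        using dist_triangle[of "fst (fst p)" "fst (snd p)" "snd (fst p)"] by (simp add: dist_commute)
    qed
    show "integrable N (\<lambda>p. dist (fst (snd p)) (fst (fst p)))"
      by (rule Xm.rho_integrable[OF N.finite_measure_axioms]) measurable
    show "integrable N (\<lambda>p. dist (fst (fst p)) (snd (fst p)) + e/2)"
      by (intro Bochner_Integration.integrable_add Xm.rho_integrable[OF N.finite_measure_axioms]) auto
  qed
  also have "\<dots> = (\<integral>p. dist (fst (fst p)) (snd (fst p)) \<partial>N) + e/2"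
    by (subst Bochner_Integration.integral_add)
       (auto simp: N.prob_space intro!: Xm.rho_integrable[OF N.finite_measure_axioms])
  also have "(\<integral>p. dist (fst (fst p)) (snd (fst p)) \<partial>N) = (\<integral>p. dist (fst p) (snd p) \<partial>\<pi>)"
    by (subst d1[symmetric], subst integral_distr) auto
  also have "\<dots> + e/2 < wasserstein dist (pr1 \<gamma>) \<mu> + e" using cost by (simp add: Xm.Wd_commute)
  finally show ?thesis using P' pr by blast
qed

lemma fiber_nonempty:
  assumes P: "\<mu> \<in> Prob" shows "\<exists>\<gamma>\<in>Prob. pr1 \<gamma> = \<mu>"
proof -
  interpret M: prob_space \<mu> by (rule ProbD[OF P])
  have s[measurable_cong]: "sets \<mu> = sets borel" by (rule ProbD[OF P])
  have "distr \<mu> borel (\<lambda>x. (x, undefined :: 'a)) \<in> Prob"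
    by (rule Prob_distr[OF M.prob_space_axioms]) measurable
  moreover have "pr1 (distr \<mu> borel (\<lambda>x. (x, undefined :: 'a))) = distr \<mu> borel (\<lambda>x. x)"
    unfolding pr1_def by (subst distr_distr) (auto simp: comp_def)
  moreover have "\<dots> = \<mu>" by (rule distr_id2) (simp add: s)
  ultimately show ?thesis by metis
qed

end

lemma (in comp_metric) closedin_superlevel:
  assumes uc: "unif_cont \<rho> \<phi>"
  shows "closedin Wm.mtopology {\<mu>\<in>Prob. c \<le> \<phi> \<mu>}"
  unfolding closedin_def Wm.topspace_mtopology Wm.openin_mtopology
proof (intro conjI allI impI)
  fix \<mu> assume "\<mu> \<in> Prob - {\<mu>\<in>Prob. c \<le> \<phi> \<mu>}"
  then have \<mu>: "\<mu> \<in> Prob" "\<phi> \<mu> < c" by auto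
  then have "0 < c - \<phi> \<mu>" by simp
  from uc[unfolded unif_cont_def, rule_format, OF this] obtain \<delta> where \<delta>: "0 < \<delta>"
    "\<And>\<mu>' \<nu>. \<mu>' \<in> Prob \<Longrightarrow> \<nu> \<in> Prob \<Longrightarrow> Wd \<mu>' \<nu> < \<delta> \<Longrightarrow> \<bar>\<phi> \<mu>' - \<phi> \<nu>\<bar> < c - \<phi> \<mu>" by blast
  have "Wm.mball \<mu> \<delta> \<subseteq> Prob - {\<mu>\<in>Prob. c \<le> \<phi> \<mu>}"
  proof
    fix \<nu> assume "\<nu> \<in> Wm.mball \<mu> \<delta>"
    then have "\<nu> \<in> Prob" "\<bar>\<phi> \<mu> - \<phi> \<nu>\<bar> < c - \<phi> \<mu>" using \<delta>(2)[OF \<mu>(1)] by auto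
    then show "\<nu> \<in> Prob - {\<mu>\<in>Prob. c \<le> \<phi> \<mu>}" by auto
  qed
  with \<delta>(1) show "\<exists>r>0. Wm.mball \<mu> r \<subseteq> Prob - {\<mu>\<in>Prob. c \<le> \<phi> \<mu>}" by blast
qed auto

lemma unif_contI:
  assumes "\<And>e. 0 < e \<Longrightarrow> \<exists>\<delta>>0. \<forall>\<mu>\<in>Prob. \<forall>\<nu>\<in>Prob. wasserstein \<rho> \<mu> \<nu> < \<delta> \<longrightarrow> \<bar>\<phi> \<mu> - \<phi> \<nu>\<bar> < e"
  shows "unif_cont \<rho> \<phi>"
  using assms by (simp add: unif_cont_def)

lemma unif_contE:
  assumes "unif_cont \<rho> \<phi>" "0 < e"
  obtains \<delta> where "0 < \<delta>" "\<And>\<mu> \<nu>. \<mu> \<in> Prob \<Longrightarrow> \<nu> \<in> Prob \<Longrightarrow> wasserstein \<rho> \<mu> \<nu> < \<delta> \<Longrightarrow> \<bar>\<phi> \<mu> - \<phi> \<nu>\<bar> < e"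
  using assms(1)[unfolded unif_cont_def, rule_format, OF assms(2)] that by blast

lemma unif_cont_diff:
  assumes a: "unif_cont \<rho> \<phi>" and b: "unif_cont \<rho> \<psi>" shows "unif_cont \<rho> (\<lambda>\<mu>. \<phi> \<mu> - \<psi> \<mu>)"
proof (rule unif_contI)
  fix e :: real assume "0 < e"
  then have e: "0 < e/2" by simp
  obtain d1 where d1: "0 < d1" "\<And>\<mu> \<nu>. \<mu> \<in> Prob \<Longrightarrow> \<nu> \<in> Prob \<Longrightarrow> wasserstein \<rho> \<mu> \<nu> < d1 \<Longrightarrow> \<bar>\<phi> \<mu> - \<phi> \<nu>\<bar> < e/2"
    using unif_contE[OF a e] by metis
  obtain d2 where d2: "0 < d2" "\<And>\<mu> \<nu>. \<mu> \<in> Prob \<Longrightarrow> \<nu> \<in> Prob \<Longrightarrow> wasserstein \<rho> \<mu> \<nu> < d2 \<Longrightarrow> \<bar>\<psi> \<mu> - \<psi> \<nu>\<bar> < e/2"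
    using unif_contE[OF b e] by metis
  show "\<exists>\<delta>>0. \<forall>\<mu>\<in>Prob. \<forall>\<nu>\<in>Prob. wasserstein \<rho> \<mu> \<nu> < \<delta> \<longrightarrow> \<bar>\<phi> \<mu> - \<psi> \<mu> - (\<phi> \<nu> - \<psi> \<nu>)\<bar> < e"
  proof (intro exI[of _ "min d1 d2"] conjI ballI impI)
    fix \<mu> \<nu> :: "'a measure" assume "\<mu> \<in> Prob" "\<nu> \<in> Prob" "wasserstein \<rho> \<mu> \<nu> < min d1 d2"
    then have "\<bar>\<phi> \<mu> - \<phi> \<nu>\<bar> < e/2" "\<bar>\<psi> \<mu> - \<psi> \<nu>\<bar> < e/2" using d1(2)[of \<mu> \<nu>] d2(2)[of \<mu> \<nu>] by auto
    then show "\<bar>\<phi> \<mu> - \<psi> \<mu> - (\<phi> \<nu> - \<psi> \<nu>)\<bar> < e" by linarith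
  qed (use d1 d2 in auto)
qed

section \<open>Value iteration and optimal joint laws\<close>

context cmkv_mdp
begin

definition Cb :: real where
  "Cb = (SOME C. \<forall>x a. \<forall>\<mu>\<in>Prob. \<bar>reward S x a \<mu>\<bar> \<le> C)"

lemma reward_le_Cb: "\<mu> \<in> Prob \<Longrightarrow> \<bar>reward S x a \<mu>\<bar> \<le> Cb"
  using someI_ex[OF reward_bounded] unfolding Cb_def by blast

lemma Prob_ne: "\<exists>\<mu>. \<mu> \<in> (Prob :: 'y::topological_space measure set)"
proof -
  have "return borel (undefined :: 'y) \<in> Prob"
    by (auto simp: space_prob_algebra intro!: prob_space_return)
  then show ?thesis by blast
qed

lemma Cb_nonneg: "0 \<le> Cb"
proof -
  obtain \<mu> where "\<mu> \<in> (Prob :: ('x \<times> 'a) measure set)" using Prob_ne by blast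
  from reward_le_Cb[OF this, of undefined undefined] show ?thesis by linarith
qed

text \<open>The geometric bound for a discounted sum of rewards of size \<open>Cb\<close>. It solves
  \<open>Cb + disc S * Rb = Rb\<close>, so the lifted objective keeps functions within it.\<close>

definition Rb :: real where "Rb = Cb / (1 - disc S)"

lemma Rb_nonneg: "0 \<le> Rb" and Rb_eq: "Cb + disc S * Rb = Rb"
  using Cb_nonneg disc by (auto simp: Rb_def field_simps)

text \<open>The class in which the iteration lives: it contains 0 and is stable under
  \<open>T\<close> and under the uniform limit taken below.\<close>

definition good :: "('x measure \<Rightarrow> real) \<Rightarrow> bool" where
  "good w \<longleftrightarrow> unif_cont dist w \<and> (\<forall>\<mu>\<in>Prob. \<bar>w \<mu>\<bar> \<le> Rb)"

lemma goodD: "good w \<Longrightarrow> unif_cont dist w" "good w \<Longrightarrow> \<mu> \<in> Prob \<Longrightarrow> \<bar>w \<mu>\<bar> \<le> Rb"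
  "good w \<Longrightarrow> w \<in> borel_measurable (prob_algebra borel)"
  by (auto simp: good_def Xm.unif_cont_measurable)

lemma good_integrable: "good w \<Longrightarrow> \<gamma> \<in> Prob \<Longrightarrow> integrable claw (\<lambda>e0. w (Fhat \<gamma> e0))"
  using w_Fhat_integrable[OF goodD(3) goodD(2)] .

lemma fhat_bound: assumes P: "\<gamma> \<in> Prob" shows "\<bar>fhat \<gamma>\<bar> \<le> Cb"
proof -
  interpret G: prob_space \<gamma> by (rule ProbD[OF P])
  have i: "integrable \<gamma> (\<lambda>p. reward S (fst p) (snd p) \<gamma>)"
    using ProbD(2)[OF P] by (intro reward_integrable[OF P G.prob_space_axioms]) (auto simp: measurable_cong_sets[OF ProbD(2)[OF P] refl])
  have "\<bar>fhat \<gamma>\<bar> \<le> (\<integral>p. \<bar>reward S (fst p) (snd p) \<gamma>\<bar> \<partial>\<gamma>)" unfolding fhat_def by (rule integral_abs_bound)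
  also have "\<dots> \<le> (\<integral>p. Cb \<partial>\<gamma>)" using i reward_le_Cb[OF P] by (intro integral_mono) auto
  finally show ?thesis using G.prob_space by simp
qed

lemma J_bound: assumes w: "good w" and P: "\<gamma> \<in> Prob" shows "\<bar>J w \<gamma>\<bar> \<le> Rb"
proof -
  interpret cl: prob_space claw by (rule claw_prob)
  have "\<bar>\<integral>e0. w (Fhat \<gamma> e0) \<partial>claw\<bar> \<le> (\<integral>e0. \<bar>w (Fhat \<gamma> e0)\<bar> \<partial>claw)" by (rule integral_abs_bound)
  also have "\<dots> \<le> (\<integral>e0. Rb \<partial>claw)"
    using good_integrable[OF w P] goodD(2)[OF w] Fhat_Prob[OF P] by (intro integral_mono) auto
  finally have "\<bar>\<integral>e0. w (Fhat \<gamma> e0) \<partial>claw\<bar> \<le> Rb" using cl.prob_space by simp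
  then have "disc S * \<bar>\<integral>e0. w (Fhat \<gamma> e0) \<partial>claw\<bar> \<le> disc S * Rb" using disc by (intro mult_left_mono) auto
  then have "\<bar>disc S * (\<integral>e0. w (Fhat \<gamma> e0) \<partial>claw)\<bar> \<le> disc S * Rb" using disc by (simp add: abs_mult)
  with fhat_bound[OF P] Rb_eq show ?thesis unfolding J_def by linarith
qed

lemma J_diff:
  assumes w: "good w" "good w'" and d: "\<And>\<mu>. \<mu> \<in> Prob \<Longrightarrow> \<bar>w \<mu> - w' \<mu>\<bar> \<le> d" and P: "\<gamma> \<in> Prob"
  shows "\<bar>J w \<gamma> - J w' \<gamma>\<bar> \<le> disc S * d"
proof -
  interpret cl: prob_space claw by (rule claw_prob)
  note i = good_integrable[OF w(1) P] good_integrable[OF w(2) P]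
  have "\<bar>(\<integral>e0. w (Fhat \<gamma> e0) \<partial>claw) - (\<integral>e0. w' (Fhat \<gamma> e0) \<partial>claw)\<bar> = \<bar>\<integral>e0. w (Fhat \<gamma> e0) - w' (Fhat \<gamma> e0) \<partial>claw\<bar>" using i by simp
  also have "\<dots> \<le> (\<integral>e0. \<bar>w (Fhat \<gamma> e0) - w' (Fhat \<gamma> e0)\<bar> \<partial>claw)" by (rule integral_abs_bound)
  also have "\<dots> \<le> (\<integral>e0. d \<partial>claw)" using i d Fhat_Prob[OF P] by (intro integral_mono) auto
  finally have "\<bar>(\<integral>e0. w (Fhat \<gamma> e0) \<partial>claw) - (\<integral>e0. w' (Fhat \<gamma> e0) \<partial>claw)\<bar> \<le> d" using cl.prob_space by simp
  then have "disc S * \<bar>(\<integral>e0. w (Fhat \<gamma> e0) \<partial>claw) - (\<integral>e0. w' (Fhat \<gamma> e0) \<partial>claw)\<bar> \<le> disc S * d" using disc by (intro mult_left_mono) auto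
  moreover have "\<bar>J w \<gamma> - J w' \<gamma>\<bar> = disc S * \<bar>(\<integral>e0. w (Fhat \<gamma> e0) \<partial>claw) - (\<integral>e0. w' (Fhat \<gamma> e0) \<partial>claw)\<bar>"
    using disc by (simp add: J_def right_diff_distrib[symmetric] abs_mult)
  ultimately show ?thesis by simp
qed

lemma T_upper: assumes w: "good w" and P: "\<gamma> \<in> Prob" shows "J w \<gamma> \<le> T w (pr1 \<gamma>)"
  unfolding T_def
proof (rule cSUP_upper)
  show "bdd_above (J w ` {\<gamma>' \<in> Prob. pr1 \<gamma>' = pr1 \<gamma>})"
    by (rule bdd_aboveI2[of _ _ Rb]) (use J_bound[OF w] in \<open>auto simp: abs_le_iff\<close>)
qed (use P in auto)

lemma T_least: assumes "\<mu> \<in> Prob" "\<And>\<gamma>. \<gamma> \<in> Prob \<Longrightarrow> pr1 \<gamma> = \<mu> \<Longrightarrow> J w \<gamma> \<le> c" shows "T w \<mu> \<le> c"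
  unfolding T_def by (rule cSUP_least) (use fiber_nonempty[OF assms(1)] assms(2) in auto)

lemma T_diff:
  assumes w: "good w" "good w'" and d: "\<And>\<mu>. \<mu> \<in> Prob \<Longrightarrow> \<bar>w \<mu> - w' \<mu>\<bar> \<le> d" and P: "\<mu> \<in> Prob"
  shows "\<bar>T w \<mu> - T w' \<mu>\<bar> \<le> disc S * d"
proof -
  have "T w \<mu> \<le> T w' \<mu> + disc S * d"
  proof (rule T_least[OF P])
    fix \<gamma> assume g: "\<gamma> \<in> (Prob :: ('x \<times> 'a) measure set)" "pr1 \<gamma> = \<mu>"
    show "J w \<gamma> \<le> T w' \<mu> + disc S * d" using J_diff[OF w d g(1)] T_upper[OF w(2) g(1)] g(2) by simp
  qed
  moreover have "T w' \<mu> \<le> T w \<mu> + disc S * d"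
  proof (rule T_least[OF P])
    fix \<gamma> assume g: "\<gamma> \<in> (Prob :: ('x \<times> 'a) measure set)" "pr1 \<gamma> = \<mu>"
    show "J w' \<gamma> \<le> T w \<mu> + disc S * d" using J_diff[OF w d g(1)] T_upper[OF w(1) g(1)] g(2) by simp
  qed
  ultimately show ?thesis by linarith
qed

text \<open>The supremum runs over a fibre that moves with \<mu>. Each competitor over \<mu> is
  lifted by \<open>fiber_lift\<close> to one over a nearby \<nu>, so \<open>T w\<close> inherits the
  modulus of \<open>J w\<close>.\<close>

lemma T_good: assumes w: "good w" shows "good (T w)"
  unfolding good_def
proof (intro conjI ballI)
  have Juc: "unif_cont sum_dist (J w)" by (rule J_unif_cont[OF goodD(1)[OF w] goodD(2)[OF w]])
  show "unif_cont dist (T w)"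
  proof (rule unif_contI)
    fix e :: real assume "0 < e"
    then have "0 < e/2" by simp
    from unif_contE[OF Juc this] obtain \<delta> where \<delta>: "0 < \<delta>"
      "\<And>\<mu> \<nu>. \<mu> \<in> Prob \<Longrightarrow> \<nu> \<in> Prob \<Longrightarrow> wasserstein sum_dist \<mu> \<nu> < \<delta> \<Longrightarrow> \<bar>J w \<mu> - J w \<nu>\<bar> < e/2" by metis
    have le: "T w \<mu> \<le> T w \<nu> + e/2" if P: "\<mu> \<in> Prob" "\<nu> \<in> Prob" and l: "wasserstein dist \<mu> \<nu> < \<delta>" for \<mu> \<nu>
    proof (rule T_least[OF P(1)])
      fix \<gamma> assume g: "\<gamma> \<in> (Prob :: ('x \<times> 'a) measure set)" "pr1 \<gamma> = \<mu>"
      have "0 < \<delta> - wasserstein dist \<mu> \<nu>" using l by simp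
      from fiber_lift[OF g(1) P(2) this] obtain \<gamma>' where g': "\<gamma>' \<in> Prob" "pr1 \<gamma>' = \<nu>" "wasserstein sum_dist \<gamma> \<gamma>' < \<delta>"
        using g(2) by auto
      show "J w \<gamma> \<le> T w \<nu> + e/2" using \<delta>(2)[OF g(1) g'(1,3)] T_upper[OF w g'(1)] unfolding g'(2) by linarith
    qed
    show "\<exists>\<delta>>0. \<forall>\<mu>\<in>Prob. \<forall>\<nu>\<in>Prob. wasserstein dist \<mu> \<nu> < \<delta> \<longrightarrow> \<bar>T w \<mu> - T w \<nu>\<bar> < e"
    proof (intro exI[of _ \<delta>] conjI ballI impI)
      fix \<mu> \<nu> :: "'x measure" assume P: "\<mu> \<in> Prob" "\<nu> \<in> Prob" and l: "wasserstein dist \<mu> \<nu> < \<delta>"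
      have l': "wasserstein dist \<nu> \<mu> < \<delta>" using l Xm.Wd_commute[of \<mu> \<nu>] by simp
      show "\<bar>T w \<mu> - T w \<nu>\<bar> < e" using le[OF P l] le[OF P(2,1) l'] \<open>0 < e\<close> by linarith
    qed (rule \<delta>(1))
  qed
  fix \<mu> assume P: "\<mu> \<in> (Prob :: 'x measure set)"
  obtain \<gamma> where g: "\<gamma> \<in> Prob" "pr1 \<gamma> = \<mu>" using fiber_nonempty[OF P] by blast
  have "T w \<mu> \<le> Rb" by (rule T_least[OF P]) (use J_bound[OF w] in \<open>auto simp: abs_le_iff\<close>)
  moreover have "- Rb \<le> T w \<mu>" using T_upper[OF w g(1)] J_bound[OF w g(1)] unfolding g(2) by linarith
  ultimately show "\<bar>T w \<mu>\<bar> \<le> Rb" by simp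
qed

lemma good_zero: "good (\<lambda>_. 0)"
  unfolding good_def using Rb_nonneg by (auto simp: unif_cont_def intro: exI[of _ 1])

text \<open>Picard iteration from 0 with convergence controlled on \<open>Prob\<close> only,
  uniformly and at a geometric rate; off \<open>Prob\<close> the limit is arbitrary.\<close>

lemma bellman_fixpoint:
  obtains W where "good W" "\<And>\<mu>. \<mu> \<in> Prob \<Longrightarrow> T W \<mu> = W \<mu>"
proof -
  define v where "v n = (T ^^ n) (\<lambda>_. 0)" for n
  have vS: "v (Suc n) = T (v n)" for n by (simp add: v_def)
  have gv: "good (v n)" for n
    by (induction n) (auto simp: vS T_good, simp add: v_def good_zero)
  have b0: "0 \<le> disc S" "disc S < 1" using disc by auto
  \<comment> \<open>The constant \<open>2 * Rb\<close> bounds the distance of any two members of the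
    class, and each application of \<open>T\<close> gains a factor \<open>disc S\<close>.\<close>
  have diff: "\<bar>v (n + k) \<mu> - v n \<mu>\<bar> \<le> disc S ^ n * (2 * Rb)" if P: "\<mu> \<in> Prob" for n k \<mu>
    using P
  proof (induction n arbitrary: \<mu>)
    case 0
    then show ?case using goodD(2)[OF gv 0, of k] goodD(2)[OF gv 0, of 0] by simp
  next
    case (Suc n)
    have "\<bar>T (v (n + k)) \<mu> - T (v n) \<mu>\<bar> \<le> disc S * (disc S ^ n * (2 * Rb))"
      by (rule T_diff[OF gv gv Suc.IH Suc.prems])
    then show ?case by (simp add: vS mult_ac)
  qed
  have lim0: "(\<lambda>n. disc S ^ n * (2 * Rb)) \<longlonglongrightarrow> 0"
    using tendsto_mult[OF LIMSEQ_power_zero[of "disc S"] tendsto_const[of "2 * Rb"]] b0 by simp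
  have conv: "convergent (\<lambda>n. v n \<mu>)" if P: "\<mu> \<in> Prob" for \<mu>
  proof -
    have "Cauchy (\<lambda>n. v n \<mu>)"
      unfolding Cauchy_altdef2
    proof (intro allI impI)
      fix e :: real assume "0 < e"
      with lim0 have "\<forall>\<^sub>F n in sequentially. disc S ^ n * (2 * Rb) < e" by (rule order_tendstoD)
      then obtain N where N: "disc S ^ N * (2 * Rb) < e" by (meson eventually_happens' sequentially_bot)
      show "\<exists>N. \<forall>n\<ge>N. dist (v n \<mu>) (v N \<mu>) < e"
      proof (intro exI[of _ N] allI impI)
        fix n assume "N \<le> n"
        then show "dist (v n \<mu>) (v N \<mu>) < e" using diff[OF P, of N "n - N"] N by (simp add: dist_real_def)
      qed
    qed
    then show ?thesis by (simp add: Cauchy_convergent_iff)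
  qed
  define W where "W \<mu> = lim (\<lambda>n. v n \<mu>)" for \<mu>
  have limW: "(\<lambda>n. v n \<mu>) \<longlonglongrightarrow> W \<mu>" if P: "\<mu> \<in> Prob" for \<mu>
    using conv[OF P] unfolding W_def convergent_LIMSEQ_iff .
  have close: "\<bar>W \<mu> - v n \<mu>\<bar> \<le> disc S ^ n * (2 * Rb)" if P: "\<mu> \<in> Prob" for \<mu> n
  proof -
    have "(\<lambda>k. v (n + k) \<mu>) \<longlonglongrightarrow> W \<mu>" using LIMSEQ_ignore_initial_segment[OF limW[OF P], of n] by (simp add: add.commute)
    then have "(\<lambda>k. \<bar>v (n + k) \<mu> - v n \<mu>\<bar>) \<longlonglongrightarrow> \<bar>W \<mu> - v n \<mu>\<bar>" by (intro tendsto_intros)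
    then show ?thesis by (rule LIMSEQ_le_const2) (use diff[OF P] in blast)
  qed
  have gW: "good W"
    unfolding good_def
  proof (intro conjI ballI)
    show "unif_cont dist W"
    proof (rule unif_contI)
      fix e :: real assume "0 < e"
      then have e3: "0 < e/3" by simp
      with lim0 have "\<forall>\<^sub>F n in sequentially. disc S ^ n * (2 * Rb) < e/3" by (rule order_tendstoD)
      then obtain N where N: "disc S ^ N * (2 * Rb) < e/3" by (meson eventually_happens' sequentially_bot)
      from unif_contE[OF goodD(1)[OF gv] e3] obtain \<delta> where \<delta>: "0 < \<delta>"
        "\<And>\<mu> \<nu>. \<mu> \<in> Prob \<Longrightarrow> \<nu> \<in> Prob \<Longrightarrow> wasserstein dist \<mu> \<nu> < \<delta> \<Longrightarrow> \<bar>v N \<mu> - v N \<nu>\<bar> < e/3" by metis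
      show "\<exists>\<delta>>0. \<forall>\<mu>\<in>Prob. \<forall>\<nu>\<in>Prob. wasserstein dist \<mu> \<nu> < \<delta> \<longrightarrow> \<bar>W \<mu> - W \<nu>\<bar> < e"
      proof (intro exI[of _ \<delta>] conjI ballI impI)
        fix \<mu> \<nu> :: "'x measure" assume P: "\<mu> \<in> Prob" "\<nu> \<in> Prob" and l: "wasserstein dist \<mu> \<nu> < \<delta>"
        show "\<bar>W \<mu> - W \<nu>\<bar> < e" using \<delta>(2)[OF P l] close[OF P(1), of N] close[OF P(2), of N] N by linarith
      qed (rule \<delta>(1))
    qed
    fix \<mu> assume P: "\<mu> \<in> (Prob :: 'x measure set)"
    have "(\<lambda>n. \<bar>v n \<mu>\<bar>) \<longlonglongrightarrow> \<bar>W \<mu>\<bar>" using limW[OF P] by (rule tendsto_rabs)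
    then show "\<bar>W \<mu>\<bar> \<le> Rb" by (rule LIMSEQ_le_const2) (use goodD(2)[OF gv P] in blast)
  qed
  have "T W \<mu> = W \<mu>" if P: "\<mu> \<in> Prob" for \<mu>
  proof -
    have "\<bar>T W \<mu> - W \<mu>\<bar> \<le> 2 * (disc S ^ n * (2 * Rb))" for n
    proof -
      have "\<bar>T W \<mu> - T (v n) \<mu>\<bar> \<le> disc S * (disc S ^ n * (2 * Rb))" by (rule T_diff[OF gW gv close P])
      also have "\<dots> \<le> 1 * (disc S ^ n * (2 * Rb))" using b0 Rb_nonneg by (intro mult_right_mono) auto
      finally have 1: "\<bar>T W \<mu> - v (Suc n) \<mu>\<bar> \<le> disc S ^ n * (2 * Rb)" by (simp add: vS)
      have "\<bar>W \<mu> - v (Suc n) \<mu>\<bar> \<le> disc S ^ Suc n * (2 * Rb)" by (rule close[OF P])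
      also have "\<dots> \<le> disc S ^ n * (2 * Rb)" using b0 Rb_nonneg by (intro mult_right_mono power_decreasing) auto
      finally show ?thesis using 1 by linarith
    qed
    moreover have "(\<lambda>n. 2 * (disc S ^ n * (2 * Rb))) \<longlonglongrightarrow> 2 * 0" by (intro tendsto_mult tendsto_const lim0)
    ultimately have "\<bar>T W \<mu> - W \<mu>\<bar> \<le> 2 * 0" by (intro LIMSEQ_le_const[where X = "\<lambda>n. 2 * (disc S ^ n * (2 * Rb))"]) auto
    then show ?thesis by simp
  qed
  with gW show ?thesis by (rule that)
qed

lemma pr1_nonexpansive:
  assumes P: "\<gamma> \<in> Prob" "\<gamma>' \<in> Prob"
  shows "wasserstein dist (pr1 \<gamma>) (pr1 \<gamma>') \<le> wasserstein sum_dist \<gamma> \<gamma>'"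
proof (rule field_le_epsilon)
  fix e :: real assume "0 < e"
  from Pm.Wd_coupling[OF P this] obtain \<pi> where \<pi>: "prob_space \<pi>" and [measurable_cong]: "sets \<pi> = sets (borel \<Otimes>\<^sub>M borel)"
    and m: "distr \<pi> borel fst = \<gamma>" "distr \<pi> borel snd = \<gamma>'"
    and cost: "(\<integral>p. sum_dist (fst p) (snd p) \<partial>\<pi>) < wasserstein sum_dist \<gamma> \<gamma>' + e" .
  interpret \<pi>: prob_space \<pi> by fact
  have "pr1 \<gamma> = distr \<pi> borel (\<lambda>p. fst (fst p))" "pr1 \<gamma>' = distr \<pi> borel (\<lambda>p. fst (snd p))"
    unfolding pr1_def m[symmetric] by (auto simp: distr_distr comp_def)
  then have "wasserstein dist (pr1 \<gamma>) (pr1 \<gamma>') \<le> (\<integral>p. dist (fst (fst p)) (fst (snd p)) \<partial>\<pi>)"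
    using Xm.Wd_le[OF \<pi>, of "\<lambda>p. fst (fst p)" "\<lambda>p. fst (snd p)"] by simp
  also have "\<dots> \<le> (\<integral>p. sum_dist (fst p) (snd p) \<partial>\<pi>)"
    by (intro integral_mono Xm.rho_integrable Pm.rho_integrable \<pi>.finite_measure_axioms) (auto simp: sum_dist_def)
  finally show "wasserstein dist (pr1 \<gamma>) (pr1 \<gamma>') \<le> wasserstein sum_dist \<gamma> \<gamma>' + e" using cost by simp
qed

lemma unif_cont_pr1: assumes w: "unif_cont dist w" shows "unif_cont sum_dist (\<lambda>\<gamma>. w (pr1 \<gamma>))"
proof (rule unif_contI)
  fix e :: real assume "0 < e"
  from unif_contE[OF w this] obtain \<delta> where \<delta>: "0 < \<delta>"
    "\<And>\<mu> \<nu>. \<mu> \<in> Prob \<Longrightarrow> \<nu> \<in> Prob \<Longrightarrow> wasserstein dist \<mu> \<nu> < \<delta> \<Longrightarrow> \<bar>w \<mu> - w \<nu>\<bar> < e" by metis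
  show "\<exists>\<delta>>0. \<forall>\<gamma>\<in>Prob. \<forall>\<gamma>'\<in>Prob. wasserstein sum_dist \<gamma> \<gamma>' < \<delta> \<longrightarrow> \<bar>w (pr1 \<gamma>) - w (pr1 \<gamma>')\<bar> < e"
  proof (intro exI[of _ \<delta>] conjI ballI impI)
    fix \<gamma> \<gamma>' :: "('x \<times> 'a) measure" assume P: "\<gamma> \<in> Prob" "\<gamma>' \<in> Prob" and l: "wasserstein sum_dist \<gamma> \<gamma>' < \<delta>"
    show "\<bar>w (pr1 \<gamma>) - w (pr1 \<gamma>')\<bar> < e" using \<delta>(2)[OF pr1_Prob[OF P(1)] pr1_Prob[OF P(2)]] pr1_nonexpansive[OF P] l by linarith
  qed (rule \<delta>(1))
qed

lemma unif_cont_neg_dist: assumes P: "\<mu> \<in> Prob" shows "unif_cont dist (\<lambda>\<nu>. - wasserstein dist \<nu> (\<mu> :: 'x measure))"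
proof (rule unif_contI)
  fix e :: real assume "0 < e"
  show "\<exists>\<delta>>0. \<forall>\<nu>\<in>Prob. \<forall>\<nu>'\<in>Prob. wasserstein dist \<nu> \<nu>' < \<delta> \<longrightarrow> \<bar>- wasserstein dist \<nu> \<mu> - - wasserstein dist \<nu>' \<mu>\<bar> < e"
  proof (intro exI[of _ e] conjI ballI impI)
    fix \<nu> \<nu>' :: "'x measure" assume Q: "\<nu> \<in> Prob" "\<nu>' \<in> Prob" and l: "wasserstein dist \<nu> \<nu>' < e"
    show "\<bar>- wasserstein dist \<nu> \<mu> - - wasserstein dist \<nu>' \<mu>\<bar> < e"
      using Xm.Wd_triangle[OF Q P] Xm.Wd_triangle[OF Q(2,1) P] Xm.Wd_commute[of \<nu> \<nu>'] l by linarith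
  qed fact
qed

text \<open>The fibre is where the nonnegative continuous function
  \<open>wasserstein dist (pr1 \<gamma>) \<mu>\<close> is at most 0.\<close>

lemma closedin_fiber: assumes P: "\<mu> \<in> Prob" shows "closedin Pm.Wm.mtopology {\<gamma> \<in> Prob. pr1 \<gamma> = \<mu>}"
proof -
  have "{\<gamma> \<in> Prob. pr1 \<gamma> = \<mu>} = {\<gamma> \<in> Prob. 0 \<le> - wasserstein dist (pr1 \<gamma>) \<mu>}"
  proof (intro Collect_cong conj_cong refl)
    fix \<gamma> assume "\<gamma> \<in> (Prob :: ('x \<times> 'a) measure set)"
    then show "(pr1 \<gamma> = \<mu>) = (0 \<le> - wasserstein dist (pr1 \<gamma>) \<mu>)"
      using Xm.Wm.zero[OF pr1_Prob P, of \<gamma>] Xm.Wd_nonneg[of "pr1 \<gamma>" \<mu>] by linarith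
  qed
  then show ?thesis using Pm.closedin_superlevel[OF unif_cont_pr1[OF unif_cont_neg_dist[OF P]], of 0] by simp
qed

text \<open>A continuous image of a compact set is compact, hence closed in a Hausdorff space. This
  supplies the measurability condition of the selection lemma.\<close>

lemma closedin_pr1_image:
  assumes C: "closedin Pm.Wm.mtopology C" shows "closedin Xm.Wm.mtopology (pr1 ` C)"
proof -
  have "continuous_map Pm.Wm.mtopology Xm.Wm.mtopology pr1"
    unfolding continuous_map_def Pm.Wm.topspace_mtopology Xm.Wm.topspace_mtopology
  proof (intro conjI allI impI)
    show "pr1 \<in> Prob \<rightarrow> Prob" using pr1_Prob by auto
    fix U assume U: "openin Xm.Wm.mtopology U"
    show "openin Pm.Wm.mtopology {\<gamma> \<in> Prob. pr1 \<gamma> \<in> U}"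
      unfolding Pm.Wm.openin_mtopology
    proof (intro conjI allI impI)
      fix \<gamma> assume g: "\<gamma> \<in> {\<gamma> \<in> Prob. pr1 \<gamma> \<in> U}"
      then obtain r where r: "0 < r" "Xm.Wm.mball (pr1 \<gamma>) r \<subseteq> U" using U Xm.Wm.openin_mtopology by auto
      have "Pm.Wm.mball \<gamma> r \<subseteq> {\<gamma> \<in> Prob. pr1 \<gamma> \<in> U}"
      proof
        fix \<gamma>' assume g': "\<gamma>' \<in> Pm.Wm.mball \<gamma> r"
        then have "\<gamma>' \<in> Prob" "pr1 \<gamma>' \<in> Xm.Wm.mball (pr1 \<gamma>) r"
          using pr1_nonexpansive[of \<gamma> \<gamma>'] g pr1_Prob by auto
        then show "\<gamma>' \<in> {\<gamma> \<in> Prob. pr1 \<gamma> \<in> U}" using r by auto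
      qed
      with r show "\<exists>r>0. Pm.Wm.mball \<gamma> r \<subseteq> {\<gamma> \<in> Prob. pr1 \<gamma> \<in> U}" by blast
    qed auto
  qed
  moreover have "compactin Pm.Wm.mtopology C" by (rule closedin_compact_space[OF Pm.compact_Prob C])
  ultimately have "compactin Xm.Wm.mtopology (pr1 ` C)" by (rule image_compactin[rotated])
  then show ?thesis by (rule compactin_imp_closedin[OF Xm.Wm.Hausdorff_space_mtopology])
qed

text \<open>The joint laws over \<mu> that are within \<open>inverse (Suc n)\<close> of the supremum
  form decreasing nonempty closed sets in a compact space; a common point is a maximizer.\<close>

lemma T_attained:
  assumes w: "good w" and P: "\<mu> \<in> Prob"
  shows "\<exists>\<gamma>\<in>Prob. pr1 \<gamma> = \<mu> \<and> J w \<gamma> = T w \<mu>"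
proof -
  have Juc: "unif_cont sum_dist (J w)" by (rule J_unif_cont[OF goodD(1)[OF w] goodD(2)[OF w]])
  define C where "C n = {\<gamma> \<in> Prob. pr1 \<gamma> = \<mu>} \<inter> {\<gamma> \<in> Prob. T w \<mu> - inverse (Suc n) \<le> J w \<gamma>}" for n
  have "closedin Pm.Wm.mtopology (C n)" for n
    unfolding C_def by (intro closedin_Int closedin_fiber[OF P] Pm.closedin_superlevel[OF Juc])
  moreover have "C n \<noteq> {}" for n
  proof
    assume e: "C n = {}"
    have "T w \<mu> \<le> T w \<mu> - inverse (Suc n)"
      by (rule T_least[OF P]) (use e in \<open>force simp: C_def\<close>)
    then show False by simp
  qed
  moreover have "decseq C"
  proof (rule decseq_SucI)
    fix n
    have "inverse (real (Suc (Suc n))) \<le> inverse (real (Suc n))" by (intro le_imp_inverse_le) auto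
    then show "C (Suc n) \<subseteq> C n" unfolding C_def by (smt (verit, best) Int_iff mem_Collect_eq subsetI)
  qed
  ultimately have "\<Inter>(range C) \<noteq> {}"
    using Pm.Wm.compact_space_nest[THEN iffD1, OF Pm.compact_Prob, THEN spec, THEN mp, of C] by blast
  then obtain \<gamma> where g: "\<And>n. \<gamma> \<in> C n" by auto
  then have g': "\<gamma> \<in> Prob" "pr1 \<gamma> = \<mu>" by (auto simp: C_def)
  have "T w \<mu> \<le> J w \<gamma>"
  proof (rule LIMSEQ_le_const2)
    show "(\<lambda>n. T w \<mu> - inverse (real (Suc n))) \<longlonglongrightarrow> T w \<mu>"
      using tendsto_diff[OF tendsto_const LIMSEQ_inverse_real_of_nat, of "T w \<mu>"] by simp
    show "\<exists>N. \<forall>n\<ge>N. T w \<mu> - inverse (real (Suc n)) \<le> J w \<gamma>" using g by (auto simp: C_def)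
  qed
  then show ?thesis using g' T_upper[OF w g'(1)] by (intro bexI[of _ \<gamma>]) auto
qed

lemma optimal_randomization:
  obtains W \<aa> where "good W" "\<And>\<gamma>. \<gamma> \<in> Prob \<Longrightarrow> J W \<gamma> \<le> W (pr1 \<gamma>)"
    "\<aa> \<in> wass_borel dist \<Otimes>\<^sub>M borel \<Otimes>\<^sub>M unif \<rightarrow>\<^sub>M borel"
    "\<And>\<mu>. \<mu> \<in> Prob \<Longrightarrow> J W (distr (\<mu> \<Otimes>\<^sub>M unif) borel (\<lambda>(x, u). (x, \<aa> (\<mu>, x, u)))) = W \<mu>"
proof -
  obtain W where gW: "good W" and fix_W: "\<And>\<mu>. \<mu> \<in> Prob \<Longrightarrow> T W \<mu> = W \<mu>" using bellman_fixpoint by blast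
  have le: "J W \<gamma> \<le> W (pr1 \<gamma>)" if "\<gamma> \<in> Prob" for \<gamma> using T_upper[OF gW that] fix_W[OF pr1_Prob[OF that]] by simp
  have Juc: "unif_cont sum_dist (J W)" by (rule J_unif_cont[OF goodD(1)[OF gW] goodD(2)[OF gW]])
  \<comment> \<open>The optimal joint laws, over all state laws together. Since \<open>J W\<close>
    never exceeds \<open>W \<circ> pr1\<close>, the inequality means equality, and it makes
    \<open>G\<close> visibly closed.\<close>
  define G where "G = {\<gamma> \<in> Prob. 0 \<le> J W \<gamma> - W (pr1 \<gamma>)}"
  have G: "closedin Pm.Wm.mtopology G"
    unfolding G_def by (rule Pm.closedin_superlevel[OF unif_cont_diff[OF Juc unif_cont_pr1[OF goodD(1)[OF gW]]]])
  have sp: "space (wass_borel (dist :: 'x \<Rightarrow> 'x \<Rightarrow> real)) = Prob" by simp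
  obtain s where s: "s \<in> wass_borel (dist :: 'x \<Rightarrow> 'x \<Rightarrow> real) \<rightarrow>\<^sub>M sigma Prob {B. openin Pm.Wm.mtopology B}"
    and sG: "\<And>\<mu>. \<mu> \<in> space (wass_borel dist) \<Longrightarrow> s \<mu> \<in> G \<and> pr1 (s \<mu>) = \<mu>"
  proof (rule Pm.Wm.measurable_selection[OF Pm.compact_Prob G, of pr1 "wass_borel dist"])
    fix C assume C: "closedin Pm.Wm.mtopology C"
    show "pr1 ` C \<inter> space (wass_borel dist) \<in> sets (wass_borel dist)"
      by (intro sets.Int Xm.closedin_wass_borel[OF closedin_pr1_image[OF C]] sets.top)
  next
    fix \<mu> assume "\<mu> \<in> space (wass_borel (dist :: 'x \<Rightarrow> 'x \<Rightarrow> real))"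
    then have P: "\<mu> \<in> Prob" by simp
    have "{\<gamma> \<in> G. pr1 \<gamma> = \<mu>} = G \<inter> {\<gamma> \<in> Prob. pr1 \<gamma> = \<mu>}" by (auto simp: G_def)
    then show "closedin Pm.Wm.mtopology {\<gamma> \<in> G. pr1 \<gamma> = \<mu>}" using closedin_Int[OF G closedin_fiber[OF P]] by simp
    show "\<exists>\<gamma>\<in>G. pr1 \<gamma> = \<mu>" using T_attained[OF gW P] fix_W[OF P] by (force simp: G_def)
  qed blast
  have "s \<in> wass_borel (dist :: 'x \<Rightarrow> 'x \<Rightarrow> real) \<rightarrow>\<^sub>M wass_borel sum_dist" using s unfolding wass_borel_def[of sum_dist] .
  from measurable_compose[OF this Pm.wass_borel_to_prob_algebra]
  have s': "s \<in> wass_borel (dist :: 'x \<Rightarrow> 'x \<Rightarrow> real) \<rightarrow>\<^sub>M prob_algebra borel" by simp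
  obtain \<aa> where a: "\<aa> \<in> wass_borel (dist :: 'x \<Rightarrow> 'x \<Rightarrow> real) \<Otimes>\<^sub>M borel \<Otimes>\<^sub>M unif \<rightarrow>\<^sub>M (borel :: 'a measure)"
    and law: "\<And>\<mu>. \<mu> \<in> space (wass_borel (dist :: 'x \<Rightarrow> 'x \<Rightarrow> real)) \<Longrightarrow>
      distr (distr (s \<mu>) borel fst \<Otimes>\<^sub>M unif) borel (\<lambda>(x, u). (x, \<aa> (\<mu>, x, u))) = s \<mu>"
    using measurable_randomization[OF compact_state compact_action s'] by blast
  show ?thesis
  proof (rule that[OF gW le a])
    fix \<mu> assume P: "\<mu> \<in> (Prob :: 'x measure set)"
    have "distr (s \<mu>) borel fst = \<mu>" "s \<mu> \<in> G" using sG[of \<mu>] P by (auto simp: pr1_def)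
    with law[of \<mu>] P le[of "s \<mu>"]
    show "J W (distr (\<mu> \<Otimes>\<^sub>M unif) borel (\<lambda>(x, u). (x, \<aa> (\<mu>, x, u)))) = W \<mu>"
      by (auto simp: G_def pr1_def)
  qed
qed

end

section \<open>Conditional laws under independence\<close>

definition sig_join :: "'w set \<Rightarrow> 'w measure \<Rightarrow> 'w measure \<Rightarrow> 'w measure" where
  "sig_join \<Omega> A B = sigma \<Omega> (sets A \<union> sets B)"

context prob_space
begin

definition ind :: "'a measure \<Rightarrow> 'a measure \<Rightarrow> bool" where
  "ind A B \<longleftrightarrow> subalgebra M A \<and> subalgebra M B \<and> (\<forall>a\<in>sets A. \<forall>b\<in>sets B. prob (a \<inter> b) = prob a * prob b)"

lemma indD:
  assumes "ind A B"
  shows "subalgebra M A" "subalgebra M B" "space A = space M" "space B = space M"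
    "\<And>a b. a \<in> sets A \<Longrightarrow> b \<in> sets B \<Longrightarrow> prob (a \<inter> b) = prob a * prob b"
    "(\<lambda>\<omega>. \<omega>) \<in> M \<rightarrow>\<^sub>M A" "(\<lambda>\<omega>. \<omega>) \<in> M \<rightarrow>\<^sub>M B"
proof -
  show s: "subalgebra M A" "subalgebra M B" using assms by (auto simp: ind_def)
  show "space A = space M" "space B = space M" using s by (auto simp: subalgebra_def)
  show "prob (a \<inter> b) = prob a * prob b" if "a \<in> sets A" "b \<in> sets B" for a b
    using assms that by (auto simp: ind_def)
  show "(\<lambda>\<omega>. \<omega>) \<in> M \<rightarrow>\<^sub>M A" "(\<lambda>\<omega>. \<omega>) \<in> M \<rightarrow>\<^sub>M B"
    by (rule measurable_from_subalg[OF s(1)], simp, rule measurable_from_subalg[OF s(2)], simp)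
qed

lemma ind_mono: "ind A B \<Longrightarrow> subalgebra A A' \<Longrightarrow> subalgebra B B' \<Longrightarrow> ind A' B'"
  unfolding ind_def subalgebra_def by (metis subsetD order_trans)

lemma indI_indep_set:
  "indep_set (sets A) (sets B) \<Longrightarrow> space A = space M \<Longrightarrow> space B = space M \<Longrightarrow> ind A B"
  unfolding ind_def indep_sets2_eq subalgebra_def by blast

lemma sig_join_Pow:
  assumes "subalgebra M A" "subalgebra M B" shows "sets A \<union> sets B \<subseteq> Pow (space M)"
  using assms sets.space_closed[of A] sets.space_closed[of B] by (simp add: subalgebra_def)

lemma space_sig_join[simp]: "subalgebra M A \<Longrightarrow> subalgebra M B \<Longrightarrow> space (sig_join (space M) A B) = space M"
  unfolding sig_join_def by (rule space_measure_of[OF sig_join_Pow])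

lemma sets_sig_join: "subalgebra M A \<Longrightarrow> subalgebra M B \<Longrightarrow> sets (sig_join (space M) A B) = sigma_sets (space M) (sets A \<union> sets B)"
  unfolding sig_join_def by (rule sets_measure_of[OF sig_join_Pow])

text \<open>Independence of \<open>A\<close> from \<open>D\<close> is used twice, for
  \<open>b \<inter> c\<close> and for \<open>b\<close>; the intersections
  \<open>a \<inter> b\<close> form an intersection-stable generator of the join.\<close>

lemma ind_join:
  assumes BC: "ind B C" and AD: "ind A D" and BD: "sets B \<subseteq> sets D" and CD: "sets C \<subseteq> sets D"
  shows "ind (sig_join (space M) A B) C"
proof -
  note sA = indD(1)[OF AD] and sB = indD(1)[OF BC] and sC = indD(2)[OF BC]
  have sp: "space A = space M" "space B = space M" "space C = space M" using sA sB sC by (auto simp: subalgebra_def)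
  define E where "E = {a \<inter> b |a b. a \<in> sets A \<and> b \<in> sets B}"
  have ev: "sets A \<subseteq> events" "sets B \<subseteq> events" "sets C \<subseteq> events" using sA sB sC by (auto simp: subalgebra_def)
  have "indep_set E (sets C)"
    unfolding indep_sets2_eq
  proof (intro conjI ballI)
    show "E \<subseteq> events" using ev by (auto simp: E_def)
    fix x c assume "x \<in> E" and c: "c \<in> sets C"
    then obtain a b where x: "x = a \<inter> b" "a \<in> sets A" "b \<in> sets B" by (auto simp: E_def)
    have "prob (x \<inter> c) = prob (a \<inter> (b \<inter> c))" by (simp add: x Int_assoc)
    also have "\<dots> = prob a * prob (b \<inter> c)" using BD CD x c by (intro indD(5)[OF AD]) auto
    also have "\<dots> = prob a * prob b * prob c" using indD(5)[OF BC x(3) c] by simp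
    also have "prob a * prob b = prob x" using indD(5)[OF AD x(2), of b] BD x by auto
    finally show "prob (x \<inter> c) = prob x * prob c" .
  qed (rule ev)
  moreover have "Int_stable E"
  proof (rule Int_stableI)
    fix x y assume "x \<in> E" "y \<in> E"
    then obtain a b a' b' where "x = a \<inter> b" "a \<in> sets A" "b \<in> sets B" "y = a' \<inter> b'" "a' \<in> sets A" "b' \<in> sets B"
      by (auto simp: E_def)
    then show "x \<inter> y \<in> E" unfolding E_def by (intro CollectI exI[of _ "a \<inter> a'"] exI[of _ "b \<inter> b'"]) auto
  qed
  moreover have "Int_stable (sets C)" by (auto simp: Int_stable_def)
  ultimately have i: "indep_set (sigma_sets (space M) E) (sigma_sets (space M) (sets C))" by (rule indep_set_sigma_sets)
  have AB: "sets A \<union> sets B \<subseteq> E"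
  proof
    fix x assume "x \<in> sets A \<union> sets B"
    then show "x \<in> E"
    proof
      assume x: "x \<in> sets A"
      have "x = x \<inter> space M" "space M \<in> sets B" using sets.sets_into_space[OF x] sp sets.top[of B] by auto
      with x show ?thesis unfolding E_def by blast
    next
      assume x: "x \<in> sets B"
      have "x = space M \<inter> x" "space M \<in> sets A" using sets.sets_into_space[OF x] sp sets.top[of A] by auto
      with x show ?thesis unfolding E_def by blast
    qed
  qed
  show ?thesis
  proof (rule indI_indep_set)
    have "sigma_sets (space M) (sets C) = sets C" using sets.sigma_sets_eq[of C] by (simp add: sp)
    with i have "indep_set (sigma_sets (space M) E) (sets C)" by simp
    then show "indep_set (sets (sig_join (space M) A B)) (sets C)"
      unfolding sets_sig_join[OF sA sB] indep_sets2_eq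
      using sigma_sets_mono'[OF AB, of "space M"] by blast
  qed (use sA sB sp in auto)
qed

text \<open>The preimage of a rectangle under the diagonal is the intersection of its sides, so
  independence says that the diagonal map has the product law. This is what allows one argument to
  be frozen while the other is averaged.\<close>

lemma ind_diag:
  assumes i: "ind A B"
  shows "distr M (A \<Otimes>\<^sub>M B) (\<lambda>\<omega>. (\<omega>, \<omega>)) = distr M A (\<lambda>\<omega>. \<omega>) \<Otimes>\<^sub>M distr M B (\<lambda>\<omega>. \<omega>)"
proof (rule pair_measure_eqI[symmetric])
  note [measurable] = indD(6,7)[OF i]
  show "sigma_finite_measure (distr M A (\<lambda>\<omega>. \<omega>))" "sigma_finite_measure (distr M B (\<lambda>\<omega>. \<omega>))"
    by (rule prob_space_imp_sigma_finite, rule prob_space_distr, measurable)+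
  show "sets (distr M A (\<lambda>\<omega>. \<omega>) \<Otimes>\<^sub>M distr M B (\<lambda>\<omega>. \<omega>)) = sets (distr M (A \<Otimes>\<^sub>M B) (\<lambda>\<omega>. (\<omega>, \<omega>)))"
    by (simp cong: sets_pair_measure_cong)
  fix a b assume "a \<in> sets (distr M A (\<lambda>\<omega>. \<omega>))" "b \<in> sets (distr M B (\<lambda>\<omega>. \<omega>))"
  then have [measurable]: "a \<in> sets A" "b \<in> sets B" by auto
  have s: "a \<inter> space M = a" "b \<inter> space M = b" "a \<inter> b \<inter> space M = a \<inter> b"
    using indD(3,4)[OF i] sets.sets_into_space[of a A] sets.sets_into_space[of b B] by auto
  have "(\<lambda>\<omega>. (\<omega>, \<omega>)) -` (a \<times> b) \<inter> space M = a \<inter> b" using s by auto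
  then have "emeasure (distr M (A \<Otimes>\<^sub>M B) (\<lambda>\<omega>. (\<omega>, \<omega>))) (a \<times> b) = ennreal (prob (a \<inter> b))"
    by (subst emeasure_distr) (auto simp: emeasure_eq_measure)
  also have "\<dots> = ennreal (prob a) * ennreal (prob b)" by (simp add: indD(5)[OF i] ennreal_mult)
  also have "\<dots> = emeasure (distr M A (\<lambda>\<omega>. \<omega>)) a * emeasure (distr M B (\<lambda>\<omega>. \<omega>)) b"
    by (simp add: emeasure_distr s emeasure_eq_measure)
  finally show "emeasure (distr M A (\<lambda>\<omega>. \<omega>)) a * emeasure (distr M B (\<lambda>\<omega>. \<omega>)) b = emeasure (distr M (A \<Otimes>\<^sub>M B) (\<lambda>\<omega>. (\<omega>, \<omega>))) (a \<times> b)" ..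
qed

lemma ind_diag_measurable: "ind A B \<Longrightarrow> (\<lambda>\<omega>. (\<omega>, \<omega>)) \<in> M \<rightarrow>\<^sub>M A \<Otimes>\<^sub>M B"
  using indD(6,7) by (intro measurable_Pair)

lemma ind_section_measurable:
  assumes i: "ind A B" and g: "g \<in> A \<Otimes>\<^sub>M B \<rightarrow>\<^sub>M N" and w: "\<omega> \<in> space M"
  shows "(\<lambda>\<omega>'. g (\<omega>', \<omega>)) \<in> A \<rightarrow>\<^sub>M N" "(\<lambda>\<omega>'. g (\<omega>', \<omega>)) \<in> M \<rightarrow>\<^sub>M N"
proof -
  have "\<omega> \<in> space B" using w indD(4)[OF i] by simp
  from measurable_compose[OF measurable_Pair2'[OF this] g] show 1: "(\<lambda>\<omega>'. g (\<omega>', \<omega>)) \<in> A \<rightarrow>\<^sub>M N" .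
  show "(\<lambda>\<omega>'. g (\<omega>', \<omega>)) \<in> M \<rightarrow>\<^sub>M N" by (rule measurable_compose[OF indD(6)[OF i] 1])
qed

lemma ind_diag_integral:
  fixes g :: "'a \<times> 'a \<Rightarrow> real"
  assumes i: "ind A B" and g: "g \<in> borel_measurable (A \<Otimes>\<^sub>M B)" and C: "\<And>\<omega> \<omega>'. \<omega> \<in> space M \<Longrightarrow> \<omega>' \<in> space M \<Longrightarrow> \<bar>g (\<omega>', \<omega>)\<bar> \<le> C"
  shows "(\<integral>\<omega>. g (\<omega>, \<omega>) \<partial>M) = (\<integral>\<omega>. (\<integral>\<omega>'. g (\<omega>', \<omega>) \<partial>M) \<partial>M)"
proof -
  note mA = indD(6)[OF i] and mB = indD(7)[OF i]
  define MA where "MA = distr M A (\<lambda>\<omega>. \<omega>)"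
  define MB where "MB = distr M B (\<lambda>\<omega>. \<omega>)"
  interpret MA: prob_space MA unfolding MA_def by (rule prob_space_distr[OF mA])
  interpret MB: prob_space MB unfolding MB_def by (rule prob_space_distr[OF mB])
  interpret P: pair_prob_space MA MB ..
  have sets[measurable_cong]: "sets MA = sets A" "sets MB = sets B" by (auto simp: MA_def MB_def)
  have sp: "space MA = space M" "space MB = space M" by (auto simp: MA_def MB_def indD(3,4)[OF i])
  have gP: "g \<in> borel_measurable (MA \<Otimes>\<^sub>M MB)" using g by measurable
  have int: "integrable (MA \<Otimes>\<^sub>M MB) g"
    by (rule P.integrable_const_bound[of _ C]) (use C gP in \<open>auto simp: sp space_pair_measure intro!: AE_I2\<close>)
  have "(\<integral>\<omega>. g (\<omega>, \<omega>) \<partial>M) = (\<integral>p. g p \<partial>distr M (A \<Otimes>\<^sub>M B) (\<lambda>\<omega>. (\<omega>, \<omega>)))"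
    by (rule integral_distr[OF ind_diag_measurable[OF i] g, symmetric])
  also have "\<dots> = (\<integral>p. g p \<partial>(MA \<Otimes>\<^sub>M MB))" unfolding ind_diag[OF i] MA_def MB_def ..
  also have "\<dots> = (\<integral>\<omega>. (\<integral>\<omega>'. g (\<omega>', \<omega>) \<partial>MA) \<partial>MB)"
    using P.integral_snd[of "\<lambda>x y. g (x, y)"] int by (simp add: case_prod_beta')
  also have "\<dots> = (\<integral>\<omega>. (\<integral>\<omega>'. g (\<omega>', \<omega>) \<partial>MA) \<partial>M)"
  proof -
    have "(\<lambda>\<omega>. \<integral>\<omega>'. g (\<omega>', \<omega>) \<partial>MA) \<in> borel_measurable MB"
      using MA.borel_measurable_lebesgue_integral[of "\<lambda>y x. g (x, y)" MB] gP by measurable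
    then have "(\<lambda>\<omega>. \<integral>\<omega>'. g (\<omega>', \<omega>) \<partial>MA) \<in> borel_measurable B" by (simp add: measurable_cong_sets[OF sets(2) refl])
    then show ?thesis unfolding MB_def by (rule integral_distr[OF mB])
  qed
  also have "\<dots> = (\<integral>\<omega>. (\<integral>\<omega>'. g (\<omega>', \<omega>) \<partial>M) \<partial>M)"
    unfolding MA_def
    by (intro Bochner_Integration.integral_cong refl integral_distr[OF mA] ind_section_measurable(1)[OF i g])
  finally show ?thesis .
qed

lemma ind_kernel_measurable:
  assumes i: "ind A B" and g: "g \<in> A \<Otimes>\<^sub>M B \<rightarrow>\<^sub>M N"
  shows "(\<lambda>\<omega>. distr M N (\<lambda>\<omega>'. g (\<omega>', \<omega>))) \<in> B \<rightarrow>\<^sub>M prob_algebra N"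
proof -
  note mA = indD(6)[OF i]
  define MA where "MA = distr M A (\<lambda>\<omega>. \<omega>)"
  have MA: "MA \<in> space (prob_algebra A)" by (auto simp: MA_def space_prob_algebra prob_space_distr[OF mA])
  have "(\<lambda>(x, y). g (y, x)) \<in> B \<Otimes>\<^sub>M A \<rightarrow>\<^sub>M N"
    using measurable_compose[OF measurable_pair_swap' g] by (simp add: case_prod_beta')
  from measurable_distr_prob_space2[OF measurable_const[OF MA] this]
  have "(\<lambda>\<omega>. distr MA N (\<lambda>\<omega>'. g (\<omega>', \<omega>))) \<in> B \<rightarrow>\<^sub>M prob_algebra N" .
  also have "?this \<longleftrightarrow> ?thesis"
  proof (rule measurable_cong)
    fix \<omega> assume "\<omega> \<in> space B"
    then have w: "\<omega> \<in> space M" using indD(4)[OF i] by simp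
    show "distr MA N (\<lambda>\<omega>'. g (\<omega>', \<omega>)) = distr M N (\<lambda>\<omega>'. g (\<omega>', \<omega>))"
      unfolding MA_def by (subst distr_distr[OF ind_section_measurable(1)[OF i g w] mA]) (simp add: comp_def)
  qed
  finally show ?thesis .
qed

text \<open>The freezing rule: with the \<open>H\<close>-measurable argument fixed, the independent
  one is averaged. Allowing \<open>g\<close> to depend on a smaller \<open>B\<close> in the second
  argument yields a version that is measurable for \<open>B\<close>.\<close>

lemma ind_is_cond_law:
  fixes g :: "'a \<times> 'a \<Rightarrow> 'y::topological_space"
  assumes i: "ind A H" and BH: "subalgebra H B" and g: "g \<in> A \<Otimes>\<^sub>M B \<rightarrow>\<^sub>M borel"
    and Y: "\<And>\<omega>. \<omega> \<in> space M \<Longrightarrow> Y \<omega> = g (\<omega>, \<omega>)"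
  shows "is_cond_law M H Y (\<lambda>\<omega>. distr M borel (\<lambda>\<omega>'. g (\<omega>', \<omega>)))"
  unfolding is_cond_law_def
proof (intro conjI ballI)
  have iB: "ind A B" using ind_mono[OF i _ BH] by (simp add: subalgebra_def)
  have mH: "f \<in> H \<rightarrow>\<^sub>M N" if "f \<in> B \<rightarrow>\<^sub>M N" for f :: "'a \<Rightarrow> 'n" and N
    by (rule measurable_from_subalg[OF BH that])
  have gH: "g \<in> A \<Otimes>\<^sub>M H \<rightarrow>\<^sub>M borel"
    using measurable_compose[OF measurable_Pair[OF measurable_fst measurable_compose[OF measurable_snd mH[OF measurable_ident[unfolded id_def]]]] g] by simp
  show K: "(\<lambda>\<omega>. distr M borel (\<lambda>\<omega>'. g (\<omega>', \<omega>))) \<in> H \<rightarrow>\<^sub>M prob_algebra borel"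
    by (rule ind_kernel_measurable[OF i gH])
  interpret finite_measure_subalgebra M H using indD(2)[OF i] by unfold_locales
  fix S :: "'y set" assume S[measurable]: "S \<in> sets borel"
  have dm: "(\<lambda>\<omega>. g (\<omega>, \<omega>)) \<in> M \<rightarrow>\<^sub>M borel" by (rule measurable_compose[OF ind_diag_measurable[OF i] gH])
  then have Ym: "Y \<in> M \<rightarrow>\<^sub>M borel" using Y by (simp cong: measurable_cong)
  have Km: "(\<lambda>\<omega>. measure (distr M borel (\<lambda>\<omega>'. g (\<omega>', \<omega>))) S) \<in> borel_measurable H"
    by (rule measurable_compose[OF K measurable_measure_prob_algebra[OF S]])
  have Kv: "measure (distr M borel (\<lambda>\<omega>'. g (\<omega>', \<omega>))) S = (\<integral>\<omega>'. indicator S (g (\<omega>', \<omega>)) \<partial>M)" if "\<omega> \<in> space M" for \<omega>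
  proof -
    note sm = ind_section_measurable(2)[OF i gH that]
    have "(\<integral>\<omega>'. indicat_real S (g (\<omega>', \<omega>)) \<partial>M) = (\<integral>y. indicat_real S y \<partial>distr M borel (\<lambda>\<omega>'. g (\<omega>', \<omega>)))"
      by (rule integral_distr[OF sm, symmetric]) simp
    then show ?thesis by simp
  qed
  have "AE \<omega> in M. real_cond_exp M H (indicator (Y -` S \<inter> space M)) \<omega> = measure (distr M borel (\<lambda>\<omega>'. g (\<omega>', \<omega>))) S"
  proof (rule real_cond_exp_charact[OF _ _ _ Km])
    show "integrable M (indicat_real (Y -` S \<inter> space M))"
      using measurable_sets[OF Ym S] by (simp add: integrable_indicator_iff emeasure_eq_measure)
    show "integrable M (\<lambda>\<omega>. measure (distr M borel (\<lambda>\<omega>'. g (\<omega>', \<omega>))) S)"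
      using measurable_from_subalg[OF subalg Km]
      by (intro integrable_const_bound[of _ 1])
         (auto intro!: AE_I2 prob_space.prob_le_1 prob_space_distr ind_section_measurable(2)[OF i gH])
    fix h assume h[measurable]: "h \<in> sets H"
    have hM: "h \<in> sets M" using h subalg by (auto simp: subalgebra_def)
    have "(\<integral>\<omega>\<in>h. indicat_real (Y -` S \<inter> space M) \<omega> \<partial>M) = (\<integral>\<omega>. indicator h \<omega> * indicator S (g (\<omega>, \<omega>)) \<partial>M)"
      unfolding set_lebesgue_integral_def
      by (intro Bochner_Integration.integral_cong) (auto simp: Y split: split_indicator)
    also have "\<dots> = (\<integral>\<omega>. (\<integral>\<omega>'. indicator h \<omega> * indicator S (g (\<omega>', \<omega>)) \<partial>M) \<partial>M)"
    proof -
      have "(\<lambda>p. indicat_real h (snd p) * indicator S (g p)) \<in> borel_measurable (A \<Otimes>\<^sub>M H)"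
        using gH by measurable
      from ind_diag_integral[OF i this, of 1] show ?thesis
        by (simp split: split_indicator)
    qed
    also have "\<dots> = (\<integral>\<omega>\<in>h. measure (distr M borel (\<lambda>\<omega>'. g (\<omega>', \<omega>))) S \<partial>M)"
      unfolding set_lebesgue_integral_def
      by (intro Bochner_Integration.integral_cong refl) (simp add: Kv)
    finally show "(\<integral>\<omega>\<in>h. indicat_real (Y -` S \<inter> space M) \<omega> \<partial>M) = (\<integral>\<omega>\<in>h. measure (distr M borel (\<lambda>\<omega>'. g (\<omega>', \<omega>))) S \<partial>M)" .
  qed
  then show "AE \<omega> in M. measure (distr M borel (\<lambda>\<omega>'. g (\<omega>', \<omega>))) S = real_cond_exp M H (indicator (Y -` S \<inter> space M)) \<omega>"
    by eventually_elim simp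
qed

lemma ind_pair_distr:
  assumes i: "ind A B" and X: "X \<in> A \<rightarrow>\<^sub>M N" and Z: "Z \<in> B \<rightarrow>\<^sub>M L"
  shows "distr M (N \<Otimes>\<^sub>M L) (\<lambda>\<omega>. (X \<omega>, Z \<omega>)) = distr M N X \<Otimes>\<^sub>M distr M L Z"
proof -
  note mA = indD(6)[OF i] and mB = indD(7)[OF i]
  have XM: "X \<in> M \<rightarrow>\<^sub>M N" and ZM: "Z \<in> M \<rightarrow>\<^sub>M L"
    using measurable_compose[OF mA X] measurable_compose[OF mB Z] by auto
  have eqX: "distr (distr M A (\<lambda>\<omega>. \<omega>)) N X = distr M N X" "distr (distr M B (\<lambda>\<omega>. \<omega>)) L Z = distr M L Z"
    using distr_distr[OF X mA] distr_distr[OF Z mB] by (simp_all add: comp_def)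
  have "distr M N X \<Otimes>\<^sub>M distr M L Z = distr (distr M A (\<lambda>\<omega>. \<omega>) \<Otimes>\<^sub>M distr M B (\<lambda>\<omega>. \<omega>)) (N \<Otimes>\<^sub>M L) (\<lambda>(x, y). (X x, Z y))"
    unfolding eqX[symmetric]
    by (rule pair_measure_distr) (use X Z in \<open>auto simp: eqX intro!: prob_space_imp_sigma_finite prob_space_distr[OF ZM]\<close>)
  also have "\<dots> = distr (distr M (A \<Otimes>\<^sub>M B) (\<lambda>\<omega>. (\<omega>, \<omega>))) (N \<Otimes>\<^sub>M L) (\<lambda>(x, y). (X x, Z y))"
    unfolding ind_diag[OF i] ..
  also have "\<dots> = distr M (N \<Otimes>\<^sub>M L) (\<lambda>\<omega>. (X \<omega>, Z \<omega>))"
    using X Z by (subst distr_distr[OF _ ind_diag_measurable[OF i]]) (auto simp: comp_def case_prod_beta')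
  finally show ?thesis ..
qed

section \<open>Factorization through the diagonal\<close>

lemma sig_join_diag:
  assumes i: "subalgebra M A" "subalgebra M B" and U: "U \<in> sets (sig_join (space M) A B)"
  shows "\<exists>C\<in>sets (A \<Otimes>\<^sub>M B). U = {\<omega> \<in> space M. (\<omega>, \<omega>) \<in> C}"
proof -
  have sp: "space A = space M" "space B = space M" using i by (auto simp: subalgebra_def)
  \<comment> \<open>Diagonal sections of product-measurable sets form a \<sigma>-algebra that
    contains both factors, hence their join.\<close>
  define V where "V = vimage_algebra (space M) (\<lambda>\<omega>. (\<omega>, \<omega>)) (A \<Otimes>\<^sub>M B)"
  have f: "(\<lambda>\<omega>. (\<omega>, \<omega>)) \<in> space M \<rightarrow> space (A \<Otimes>\<^sub>M B)" by (auto simp: space_pair_measure sp)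
  have V: "sets V = {(\<lambda>\<omega>. (\<omega>, \<omega>)) -` C \<inter> space M |C. C \<in> sets (A \<Otimes>\<^sub>M B)}" unfolding V_def by (rule sets_vimage_algebra2[OF f])
  have "sets A \<union> sets B \<subseteq> sets V"
  proof
    fix x assume "x \<in> sets A \<union> sets B"
    then show "x \<in> sets V"
    proof
      assume x: "x \<in> sets A"
      then have "x \<times> space B \<in> sets (A \<Otimes>\<^sub>M B)" by auto
      moreover have "x = (\<lambda>\<omega>. (\<omega>, \<omega>)) -` (x \<times> space B) \<inter> space M" using sets.sets_into_space[OF x] sp by auto
      ultimately show ?thesis unfolding V by blast
    next
      assume x: "x \<in> sets B"
      then have "space A \<times> x \<in> sets (A \<Otimes>\<^sub>M B)" by auto
      moreover have "x = (\<lambda>\<omega>. (\<omega>, \<omega>)) -` (space A \<times> x) \<inter> space M" using sets.sets_into_space[OF x] sp by auto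
      ultimately show ?thesis unfolding V by blast
    qed
  qed
  moreover have "space V = space M" by (simp add: V_def)
  ultimately have "sigma_sets (space M) (sets A \<union> sets B) \<subseteq> sets V" using sets.sigma_sets_subset[of _ V] by metis
  with U have "U \<in> sets V" unfolding sets_sig_join[OF i] by auto
  then show ?thesis unfolding V by auto
qed

text \<open>A function is recovered from its sublevel sets at rational levels. The product sets
  realizing these sublevels are tied to \<open>r\<close> only on the diagonal; elsewhere
  \<open>g\<close> is just some measurable function.\<close>

lemma diag_factor_real:
  fixes r :: "'a \<Rightarrow> real"
  assumes i: "subalgebra M A" "subalgebra M B" and r: "r \<in> borel_measurable (sig_join (space M) A B)" and b: "\<And>\<omega>. \<bar>r \<omega>\<bar> \<le> b"
  shows "\<exists>g\<in>borel_measurable (A \<Otimes>\<^sub>M B). \<forall>\<omega>\<in>space M. r \<omega> = g (\<omega>, \<omega>)"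
proof -
  have "\<exists>C\<in>sets (A \<Otimes>\<^sub>M B). {\<omega> \<in> space M. r \<omega> \<le> q} = {\<omega> \<in> space M. (\<omega>, \<omega>) \<in> C}" for q
  proof (rule sig_join_diag[OF i])
    have "{\<omega> \<in> space (sig_join (space M) A B). r \<omega> \<le> q} \<in> sets (sig_join (space M) A B)" using r by measurable
    then show "{\<omega> \<in> space M. r \<omega> \<le> q} \<in> sets (sig_join (space M) A B)" using i by simp
  qed
  then have "\<forall>q. \<exists>C. C \<in> sets (A \<Otimes>\<^sub>M B) \<and> {\<omega> \<in> space M. r \<omega> \<le> q} = {\<omega> \<in> space M. (\<omega>, \<omega>) \<in> C}" by blast
  from choice[OF this] obtain C where C: "\<And>q. C q \<in> sets (A \<Otimes>\<^sub>M B)" "\<And>q. {\<omega> \<in> space M. r \<omega> \<le> q} = {\<omega> \<in> space M. (\<omega>, \<omega>) \<in> C q}"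
    by blast
  \<comment> \<open>The default \<open>b\<close> is neutral for the infimum because \<open>r\<close>
    never exceeds \<open>b\<close>.\<close>
  define c where "c q p = (if p \<in> C q then max (-b) q else b)" for q p
  define g where "g p = (INF q\<in>\<rat>. c q p)" for p
  have "g \<in> borel_measurable (A \<Otimes>\<^sub>M B)" unfolding g_def c_def
    using C(1) by (intro borel_measurable_cINF_real countable_rat measurable_If_set) (auto simp: sets.Int_space_eq2)
  moreover have "r \<omega> = g (\<omega>, \<omega>)" if w: "\<omega> \<in> space M" for \<omega>
  proof (rule antisym)
    have iff: "(\<omega>, \<omega>) \<in> C q \<longleftrightarrow> r \<omega> \<le> q" for q using C(2)[of q] w by blast
    have rb: "- b \<le> r \<omega>" "r \<omega> \<le> b" using b[of \<omega>] by (auto simp: abs_le_iff)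
    have le: "r \<omega> \<le> c q (\<omega>, \<omega>)" for q using rb by (auto simp: c_def iff)
    show "r \<omega> \<le> g (\<omega>, \<omega>)" unfolding g_def by (rule cINF_greatest) (use le Rats_0 in auto)
    show "g (\<omega>, \<omega>) \<le> r \<omega>"
    proof (rule field_le_epsilon)
      fix e :: real assume "0 < e"
      then obtain q where q: "q \<in> \<rat>" "r \<omega> < q" "q < r \<omega> + e" using Rats_dense_in_real[of "r \<omega>" "r \<omega> + e"] by auto
      have "g (\<omega>, \<omega>) \<le> c q (\<omega>, \<omega>)" unfolding g_def by (rule cINF_lower) (use le q in \<open>auto intro!: bdd_belowI2\<close>)
      also have "\<dots> \<le> r \<omega> + e" using q rb iff[of q] by (auto simp: c_def)
      finally show "g (\<omega>, \<omega>) \<le> r \<omega> + e" .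
    qed
  qed
  ultimately show ?thesis by blast
qed

lemma diag_factor:
  fixes Y :: "'a \<Rightarrow> 'y::polish_space"
  assumes comp: "compact (UNIV :: 'y set)"
    and i: "subalgebra M A" "subalgebra M B" and Y: "Y \<in> sig_join (space M) A B \<rightarrow>\<^sub>M borel"
  shows "\<exists>g\<in>A \<Otimes>\<^sub>M B \<rightarrow>\<^sub>M borel. \<forall>\<omega>\<in>space M. Y \<omega> = g (\<omega>, \<omega>)"
proof -
  obtain \<theta> :: "'y \<Rightarrow> real" and D K where enc: "\<theta> \<in> borel_measurable borel" "D \<in> borel \<rightarrow>\<^sub>M borel" "compact K" "range \<theta> \<subseteq> K"
    "\<And>y. D (\<theta> y) = y" using compact_encoding[OF comp] by metis
  obtain b where b: "\<And>x. x \<in> K \<Longrightarrow> \<bar>x\<bar> \<le> b" using compact_imp_bounded[OF enc(3)] unfolding bounded_real by auto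
  have "\<exists>g\<in>borel_measurable (A \<Otimes>\<^sub>M B). \<forall>\<omega>\<in>space M. \<theta> (Y \<omega>) = g (\<omega>, \<omega>)"
    by (rule diag_factor_real[OF i measurable_compose[OF Y enc(1)]]) (use b enc(4) in auto)
  then obtain g where g: "g \<in> borel_measurable (A \<Otimes>\<^sub>M B)" "\<And>\<omega>. \<omega> \<in> space M \<Longrightarrow> \<theta> (Y \<omega>) = g (\<omega>, \<omega>)" by auto
  show ?thesis
  proof (intro bexI ballI)
    show "(\<lambda>p. D (g p)) \<in> A \<Otimes>\<^sub>M B \<rightarrow>\<^sub>M borel" by (rule measurable_compose[OF g(1) enc(2)])
    show "Y \<omega> = D (g (\<omega>, \<omega>))" if "\<omega> \<in> space M" for \<omega> using g(2)[OF that] enc(5) by metis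
  qed
qed

end

text \<open>Conditional laws are pinned down event by event, each up to its own null set; countably
  many events that determine a law allow these null sets to be united. The sets used are the
  rational sublevels of the code.\<close>

lemma countable_separating_sets:
  assumes comp: "compact (UNIV :: 'y::polish_space set)"
  obtains E :: "nat \<Rightarrow> 'y::polish_space set" where "\<And>n. E n \<in> sets borel"
    "\<And>\<mu> \<nu>. \<mu> \<in> Prob \<Longrightarrow> \<nu> \<in> Prob \<Longrightarrow> (\<And>n. measure \<mu> (E n) = measure \<nu> (E n)) \<Longrightarrow> \<mu> = \<nu>"
proof -
  interpret comp_metric "dist :: 'y \<Rightarrow> 'y \<Rightarrow> real" by (rule comp_metric_dist[OF comp])
  obtain \<theta> :: "'y \<Rightarrow> real" and D K where enc: "\<theta> \<in> borel_measurable borel" "D \<in> borel \<rightarrow>\<^sub>M borel" "compact K" "range \<theta> \<subseteq> K"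
    "continuous_on K D" "\<And>y. D (\<theta> y) = y"
    using compact_encoding[OF comp] by blast
  note [measurable] = enc(1,2)
  define q where "q = from_nat_into (\<rat> :: real set)"
  have q: "range q = \<rat>" unfolding q_def by (rule range_from_nat_into) (auto simp: countable_rat)
  have \<theta>': "\<theta> \<in> borel_measurable \<mu>" if "\<mu> \<in> Prob" for \<mu>
    using enc(1) ProbD[OF that] measurable_cong_sets by blast
  have rd: "real_distribution (distr \<mu> borel \<theta>)" if "\<mu> \<in> Prob" for \<mu>
    by (rule prob_space.real_distribution_distr) (use ProbD[OF that] \<theta>'[OF that] in auto)
  show ?thesis
  proof (rule that[of "\<lambda>n. {y. \<theta> y \<le> q n}"])
    fix \<mu> \<nu> :: "'y measure" assume P: "\<mu> \<in> Prob" "\<nu> \<in> Prob" and eq: "\<And>n. measure \<mu> {y. \<theta> y \<le> q n} = measure \<nu> {y. \<theta> y \<le> q n}"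
    have cdf: "cdf (distr \<mu> borel \<theta>) x = measure \<mu> {y. \<theta> y \<le> x}" if "\<mu> \<in> Prob" for \<mu> x
      using \<theta>'[OF that] ProbD[OF that] by (auto simp: cdf_def measure_distr vimage_def)
    have "cdf (distr \<mu> borel \<theta>) x = cdf (distr \<nu> borel \<theta>) x" if "x \<in> \<rat>" for x
      using that eq unfolding q[symmetric] by (auto simp: cdf P)
    then have "weak_conv_m (\<lambda>n::nat. distr \<mu> borel \<theta>) (distr \<nu> borel \<theta>)"
      by (intro weak_conv_m_rationals rd P) simp
    from weak_conv_imp_Wd_tendsto(2)[OF enc(1-6) P(1) rd[OF P(2)] this]
    have "(\<lambda>n::nat. wasserstein dist \<mu> (distr (distr \<nu> borel \<theta>) borel D)) \<longlonglongrightarrow> 0" .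
    then have z: "wasserstein dist \<mu> (distr (distr \<nu> borel \<theta>) borel D) = 0" by (simp add: LIMSEQ_const_iff)
    have "distr (distr \<nu> borel \<theta>) borel D = distr \<nu> borel (\<lambda>x. x)"
      using \<theta>'[OF P(2)] by (subst distr_distr) (auto simp: comp_def enc(6))
    moreover have "distr \<nu> borel (\<lambda>x. x) = \<nu>" using ProbD[OF P(2)] by (intro distr_id2) auto
    ultimately show "\<mu> = \<nu>" using Wd_zeroD[OF P] z by simp
  qed measurable
qed

lemma is_cond_law_unique:
  fixes \<kappa> \<kappa>' :: "'w \<Rightarrow> 'y::polish_space measure"
  assumes comp: "compact (UNIV :: 'y set)" and H: "space H = space M"
    and k: "is_cond_law M H Y \<kappa>" "is_cond_law M H Y \<kappa>'"
  shows "AE \<omega> in M. \<kappa> \<omega> = \<kappa>' \<omega>"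
proof -
  obtain E :: "nat \<Rightarrow> 'y set" where E: "\<And>n. E n \<in> sets borel"
    "\<And>\<mu> \<nu>. \<mu> \<in> Prob \<Longrightarrow> \<nu> \<in> Prob \<Longrightarrow> (\<And>n. measure \<mu> (E n) = measure \<nu> (E n)) \<Longrightarrow> \<mu> = \<nu>"
    using countable_separating_sets[OF comp] by metis
  have "AE \<omega> in M. measure (\<kappa> \<omega>) (E n) = measure (\<kappa>' \<omega>) (E n)" for n
  proof -
    have "AE \<omega> in M. measure (\<kappa> \<omega>) (E n) = real_cond_exp M H (indicator (Y -` E n \<inter> space M)) \<omega>"
      "AE \<omega> in M. measure (\<kappa>' \<omega>) (E n) = real_cond_exp M H (indicator (Y -` E n \<inter> space M)) \<omega>"
      using k E(1) unfolding is_cond_law_def by auto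
    then show ?thesis by eventually_elim simp
  qed
  then have "AE \<omega> in M. \<forall>n. measure (\<kappa> \<omega>) (E n) = measure (\<kappa>' \<omega>) (E n)" by (simp add: AE_all_countable)
  then show ?thesis
    using AE_space
  proof eventually_elim
    case (elim \<omega>)
    then have "\<omega> \<in> space H" using H by simp
    then have "\<kappa> \<omega> \<in> Prob" "\<kappa>' \<omega> \<in> Prob"
      using k measurable_space[of \<kappa> H] measurable_space[of \<kappa>' H] unfolding is_cond_law_def by blast+
    with E(2) elim(1) show ?case by blast
  qed
qed

section \<open>Dynamics and verification\<close>

lemma gen_sigma_Pow: "(\<Union>i\<in>I. sets (vimage_algebra \<Omega> (Y i) N)) \<subseteq> Pow \<Omega>"
  using sets.space_closed[of "vimage_algebra \<Omega> _ N"] by fastforce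

lemma space_gen_sigma[simp]: "space (gen_sigma \<Omega> N Y I) = \<Omega>"
  unfolding gen_sigma_def by (rule space_measure_of[OF gen_sigma_Pow])

lemma sets_gen_sigma: "sets (gen_sigma \<Omega> N Y I) = sigma_sets \<Omega> (\<Union>i\<in>I. sets (vimage_algebra \<Omega> (Y i) N))"
  unfolding gen_sigma_def by (rule sets_measure_of[OF gen_sigma_Pow])

lemma gen_sigma_mono: "I \<subseteq> J \<Longrightarrow> sets (gen_sigma \<Omega> N Y I) \<subseteq> sets (gen_sigma \<Omega> N Y J)"
  unfolding sets_gen_sigma by (rule sigma_sets_mono') auto

lemma gen_sigma_measurable:
  assumes i: "i \<in> I" and Y: "Y i \<in> \<Omega> \<rightarrow> space N" shows "Y i \<in> gen_sigma \<Omega> N Y I \<rightarrow>\<^sub>M N"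
proof (rule measurableI)
  show "Y i x \<in> space N" if "x \<in> space (gen_sigma \<Omega> N Y I)" for x using that Y by auto
  fix A assume "A \<in> sets N"
  then have "Y i -` A \<inter> \<Omega> \<in> sets (vimage_algebra \<Omega> (Y i) N)" by (rule in_vimage_algebra)
  then show "Y i -` A \<inter> space (gen_sigma \<Omega> N Y I) \<in> sets (gen_sigma \<Omega> N Y I)"
    unfolding sets_gen_sigma using i by (auto intro!: sigma_sets.Basic)
qed

context prob_space
begin

lemma gen_sigma_subalgebra:
  assumes Y: "\<And>i. i \<in> I \<Longrightarrow> Y i \<in> M \<rightarrow>\<^sub>M N" shows "subalgebra M (gen_sigma (space M) N Y I)"
proof -
  have "sets (vimage_algebra (space M) (Y i) N) \<subseteq> events" if "i \<in> I" for i
    using measurable_iff_sets[of "Y i" M N] Y[OF that] by blast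
  then have "sigma_sets (space M) (\<Union>i\<in>I. sets (vimage_algebra (space M) (Y i) N)) \<subseteq> events"
    by (intro sets.sigma_sets_subset) auto
  then show ?thesis by (simp add: subalgebra_def sets_gen_sigma)
qed

lemma gen_sigma_ind:
  assumes iv: "indep_vars (\<lambda>_. N) Y K" and IJ: "I \<inter> J = {}" "I \<union> J \<subseteq> K"
  shows "ind (gen_sigma (space M) N Y I) (gen_sigma (space M) N Y J)"
proof (rule indI_indep_set)
  have "indep_sets (\<lambda>i. sets (vimage_algebra (space M) (Y i) N)) K"
    using iv unfolding indep_vars_def sets_vimage_algebra by auto
  then have "indep_sets (\<lambda>i. sets (vimage_algebra (space M) (Y i) N)) (\<Union>b\<in>UNIV. case_bool I J b)"
    by (rule indep_sets_mono_index[rotated]) (use IJ in \<open>auto simp: UNIV_bool\<close>)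
  then have "indep_sets (\<lambda>b. sigma_sets (space M) (\<Union>i\<in>case_bool I J b. sets (vimage_algebra (space M) (Y i) N))) UNIV"
    by (rule indep_sets_collect_sigma)
       (use IJ in \<open>auto simp: Int_stable_def disjoint_family_on_def split: bool.splits\<close>)
  also have "(\<lambda>b. sigma_sets (space M) (\<Union>i\<in>case_bool I J b. sets (vimage_algebra (space M) (Y i) N)))
    = case_bool (sets (gen_sigma (space M) N Y I)) (sets (gen_sigma (space M) N Y J))"
    unfolding sets_gen_sigma by (auto simp: fun_eq_iff split: bool.splits)
  finally show "indep_set (sets (gen_sigma (space M) N Y I)) (sets (gen_sigma (space M) N Y J))"
    unfolding indep_set_def .
qed auto

lemma sig_join_upper:
  assumes "subalgebra M A" "subalgebra M B"
  shows "sets A \<subseteq> sets (sig_join (space M) A B)" "sets B \<subseteq> sets (sig_join (space M) A B)"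
  unfolding sets_sig_join[OF assms] by (auto intro: sigma_sets.Basic)

lemma sig_join_least:
  assumes "subalgebra M A" "subalgebra M B" "sets A \<subseteq> sets C" "sets B \<subseteq> sets C" "space C = space M"
  shows "sets (sig_join (space M) A B) \<subseteq> sets C"
  unfolding sets_sig_join[OF assms(1,2)] using assms(3-5) sets.sigma_sets_subset[of "sets A \<union> sets B" C] by auto

lemma sig_join_subalgebra:
  assumes "subalgebra M A" "subalgebra M B" shows "subalgebra M (sig_join (space M) A B)"
  using sig_join_least[OF assms, of M] assms by (auto simp: subalgebra_def)

end

section \<open>Information \<sigma>-algebras and their independence\<close>

context cmkv_mdp
begin

abbreviation "Om \<equiv> space (prb S)"
abbreviation "com t \<equiv> common_sigma S {1..t}"
abbreviation "comall \<equiv> common_sigma S {1..}"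

text \<open>Idiosyncratic and full information at time \<open>t\<close>; the set \<open>I\<close> of randomization indices is
  \<open>{0..<t}\<close> before and \<open>{0..t}\<close> after the action is drawn.\<close>
definition pv :: "nat set \<Rightarrow> nat \<Rightarrow> 'w measure" where
  "pv I t = sig_join Om (sig_join Om (init S) (rnd_sigma S I)) (noise_sigma S {1..t})"

definition fil :: "nat set \<Rightarrow> nat \<Rightarrow> 'w measure" where
  "fil I t = sig_join Om (pv I t) (com t)"

lemma sub_init: "subalgebra (prb S) (init S)" by (rule init_subalgebra)
lemma sub_rnd: "subalgebra (prb S) (rnd_sigma S I)"
  unfolding rnd_sigma_def by (rule gen_sigma_subalgebra) (rule rnd_measurable)
lemma sub_noise: "I \<subseteq> {1..} \<Longrightarrow> subalgebra (prb S) (noise_sigma S I)"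
  unfolding noise_sigma_def by (rule gen_sigma_subalgebra) (rule noise_measurable, auto)
lemma sub_common: "I \<subseteq> {1..} \<Longrightarrow> subalgebra (prb S) (common_sigma S I)"
  unfolding common_sigma_def by (rule gen_sigma_subalgebra) (rule common_measurable, auto)

lemma sub_noise_t: "subalgebra (prb S) (noise_sigma S {1..t})" and sub_com: "subalgebra (prb S) (com t)"
  and sub_comall: "subalgebra (prb S) comall"
  by (rule sub_noise sub_common, auto)+

lemma sub_IR: "subalgebra (prb S) (sig_join Om (init S) (rnd_sigma S I))"
  by (rule sig_join_subalgebra[OF sub_init sub_rnd])

lemma sub_pv: "subalgebra (prb S) (pv I t)"
  unfolding pv_def by (rule sig_join_subalgebra[OF sub_IR sub_noise_t])

lemma sub_fil: "subalgebra (prb S) (fil I t)"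
  unfolding fil_def by (rule sig_join_subalgebra[OF sub_pv sub_com])

lemma space_fil[simp]: "space (fil I t) = Om" and space_pv[simp]: "space (pv I t) = Om"
  and space_com[simp]: "space (common_sigma S I) = Om"
  using sub_fil[of I t] sub_pv[of I t] by (simp_all add: subalgebra_def common_sigma_def)

lemma com_mono: "s \<le> t \<Longrightarrow> subalgebra (com t) (com s)" "subalgebra comall (com t)"
  unfolding subalgebra_def common_sigma_def by (intro impI conjI gen_sigma_mono; simp)+

lemma pv_pieces: "sets (init S) \<subseteq> sets (pv I t)" "sets (rnd_sigma S I) \<subseteq> sets (pv I t)" "sets (noise_sigma S {1..t}) \<subseteq> sets (pv I t)"
  unfolding pv_def using sig_join_upper[OF sub_init sub_rnd[of I]] sig_join_upper[OF sub_IR[of I] sub_noise_t[of t]]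
  by (meson order_trans)+

lemma pv_least:
  assumes "sets (init S) \<subseteq> sets C" "sets (rnd_sigma S I) \<subseteq> sets C" "sets (noise_sigma S {1..t}) \<subseteq> sets C" "space C = Om"
  shows "sets (pv I t) \<subseteq> sets C"
  unfolding pv_def using assms by (intro sig_join_least sub_IR sub_init sub_rnd sub_noise_t)

lemma fil_pieces: "sets (pv I t) \<subseteq> sets (fil I t)" "sets (com t) \<subseteq> sets (fil I t)"
  unfolding fil_def using sig_join_upper[OF sub_pv sub_com] by blast+

lemma pv_mono: assumes "I \<subseteq> I'" "s \<le> t" shows "subalgebra (pv I' t) (pv I s)"
proof -
  have "sets (rnd_sigma S I) \<subseteq> sets (rnd_sigma S I')" "sets (noise_sigma S {1..s}) \<subseteq> sets (noise_sigma S {1..t})"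
    unfolding rnd_sigma_def noise_sigma_def using assms by (intro gen_sigma_mono; auto)+
  then show ?thesis unfolding subalgebra_def using pv_pieces[where I = I' and t = t]
    by (intro conjI pv_least) auto
qed

lemma fil_mono: assumes "I \<subseteq> I'" "s \<le> t" shows "subalgebra (fil I' t) (fil I s)"
proof -
  have "sets (fil I s) \<subseteq> sets (fil I' t)"
    unfolding fil_def[of I s] using pv_mono[OF assms] com_mono(1)[OF assms(2)] fil_pieces[where I = I' and t = t]
    by (intro sig_join_least sub_pv sub_com) (auto simp: subalgebra_def)
  then show ?thesis by (simp add: subalgebra_def)
qed

text \<open>Splits the filtration into an idiosyncratic and a common factor, which are independent;
  the factorization through the diagonal applies to this form.\<close>

lemma sets_filt: "sets (filt S t) = sets (fil {0..t} t)" and space_filt: "space (filt S t) = Om"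
proof -
  let ?G = "sets (init S) \<union> sets (rnd_sigma S {0..t}) \<union> sets (noise_sigma S {1..t}) \<union> sets (com t)"
  have Gev: "?G \<subseteq> events" using sub_init sub_rnd[of "{0..t}"] sub_noise_t[of t] sub_com[of t] by (simp add: subalgebra_def)
  then have GP: "?G \<subseteq> Pow Om" using sets.space_closed[of "prb S"] by blast
  have s: "sets (filt S t) = sigma_sets Om ?G" unfolding filt_def by (rule sets_measure_of[OF GP])
  show sp: "space (filt S t) = Om" unfolding filt_def by (rule space_measure_of[OF GP])
  have G: "?G \<subseteq> sets (filt S t)" unfolding s by (rule subsetI) (rule sigma_sets.Basic)
  show "sets (filt S t) = sets (fil {0..t} t)"
  proof
    have "?G \<subseteq> sets (fil {0..t} t)"
      by (intro Un_least order_trans[OF pv_pieces(1) fil_pieces(1)] order_trans[OF pv_pieces(2) fil_pieces(1)]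
          order_trans[OF pv_pieces(3) fil_pieces(1)] fil_pieces(2))
    then show "sets (filt S t) \<subseteq> sets (fil {0..t} t)" unfolding s using sets.sigma_sets_subset[of ?G "fil {0..t} t"] by simp
    show "sets (fil {0..t} t) \<subseteq> sets (filt S t)"
      unfolding fil_def using G sp by (intro sig_join_least sub_pv sub_com pv_least) auto
  qed
qed

lemma measurable_filt: "f \<in> filt S t \<rightarrow>\<^sub>M N \<longleftrightarrow> f \<in> fil {0..t} t \<rightarrow>\<^sub>M N"
  using measurable_cong_sets[OF sets_filt refl] by blast

lemma noise_pv: "1 \<le> s \<Longrightarrow> s \<le> t \<Longrightarrow> noise S s \<in> pv I t \<rightarrow>\<^sub>M nsp S"
  by (rule measurable_from_subalg[of _ "noise_sigma S {1..t}"])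
     (use pv_pieces(3) sub_noise_t[of t] in \<open>auto simp: subalgebra_def noise_sigma_def intro!: gen_sigma_measurable measurable_space[OF noise_measurable]\<close>)

lemma common_com: "1 \<le> s \<Longrightarrow> s \<in> I \<Longrightarrow> common S s \<in> common_sigma S I \<rightarrow>\<^sub>M csp S"
  unfolding common_sigma_def by (rule gen_sigma_measurable) (auto intro!: measurable_space[OF common_measurable])

lemma rnd_pv: "s \<in> I \<Longrightarrow> rnd S s \<in> pv I t \<rightarrow>\<^sub>M unif"
  by (rule measurable_from_subalg[of _ "rnd_sigma S I"])
     (use pv_pieces(2) sub_rnd[of I] measurable_space[OF rnd_measurable] in \<open>auto simp: subalgebra_def rnd_sigma_def simp del: space_unif intro!: gen_sigma_measurable\<close>)

lemma init_pv: "f \<in> init S \<rightarrow>\<^sub>M N \<Longrightarrow> f \<in> pv I t \<rightarrow>\<^sub>M N"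
  by (rule measurable_from_subalg[of _ "init S"]) (use pv_pieces(1) sub_init in \<open>auto simp: subalgebra_def\<close>)

lemma fil_of_pv: "f \<in> pv I t \<rightarrow>\<^sub>M N \<Longrightarrow> f \<in> fil I t \<rightarrow>\<^sub>M N"
  by (rule measurable_from_subalg[of _ "pv I t"]) (use fil_pieces in \<open>auto simp: subalgebra_def\<close>)

lemma fil_of_com: "f \<in> com t \<rightarrow>\<^sub>M N \<Longrightarrow> f \<in> fil I t \<rightarrow>\<^sub>M N"
  by (rule measurable_from_subalg[of _ "com t"]) (use fil_pieces in \<open>auto simp: subalgebra_def\<close>)

lemma prb_of_fil: "f \<in> fil I t \<rightarrow>\<^sub>M N \<Longrightarrow> f \<in> prb S \<rightarrow>\<^sub>M N"
  by (rule measurable_from_subalg[OF sub_fil])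

lemma prb_of_com: "f \<in> com t \<rightarrow>\<^sub>M N \<Longrightarrow> f \<in> prb S \<rightarrow>\<^sub>M N"
  by (rule measurable_from_subalg[OF sub_com])

definition src :: "nat \<Rightarrow> 'w measure" where
  "src i = [init S, rnd_sigma S UNIV, noise_sigma S {1..}, common_sigma S {1..}] ! i"

text \<open>Groups the four independent sources into two disjoint blocks and passes to
  \<sigma>-algebras generated within each block.\<close>

lemma src_ind:
  assumes PQ: "P \<inter> Q = {}" "P \<union> Q \<subseteq> {..<4}" and A: "subalgebra (prb S) A" "sets A \<subseteq> sigma_sets Om (\<Union>i\<in>P. sets (src i))"
    and B: "subalgebra (prb S) B" "sets B \<subseteq> sigma_sets Om (\<Union>i\<in>Q. sets (src i))"
  shows "ind A B"
proof (rule indI_indep_set)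
  have "[sets (init S), sets (rnd_sigma S UNIV), sets (noise_sigma S {1..}), sets (common_sigma S {1..})] ! i = sets (src i)" if "i < 4" for i
  proof -
    have "i \<in> {0, 1, 2, 3}" using that by auto
    then show ?thesis by (auto simp: src_def)
  qed
  with sources_indep have "indep_sets (\<lambda>i. sets (src i)) {..<4}"
    by (subst (asm) indep_sets_cong[OF refl]) auto
  then have "indep_sets (\<lambda>i. sets (src i)) (\<Union>b\<in>UNIV. case_bool P Q b)"
    by (rule indep_sets_mono_index[rotated]) (use PQ in \<open>auto simp: UNIV_bool\<close>)
  then have "indep_sets (\<lambda>b. sigma_sets Om (\<Union>i\<in>case_bool P Q b. sets (src i))) UNIV"
    by (rule indep_sets_collect_sigma)
       (use PQ in \<open>auto simp: Int_stable_def disjoint_family_on_def split: bool.splits\<close>)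
  then have "indep_sets (case_bool (sets A) (sets B)) UNIV"
    by (rule indep_sets_mono_sets) (use A B in \<open>auto split: bool.splits\<close>)
  then show "indep_set (sets A) (sets B)" unfolding indep_set_def .
qed (use A B in \<open>auto simp: subalgebra_def\<close>)

lemma src_simps: "src 0 = init S" "src 1 = rnd_sigma S UNIV" "src 2 = noise_sigma S {1..}" "src 3 = common_sigma S {1..}"
  by (simp_all add: src_def)

lemma src_sub: "i < 4 \<Longrightarrow> subalgebra (prb S) (src i)"
proof -
  assume "i < 4"
  then have "i = 0 \<or> i = 1 \<or> i = 2 \<or> i = 3" by auto
  then show ?thesis using sub_init sub_rnd sub_noise sub_comall by (elim disjE) (simp_all add: src_simps del: One_nat_def)
qed

lemma src_sigma:
  assumes P: "P \<subseteq> {..<4}"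
  shows "space (sigma Om (\<Union>i\<in>P. sets (src i))) = Om" "sets (sigma Om (\<Union>i\<in>P. sets (src i))) = sigma_sets Om (\<Union>i\<in>P. sets (src i))"
    "i \<in> P \<Longrightarrow> sets (src i) \<subseteq> sigma_sets Om (\<Union>i\<in>P. sets (src i))"
proof -
  have "sets (src i) \<subseteq> Pow Om" if "i \<in> P" for i
  proof -
    have "i < 4" using P that by auto
    from src_sub[OF this] sets.space_closed[of "src i"] show ?thesis by (simp add: subalgebra_def)
  qed
  then have "(\<Union>i\<in>P. sets (src i)) \<subseteq> Pow Om" by (rule UN_least)
  then show "space (sigma Om (\<Union>i\<in>P. sets (src i))) = Om" "sets (sigma Om (\<Union>i\<in>P. sets (src i))) = sigma_sets Om (\<Union>i\<in>P. sets (src i))"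
    by (rule space_measure_of, rule sets_measure_of)
qed (auto intro: sigma_sets.Basic)

lemma rnd_src: "sets (rnd_sigma S I) \<subseteq> sets (src 1)" and noise_src: "I' \<subseteq> {1..} \<Longrightarrow> sets (noise_sigma S I') \<subseteq> sets (src 2)"
  unfolding src_simps rnd_sigma_def noise_sigma_def by (rule gen_sigma_mono, (assumption | simp))+

lemma ind_pv_comall: "ind (pv I t) comall"
proof (rule src_ind[of "{0, 1, 2}" "{3}"])
  let ?C = "sigma Om (\<Union>i\<in>{0, 1, 2}. sets (src i))"
  have P: "{0, 1, 2} \<subseteq> {..<4::nat}" by auto
  note C = src_sigma[OF P]
  have "sets (pv I t) \<subseteq> sets ?C"
  proof (rule pv_least)
    show "sets (init S) \<subseteq> sets ?C" unfolding C(2) using C(3)[of 0] by (simp add: src_simps)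
    show "sets (rnd_sigma S I) \<subseteq> sets ?C" unfolding C(2) using C(3)[of 1] rnd_src by blast
    show "sets (noise_sigma S {1..t}) \<subseteq> sets ?C" unfolding C(2) using C(3)[of 2] noise_src[of "{1..t}"] by auto
  qed (rule C(1))
  then show "sets (pv I t) \<subseteq> sigma_sets Om (\<Union>i\<in>{0, 1, 2}. sets (src i))" unfolding C(2) .
  show "sets comall \<subseteq> sigma_sets Om (\<Union>i\<in>{3}. sets (src i))" by (auto simp: src_simps intro: sigma_sets.Basic)
qed (rule sub_pv sub_comall | simp)+

lemma ind_pv_com: "ind (pv I t) (com s)"
  by (rule ind_mono[OF ind_pv_comall[where I = I and t = t] _ com_mono(2)]) (simp add: subalgebra_def)

text \<open>The next noise is independent of the earlier ones, and both lie in the noise source,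
  which is independent of the initial information and the randomization.\<close>

lemma ind_pv_noise: "ind (pv I t) (noise_sigma S {Suc t})"
  unfolding pv_def
proof (rule ind_join[where D = "noise_sigma S {1..}"])
  show "ind (noise_sigma S {1..t}) (noise_sigma S {Suc t})"
    unfolding noise_sigma_def by (rule gen_sigma_ind[OF noise_indep]) auto
  show "ind (sig_join Om (init S) (rnd_sigma S I)) (noise_sigma S {1..})"
  proof (rule src_ind[of "{0, 1}" "{2}"])
    let ?C = "sigma Om (\<Union>i\<in>{0, 1}. sets (src i))"
    have P: "{0, 1} \<subseteq> {..<4::nat}" by auto
    note C = src_sigma[OF P]
    have "sets (sig_join Om (init S) (rnd_sigma S I)) \<subseteq> sets ?C"
    proof (rule sig_join_least[OF sub_init sub_rnd])
      show "sets (init S) \<subseteq> sets ?C" unfolding C(2) using C(3)[of 0] by (simp add: src_simps)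
      show "sets (rnd_sigma S I) \<subseteq> sets ?C" unfolding C(2) using C(3)[of 1] rnd_src by blast
    qed (rule C(1))
    then show "sets (sig_join Om (init S) (rnd_sigma S I)) \<subseteq> sigma_sets Om (\<Union>i\<in>{0, 1}. sets (src i))" unfolding C(2) .
    show "sets (noise_sigma S {1..}) \<subseteq> sigma_sets Om (\<Union>i\<in>{2}. sets (src i))" by (auto simp: src_simps intro: sigma_sets.Basic)
  qed (rule sub_IR sub_noise[OF order_refl] | simp)+
qed (unfold noise_sigma_def, (rule gen_sigma_mono, simp)+)

text \<open>The join is regrouped so that the randomization comes last; only then do the past and
  the next randomization variable lie in one source to which \<open>ind_join\<close>
  applies.\<close>

lemma ind_pv_rnd: "ind (pv {0..<t} s) (rnd_sigma S {t})"
proof -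
  let ?A = "sig_join Om (init S) (noise_sigma S {1..s})"
  have sA: "subalgebra (prb S) ?A" by (rule sig_join_subalgebra[OF sub_init sub_noise_t])
  have "ind (sig_join Om ?A (rnd_sigma S {0..<t})) (rnd_sigma S {t})"
  proof (rule ind_join[where D = "rnd_sigma S UNIV"])
    show "ind (rnd_sigma S {0..<t}) (rnd_sigma S {t})"
      unfolding rnd_sigma_def by (rule gen_sigma_ind[OF rnd_indep]) auto
    show "ind ?A (rnd_sigma S UNIV)"
    proof (rule src_ind[of "{0, 2}" "{1}"])
      let ?C = "sigma Om (\<Union>i\<in>{0, 2}. sets (src i))"
      have P: "{0, 2} \<subseteq> {..<4::nat}" by auto
      note C = src_sigma[OF P]
      have "sets ?A \<subseteq> sets ?C"
      proof (rule sig_join_least[OF sub_init sub_noise_t])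
        show "sets (init S) \<subseteq> sets ?C" unfolding C(2) using C(3)[of 0] by (simp add: src_simps)
        show "sets (noise_sigma S {1..s}) \<subseteq> sets ?C" unfolding C(2) using C(3)[of 2] noise_src[of "{1..s}"] by auto
      qed (rule C(1))
      then show "sets ?A \<subseteq> sigma_sets Om (\<Union>i\<in>{0, 2}. sets (src i))" unfolding C(2) .
      show "sets (rnd_sigma S UNIV) \<subseteq> sigma_sets Om (\<Union>i\<in>{1}. sets (src i))"
        unfolding src_simps(2)[symmetric] by (auto intro: sigma_sets.Basic)
    qed (rule sA sub_rnd | simp)+
  qed (unfold rnd_sigma_def, (rule gen_sigma_mono, simp)+)
  then show ?thesis
  proof (rule ind_mono)
    have "sets (pv {0..<t} s) \<subseteq> sets (sig_join Om ?A (rnd_sigma S {0..<t}))"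
      using sig_join_upper[OF sub_init sub_noise_t, of s] sig_join_upper[OF sA sub_rnd, of "{0..<t}"]
        space_sig_join[OF sA sub_rnd, of "{0..<t}"]
      by (intro pv_least) auto
    then show "subalgebra (sig_join Om ?A (rnd_sigma S {0..<t})) (pv {0..<t} s)"
      using space_sig_join[OF sA sub_rnd, of "{0..<t}"] by (simp add: subalgebra_def)
  qed (simp add: subalgebra_def)
qed

lemma ind_com_common: "ind (com t) (common_sigma S {Suc t})"
  unfolding common_sigma_def by (rule gen_sigma_ind[OF common_indep]) auto

section \<open>One-step transition of conditional laws\<close>

lemma noise_law: "distr (prb S) (nsp S) (noise S (Suc t)) = nlaw"
  unfolding nlaw_def by (rule noise_ident) simp

lemma common_law: "distr (prb S) (csp S) (common S (Suc t)) = claw"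
  unfolding claw_def by (rule common_ident) simp

text \<open>The averaged kernel is a version that depends on the common noise up to \<open>t\<close>
  only, so the choice in \<open>cond_law\<close> is not vacuous. The chosen version inherits this
  measurability everywhere and agrees with the kernel almost surely.\<close>

lemma cond_law_diag:
  fixes Y :: "'w \<Rightarrow> 'y::polish_space"
  assumes comp: "compact (UNIV :: 'y set)" and i: "ind A comall" and g: "g \<in> A \<Otimes>\<^sub>M com t \<rightarrow>\<^sub>M borel"
    and Y: "\<And>\<omega>. \<omega> \<in> Om \<Longrightarrow> Y \<omega> = g (\<omega>, \<omega>)"
  shows "cond_law S t Y \<in> com t \<rightarrow>\<^sub>M prob_algebra borel"
    "AE \<omega> in prb S. cond_law S t Y \<omega> = distr (prb S) borel (\<lambda>\<omega>'. g (\<omega>', \<omega>))"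
proof -
  have ic: "is_cond_law (prb S) comall Y (\<lambda>\<omega>. distr (prb S) borel (\<lambda>\<omega>'. g (\<omega>', \<omega>)))"
    by (rule ind_is_cond_law[OF i com_mono(2) g Y])
  have it: "ind A (com t)" by (rule ind_mono[OF i _ com_mono(2)]) (simp add: subalgebra_def)
  have ex: "\<exists>\<kappa>. is_cond_law (prb S) comall Y \<kappa> \<and> \<kappa> \<in> com t \<rightarrow>\<^sub>M prob_algebra borel"
    using ic ind_kernel_measurable[OF it g] by blast
  have c: "is_cond_law (prb S) comall Y (cond_law S t Y) \<and> cond_law S t Y \<in> com t \<rightarrow>\<^sub>M prob_algebra borel"
    unfolding cond_law_def by (rule someI_ex[OF ex])
  then show "cond_law S t Y \<in> com t \<rightarrow>\<^sub>M prob_algebra borel" by simp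
  show "AE \<omega> in prb S. cond_law S t Y \<omega> = distr (prb S) borel (\<lambda>\<omega>'. g (\<omega>', \<omega>))"
    by (rule is_cond_law_unique[OF comp _ _ ic]) (use c in auto)
qed

lemma fil_factor:
  fixes Y :: "'w \<Rightarrow> 'y::polish_space"
  assumes comp: "compact (UNIV :: 'y set)" and Y: "Y \<in> fil I t \<rightarrow>\<^sub>M borel"
  obtains g where "g \<in> pv I t \<Otimes>\<^sub>M com t \<rightarrow>\<^sub>M borel" "\<And>\<omega>. \<omega> \<in> Om \<Longrightarrow> Y \<omega> = g (\<omega>, \<omega>)"
  using diag_factor[OF comp sub_pv sub_com Y[unfolded fil_def]] by blast

lemma cond_law_measurable:
  fixes Y :: "'w \<Rightarrow> 'y::polish_space"
  assumes comp: "compact (UNIV :: 'y set)" and Y: "Y \<in> fil I t \<rightarrow>\<^sub>M borel"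
  shows "cond_law S t Y \<in> com t \<rightarrow>\<^sub>M prob_algebra borel"
proof -
  obtain g where g: "g \<in> pv I t \<Otimes>\<^sub>M com t \<rightarrow>\<^sub>M borel" "\<And>\<omega>. \<omega> \<in> Om \<Longrightarrow> Y \<omega> = g (\<omega>, \<omega>)" using fil_factor[OF comp Y] by blast
  show ?thesis by (rule cond_law_diag(1)[OF comp ind_pv_comall g])
qed

text \<open>With the common noise frozen, the pair \<open>g\<close> has law \<kappa> and is
  independent of the next idiosyncratic noise; the transition then carries their product law to
  \<open>Fhat\<close>.\<close>

lemma cond_law_step:
  assumes g: "g \<in> pv {0..t} t \<Otimes>\<^sub>M com t \<rightarrow>\<^sub>M borel" and k: "\<kappa> \<in> com t \<rightarrow>\<^sub>M prob_algebra borel"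
    and kg: "AE \<omega> in prb S. \<kappa> \<omega> = distr (prb S) borel (\<lambda>\<omega>'. g (\<omega>', \<omega>))"
    and Y: "\<And>\<omega>. \<omega> \<in> Om \<Longrightarrow> Y \<omega> = trans_fun S (fst (g (\<omega>, \<omega>))) (snd (g (\<omega>, \<omega>))) (\<kappa> \<omega>) (noise S (Suc t) \<omega>) (common S (Suc t) \<omega>)"
  shows "AE \<omega> in prb S. cond_law S (Suc t) Y \<omega> = Fhat (\<kappa> \<omega>) (common S (Suc t) \<omega>)"
proof -
  \<comment> \<open>The first argument carries the idiosyncratic noise. The measure argument and the
    common noise sit in the second, so they are constants once it is frozen.\<close>
  define h where "h p = trans_fun S (fst (g p)) (snd (g p)) (\<kappa> (snd p)) (noise S (Suc t) (fst p)) (common S (Suc t) (snd p))" for p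
  have idA: "(\<lambda>\<omega>. \<omega>) \<in> pv {0..t} (Suc t) \<rightarrow>\<^sub>M pv {0..t} t"
    by (rule measurable_from_subalg[OF pv_mono[where I = "{0..t}" and I' = "{0..t}" and s = t and t = "Suc t"]]) auto
  have idC: "(\<lambda>\<omega>. \<omega>) \<in> com (Suc t) \<rightarrow>\<^sub>M com t"
    by (rule measurable_from_subalg[OF com_mono(1)[where s = t and t = "Suc t"]]) auto
  have idP: "(\<lambda>p. (fst p, snd p)) \<in> pv {0..t} (Suc t) \<Otimes>\<^sub>M com (Suc t) \<rightarrow>\<^sub>M pv {0..t} t \<Otimes>\<^sub>M com t"
    by (intro measurable_Pair measurable_compose[OF measurable_fst idA] measurable_compose[OF measurable_snd idC])
  have [measurable]: "g \<in> pv {0..t} (Suc t) \<Otimes>\<^sub>M com (Suc t) \<rightarrow>\<^sub>M borel" using measurable_compose[OF idP g] by simp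
  have [measurable]: "\<kappa> \<in> com (Suc t) \<rightarrow>\<^sub>M prob_algebra borel" using measurable_compose[OF idC k] .
  have [measurable]: "noise S (Suc t) \<in> pv {0..t} (Suc t) \<rightarrow>\<^sub>M nsp S" by (rule noise_pv) auto
  have [measurable]: "common S (Suc t) \<in> com (Suc t) \<rightarrow>\<^sub>M csp S" by (rule common_com) auto
  have h: "h \<in> pv {0..t} (Suc t) \<Otimes>\<^sub>M com (Suc t) \<rightarrow>\<^sub>M borel" unfolding h_def by measurable
  have Yh: "Y \<omega> = h (\<omega>, \<omega>)" if "\<omega> \<in> Om" for \<omega> using Y[OF that] by (simp add: h_def)
  have "AE \<omega> in prb S. cond_law S (Suc t) Y \<omega> = distr (prb S) borel (\<lambda>\<omega>'. h (\<omega>', \<omega>))"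
    by (rule cond_law_diag(2)[OF compact_state ind_pv_comall h Yh])
  then show ?thesis using kg AE_space
  proof eventually_elim
    case (elim \<omega>)
    have P: "\<kappa> \<omega> \<in> Prob" using measurable_space[OF k] elim(3) by simp
    have c: "common S (Suc t) \<omega> \<in> space (csp S)" using measurable_space[OF common_measurable, of "Suc t"] elim(3) by simp
    have g1: "(\<lambda>\<omega>'. g (\<omega>', \<omega>)) \<in> pv {0..t} t \<rightarrow>\<^sub>M borel" by (rule ind_section_measurable(1)[OF ind_pv_com g]) (rule elim)
    have n1: "noise S (Suc t) \<in> noise_sigma S {Suc t} \<rightarrow>\<^sub>M nsp S"
      unfolding noise_sigma_def by (rule gen_sigma_measurable) (auto intro!: measurable_space[OF noise_measurable])
    have pair: "distr (prb S) (borel \<Otimes>\<^sub>M nsp S) (\<lambda>\<omega>'. (g (\<omega>', \<omega>), noise S (Suc t) \<omega>')) = \<kappa> \<omega> \<Otimes>\<^sub>M nlaw"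
      unfolding ind_pair_distr[OF ind_pv_noise g1 n1] noise_law elim(2) ..
    have mP: "(\<lambda>\<omega>'. (g (\<omega>', \<omega>), noise S (Suc t) \<omega>')) \<in> prb S \<rightarrow>\<^sub>M borel \<Otimes>\<^sub>M nsp S"
      using ind_section_measurable(2)[OF ind_pv_com g elim(3)] noise_measurable[of "Suc t"] by (intro measurable_Pair) auto
    have mF: "(\<lambda>(p, e). trans_fun S (fst p) (snd p) (\<kappa> \<omega>) e (common S (Suc t) \<omega>)) \<in> borel \<Otimes>\<^sub>M nsp S \<rightarrow>\<^sub>M borel"
      using P c unfolding case_prod_beta' by measurable
    have "Fhat (\<kappa> \<omega>) (common S (Suc t) \<omega>) = distr (prb S) borel (\<lambda>\<omega>'. h (\<omega>', \<omega>))"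
      unfolding Fhat_def pair[symmetric] by (subst distr_distr[OF mF mP]) (simp add: comp_def h_def)
    then show ?case using elim(1) by simp
  qed
qed

text \<open>The next common noise is independent of the past common noise, on which \<kappa>
  depends, so it may be averaged first.\<close>

lemma expectation_Fhat:
  assumes k: "\<kappa> \<in> com t \<rightarrow>\<^sub>M prob_algebra borel" and w: "good w"
  shows "(\<integral>\<omega>. w (Fhat (\<kappa> \<omega>) (common S (Suc t) \<omega>)) \<partial>prb S) = (\<integral>\<omega>. (\<integral>e0. w (Fhat (\<kappa> \<omega>) e0) \<partial>claw) \<partial>prb S)"
proof -
  note km = prb_of_com[OF k]
  have c1: "common S (Suc t) \<in> common_sigma S {Suc t} \<rightarrow>\<^sub>M csp S" by (rule common_com) auto
  have cm: "common S (Suc t) \<in> prb S \<rightarrow>\<^sub>M csp S" by (rule common_measurable) simp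
  have pr: "distr (prb S) (prob_algebra borel \<Otimes>\<^sub>M csp S) (\<lambda>\<omega>. (\<kappa> \<omega>, common S (Suc t) \<omega>)) = distr (prb S) (prob_algebra borel) \<kappa> \<Otimes>\<^sub>M claw"
    unfolding ind_pair_distr[OF ind_com_common k c1] common_law ..
  have f: "(\<lambda>(\<gamma>, e0). w (Fhat \<gamma> e0)) \<in> borel_measurable (prob_algebra borel \<Otimes>\<^sub>M csp S)"
    using measurable_compose[OF Fhat_measurable goodD(3)[OF w]] by (simp add: case_prod_beta')
  interpret A: prob_space "distr (prb S) (prob_algebra borel) \<kappa>" by (rule prob_space_distr[OF km])
  interpret cl: prob_space claw by (rule claw_prob)
  interpret P: pair_prob_space "distr (prb S) (prob_algebra borel) \<kappa>" claw ..
  have fm: "(\<lambda>p. w (Fhat (fst p) (snd p))) \<in> borel_measurable (distr (prb S) (prob_algebra borel) \<kappa> \<Otimes>\<^sub>M claw)"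
    using f by (simp add: case_prod_beta' cong: measurable_cong_sets sets_pair_measure_cong)
  have fi: "integrable (distr (prb S) (prob_algebra borel) \<kappa> \<Otimes>\<^sub>M claw) (\<lambda>p. w (Fhat (fst p) (snd p)))"
    using fm by (intro P.integrable_const_bound[of _ Rb] AE_I2) (auto simp: space_pair_measure intro!: goodD(2)[OF w] Fhat_Prob)
  have "(\<integral>\<omega>. w (Fhat (\<kappa> \<omega>) (common S (Suc t) \<omega>)) \<partial>prb S)
    = (\<integral>p. w (Fhat (fst p) (snd p)) \<partial>distr (prb S) (prob_algebra borel \<Otimes>\<^sub>M csp S) (\<lambda>\<omega>. (\<kappa> \<omega>, common S (Suc t) \<omega>)))"
    using f by (subst integral_distr[OF measurable_Pair[OF km cm]]) (simp_all add: case_prod_beta')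
  also have "\<dots> = (\<integral>\<gamma>. (\<integral>e0. w (Fhat \<gamma> e0) \<partial>claw) \<partial>distr (prb S) (prob_algebra borel) \<kappa>)"
    unfolding pr using P.integral_fst'[OF fi] by simp
  also have "\<dots> = (\<integral>\<omega>. (\<integral>e0. w (Fhat (\<kappa> \<omega>) e0) \<partial>claw) \<partial>prb S)"
  proof (rule integral_distr[OF km])
    have "(\<lambda>(\<gamma>, e0). w (Fhat \<gamma> e0)) \<in> borel_measurable (prob_algebra borel \<Otimes>\<^sub>M claw)"
      using f by (simp cong: measurable_cong_sets sets_pair_measure_cong)
    then show "(\<lambda>\<gamma>. \<integral>e0. w (Fhat \<gamma> e0) \<partial>claw) \<in> borel_measurable (prob_algebra borel)"
      by (rule cl.borel_measurable_lebesgue_integral)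
  qed
  finally show ?thesis .
qed

text \<open>Freezing the common noise fixes the measure argument of the reward; averaging over the
  rest integrates against that same law.\<close>

lemma expectation_reward:
  assumes g: "g \<in> pv I t \<Otimes>\<^sub>M com t \<rightarrow>\<^sub>M borel" and k: "\<kappa> \<in> com t \<rightarrow>\<^sub>M prob_algebra borel"
    and kg: "AE \<omega> in prb S. \<kappa> \<omega> = distr (prb S) borel (\<lambda>\<omega>'. g (\<omega>', \<omega>))"
  shows "(\<integral>\<omega>. reward S (fst (g (\<omega>, \<omega>))) (snd (g (\<omega>, \<omega>))) (\<kappa> \<omega>) \<partial>prb S) = (\<integral>\<omega>. fhat (\<kappa> \<omega>) \<partial>prb S)"
proof -
  note km = prb_of_com[OF k]
  have P: "\<kappa> \<omega> \<in> Prob" if "\<omega> \<in> Om" for \<omega> using measurable_space[OF k] that by simp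
  define r where "r p = reward S (fst (g p)) (snd (g p)) (\<kappa> (snd p))" for p
  have r: "r \<in> borel_measurable (pv I t \<Otimes>\<^sub>M com t)" unfolding r_def using g k by measurable
  have "(\<integral>\<omega>. r (\<omega>, \<omega>) \<partial>prb S) = (\<integral>\<omega>. (\<integral>\<omega>'. r (\<omega>', \<omega>) \<partial>prb S) \<partial>prb S)"
    by (rule ind_diag_integral[OF ind_pv_com r, of Cb]) (use reward_le_Cb P in \<open>auto simp: r_def\<close>)
  also have "\<dots> = (\<integral>\<omega>. fhat (\<kappa> \<omega>) \<partial>prb S)"
  proof (rule integral_cong_AE)
    show "(\<lambda>\<omega>. fhat (\<kappa> \<omega>)) \<in> borel_measurable (prb S)" by (rule measurable_compose[OF km fhat_measurable])
    have idp: "(\<lambda>\<omega>. \<omega>) \<in> prb S \<rightarrow>\<^sub>M pv I t" "(\<lambda>\<omega>. \<omega>) \<in> prb S \<rightarrow>\<^sub>M com t" using indD(6,7)[OF ind_pv_com] by auto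
    have "(\<lambda>p. (snd p, fst p)) \<in> prb S \<Otimes>\<^sub>M prb S \<rightarrow>\<^sub>M pv I t \<Otimes>\<^sub>M com t"
      by (intro measurable_Pair measurable_compose[OF measurable_fst idp(2)] measurable_compose[OF measurable_snd idp(1)])
    from measurable_compose[OF this r] have "(\<lambda>(\<omega>, \<omega>'). r (\<omega>', \<omega>)) \<in> borel_measurable (prb S \<Otimes>\<^sub>M prb S)"
      by (simp add: case_prod_beta')
    then show "(\<lambda>\<omega>. \<integral>\<omega>'. r (\<omega>', \<omega>) \<partial>prb S) \<in> borel_measurable (prb S)"
      by (rule borel_measurable_lebesgue_integral)
    show "AE \<omega> in prb S. (\<integral>\<omega>'. r (\<omega>', \<omega>) \<partial>prb S) = fhat (\<kappa> \<omega>)"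
      using kg AE_space
    proof eventually_elim
      case (elim \<omega>)
      have sec: "(\<lambda>\<omega>'. g (\<omega>', \<omega>)) \<in> prb S \<rightarrow>\<^sub>M borel" by (rule ind_section_measurable(2)[OF ind_pv_com g elim(2)])
      have rm: "(\<lambda>p. reward S (fst p) (snd p) (\<kappa> \<omega>)) \<in> borel_measurable borel" using P[OF elim(2)] by measurable
      have "(\<integral>\<omega>'. r (\<omega>', \<omega>) \<partial>prb S) = (\<integral>\<omega>'. reward S (fst (g (\<omega>', \<omega>))) (snd (g (\<omega>', \<omega>))) (\<kappa> \<omega>) \<partial>prb S)" by (simp add: r_def)
      also have "\<dots> = (\<integral>p. reward S (fst p) (snd p) (\<kappa> \<omega>) \<partial>distr (prb S) borel (\<lambda>\<omega>'. g (\<omega>', \<omega>)))"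
        by (rule integral_distr[OF sec rm, symmetric])
      also have "\<dots> = fhat (\<kappa> \<omega>)" unfolding elim(1)[symmetric] fhat_def ..
      finally show ?case .
    qed
  qed
  finally show ?thesis by (simp add: r_def)
qed

section \<open>Controlled paths and their gain\<close>

definition path_law where "path_law \<xi> \<alpha> t = cond_law S t (state S \<alpha> \<xi> t)"
definition joint_law where "joint_law \<xi> \<alpha> t = joint_cond_law S t (state S \<alpha> \<xi> t) (\<alpha> t)"
definition path_reward where "path_reward \<xi> \<alpha> t \<omega> = reward S (state S \<alpha> \<xi> t \<omega>) (\<alpha> t \<omega>) (joint_law \<xi> \<alpha> t \<omega>)"

lemma joint_cond_law_measurable:
  assumes X: "X \<in> fil {0..t} t \<rightarrow>\<^sub>M borel" and A: "A \<in> fil {0..t} t \<rightarrow>\<^sub>M borel"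
  shows "joint_cond_law S t X A \<in> com t \<rightarrow>\<^sub>M prob_algebra borel"
  unfolding joint_cond_law_def using X A by (intro cond_law_measurable[OF Pm.comp]) (rule borel_measurable_Pair)

text \<open>The new state uses randomization indices below \<open>Suc t\<close> only, so it is
  independent of the variable that will randomize the next action.\<close>

lemma step_measurable:
  assumes X: "X \<in> fil {0..t} t \<rightarrow>\<^sub>M borel" and A: "A \<in> fil {0..t} t \<rightarrow>\<^sub>M borel"
  shows "step S t X A \<in> fil {0..<Suc t} (Suc t) \<rightarrow>\<^sub>M borel"
proof -
  have up: "f \<in> fil {0..t} (Suc t) \<rightarrow>\<^sub>M N" if "f \<in> fil {0..t} t \<rightarrow>\<^sub>M N" for f :: "'w \<Rightarrow> 'n" and N
    by (rule measurable_from_subalg[OF fil_mono that]) auto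
  have [measurable]: "X \<in> fil {0..t} (Suc t) \<rightarrow>\<^sub>M borel" "A \<in> fil {0..t} (Suc t) \<rightarrow>\<^sub>M borel"
    "joint_cond_law S t X A \<in> fil {0..t} (Suc t) \<rightarrow>\<^sub>M prob_algebra borel"
    using up[OF X] up[OF A] up[OF fil_of_com[OF joint_cond_law_measurable[OF X A]]] by auto
  have [measurable]: "noise S (Suc t) \<in> fil {0..t} (Suc t) \<rightarrow>\<^sub>M nsp S" "common S (Suc t) \<in> fil {0..t} (Suc t) \<rightarrow>\<^sub>M csp S"
    by (rule fil_of_pv, rule noise_pv, simp, simp) (rule fil_of_com, rule common_com, simp, simp)
  have "(\<lambda>\<omega>. trans_fun S (X \<omega>) (A \<omega>) (joint_cond_law S t X A \<omega>) (noise S (Suc t) \<omega>) (common S (Suc t) \<omega>)) \<in> fil {0..t} (Suc t) \<rightarrow>\<^sub>M borel"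
    by measurable
  moreover have "{0..<Suc t} = {0..t}" by auto
  ultimately show ?thesis unfolding step_def by simp
qed

lemma initD:
  assumes "\<xi> \<in> initial_states S \<mu>"
  shows "\<xi> \<in> init S \<rightarrow>\<^sub>M borel" "distr (prb S) borel \<xi> = \<mu>" "\<xi> \<in> fil I 0 \<rightarrow>\<^sub>M borel"
  using assms fil_of_pv[OF init_pv] by (auto simp: initial_states_def)

lemma state_measurable:
  assumes \<alpha>: "\<alpha> \<in> controls S" and \<xi>: "\<xi> \<in> initial_states S \<mu>"
  shows "state S \<alpha> \<xi> t \<in> fil {0..t} t \<rightarrow>\<^sub>M borel" "\<alpha> t \<in> fil {0..t} t \<rightarrow>\<^sub>M borel"
proof -
  show \<alpha>m: "\<alpha> t \<in> fil {0..t} t \<rightarrow>\<^sub>M borel" for t using \<alpha> by (auto simp: controls_def measurable_filt)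
  show "state S \<alpha> \<xi> t \<in> fil {0..t} t \<rightarrow>\<^sub>M borel"
  proof (induction t)
    case 0
    show ?case using initD(3)[OF \<xi>] by simp
  next
    case (Suc t)
    have "state S \<alpha> \<xi> (Suc t) \<in> fil {0..<Suc t} (Suc t) \<rightarrow>\<^sub>M borel" using step_measurable[OF Suc \<alpha>m] by simp
    then show ?case by (rule measurable_from_subalg[OF fil_mono, rotated 2]) auto
  qed
qed

lemma initial_law:
  assumes \<xi>: "\<xi> \<in> initial_states S \<mu>"
  shows "AE \<omega> in prb S. cond_law S 0 \<xi> \<omega> = \<mu>"
proof -
  have g: "(\<lambda>p. \<xi> (fst p)) \<in> pv {} 0 \<Otimes>\<^sub>M com 0 \<rightarrow>\<^sub>M borel"
    by (rule measurable_compose[OF measurable_fst init_pv[OF initD(1)[OF \<xi>]]])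
  from cond_law_diag(2)[OF compact_state ind_pv_comall g, of \<xi>] show ?thesis by (simp add: initD(2)[OF \<xi>])
qed

text \<open>Together these say that, almost surely, the conditional laws follow the lifted decision
  process: the joint law projects to the current state law and determines the next one and the mean
  reward.\<close>

lemma path_step:
  assumes \<alpha>: "\<alpha> \<in> controls S" and \<xi>: "\<xi> \<in> initial_states S \<mu>"
  shows "joint_law \<xi> \<alpha> t \<in> com t \<rightarrow>\<^sub>M prob_algebra borel" "path_law \<xi> \<alpha> t \<in> com t \<rightarrow>\<^sub>M prob_algebra borel"
    "AE \<omega> in prb S. path_law \<xi> \<alpha> t \<omega> = pr1 (joint_law \<xi> \<alpha> t \<omega>)"
    "AE \<omega> in prb S. path_law \<xi> \<alpha> (Suc t) \<omega> = Fhat (joint_law \<xi> \<alpha> t \<omega>) (common S (Suc t) \<omega>)"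
    "(\<integral>\<omega>. path_reward \<xi> \<alpha> t \<omega> \<partial>prb S) = (\<integral>\<omega>. fhat (joint_law \<xi> \<alpha> t \<omega>) \<partial>prb S)"
proof -
  note m = state_measurable[OF \<alpha> \<xi>]
  show jm: "joint_law \<xi> \<alpha> t \<in> com t \<rightarrow>\<^sub>M prob_algebra borel" unfolding joint_law_def by (rule joint_cond_law_measurable[OF m])
  show "path_law \<xi> \<alpha> t \<in> com t \<rightarrow>\<^sub>M prob_algebra borel" unfolding path_law_def by (rule cond_law_measurable[OF compact_state m(1)])
  have pm: "(\<lambda>\<omega>. (state S \<alpha> \<xi> t \<omega>, \<alpha> t \<omega>)) \<in> fil {0..t} t \<rightarrow>\<^sub>M borel" using m by (rule borel_measurable_Pair)
  obtain g where g: "g \<in> pv {0..t} t \<Otimes>\<^sub>M com t \<rightarrow>\<^sub>M borel"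
    and gd: "\<And>\<omega>. \<omega> \<in> Om \<Longrightarrow> (state S \<alpha> \<xi> t \<omega>, \<alpha> t \<omega>) = g (\<omega>, \<omega>)"
    using fil_factor[OF Pm.comp pm] by blast
  have jg: "AE \<omega> in prb S. joint_law \<xi> \<alpha> t \<omega> = distr (prb S) borel (\<lambda>\<omega>'. g (\<omega>', \<omega>))"
    unfolding joint_law_def joint_cond_law_def by (rule cond_law_diag(2)[OF Pm.comp ind_pv_comall g gd])
  have g1: "(\<lambda>p. fst (g p)) \<in> pv {0..t} t \<Otimes>\<^sub>M com t \<rightarrow>\<^sub>M borel" using g by measurable
  have gs: "state S \<alpha> \<xi> t \<omega> = fst (g (\<omega>, \<omega>))" "\<alpha> t \<omega> = snd (g (\<omega>, \<omega>))" if "\<omega> \<in> Om" for \<omega>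
    using gd[OF that] by (metis fst_conv, metis snd_conv)
  have "AE \<omega> in prb S. path_law \<xi> \<alpha> t \<omega> = distr (prb S) borel (\<lambda>\<omega>'. fst (g (\<omega>', \<omega>)))"
    unfolding path_law_def by (rule cond_law_diag(2)[OF compact_state ind_pv_comall g1]) (rule gs)
  then show "AE \<omega> in prb S. path_law \<xi> \<alpha> t \<omega> = pr1 (joint_law \<xi> \<alpha> t \<omega>)"
    using jg AE_space
  proof eventually_elim
    case (elim \<omega>)
    have sec: "(\<lambda>\<omega>'. g (\<omega>', \<omega>)) \<in> prb S \<rightarrow>\<^sub>M borel" by (rule ind_section_measurable(2)[OF ind_pv_com g elim(3)])
    show ?case unfolding elim(1,2) pr1_def by (subst distr_distr[OF _ sec]) (auto simp: comp_def)
  qed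
  show "AE \<omega> in prb S. path_law \<xi> \<alpha> (Suc t) \<omega> = Fhat (joint_law \<xi> \<alpha> t \<omega>) (common S (Suc t) \<omega>)"
    unfolding path_law_def
    by (rule cond_law_step[OF g jm jg]) (simp add: step_def joint_law_def gs)
  have "(\<integral>\<omega>. path_reward \<xi> \<alpha> t \<omega> \<partial>prb S) = (\<integral>\<omega>. reward S (fst (g (\<omega>, \<omega>))) (snd (g (\<omega>, \<omega>))) (joint_law \<xi> \<alpha> t \<omega>) \<partial>prb S)"
    by (intro Bochner_Integration.integral_cong) (auto simp: path_reward_def gs)
  also have "\<dots> = (\<integral>\<omega>. fhat (joint_law \<xi> \<alpha> t \<omega>) \<partial>prb S)" by (rule expectation_reward[OF g jm jg])
  finally show "(\<integral>\<omega>. path_reward \<xi> \<alpha> t \<omega> \<partial>prb S) = (\<integral>\<omega>. fhat (joint_law \<xi> \<alpha> t \<omega>) \<partial>prb S)" .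
qed

lemma good_integrable_prb:
  assumes w: "good w" and k: "\<kappa> \<in> com t \<rightarrow>\<^sub>M prob_algebra borel"
  shows "integrable (prb S) (\<lambda>\<omega>. w (\<kappa> \<omega>))"
  using measurable_compose[OF prb_of_com[OF k] goodD(3)[OF w]] measurable_space[OF k]
  by (intro integrable_const_bound[of _ Rb] AE_I2) (auto intro!: goodD(2)[OF w])

lemma J_measurable: assumes w: "good w" shows "J w \<in> borel_measurable (prob_algebra borel)"
  using Pm.unif_cont_measurable[OF J_unif_cont[OF goodD(1)[OF w] goodD(2)[OF w]]] .

lemma J_integrable_prb:
  assumes w: "good w" and k: "\<kappa> \<in> com t \<rightarrow>\<^sub>M prob_algebra borel"
  shows "integrable (prb S) (\<lambda>\<omega>. J w (\<kappa> \<omega>))"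
  using measurable_compose[OF prb_of_com[OF k] J_measurable[OF w]] measurable_space[OF k]
  by (intro integrable_const_bound[of _ Rb] AE_I2) (auto intro!: J_bound[OF w])

lemma expectation_J:
  assumes w: "good w" and k: "\<kappa> \<in> com t \<rightarrow>\<^sub>M prob_algebra borel"
  shows "(\<integral>\<omega>. J w (\<kappa> \<omega>) \<partial>prb S) = (\<integral>\<omega>. fhat (\<kappa> \<omega>) \<partial>prb S) + disc S * (\<integral>\<omega>. w (Fhat (\<kappa> \<omega>) (common S (Suc t) \<omega>)) \<partial>prb S)"
proof -
  have f: "integrable (prb S) (\<lambda>\<omega>. fhat (\<kappa> \<omega>))"
    using measurable_compose[OF prb_of_com[OF k] fhat_measurable] measurable_space[OF k]
    by (intro integrable_const_bound[of _ Cb] AE_I2) (auto intro!: fhat_bound)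
  \<comment> \<open>Integrability of the inner average is read off from that of \<open>J\<close> by
    solving for it; the division is legitimate because the discount is positive.\<close>
  have "integrable (prb S) (\<lambda>\<omega>. (J w (\<kappa> \<omega>) - fhat (\<kappa> \<omega>)) / disc S)"
    using f J_integrable_prb[OF w k] by auto
  then have i: "integrable (prb S) (\<lambda>\<omega>. \<integral>e0. w (Fhat (\<kappa> \<omega>) e0) \<partial>claw)" using disc by (simp add: J_def)
  show ?thesis unfolding expectation_Fhat[OF k w] J_def using f i by simp
qed

lemma path_bellman:
  assumes \<alpha>: "\<alpha> \<in> controls S" and \<xi>: "\<xi> \<in> initial_states S \<mu>" and w: "good w"
  shows "(\<integral>\<omega>. path_reward \<xi> \<alpha> t \<omega> \<partial>prb S) + disc S * (\<integral>\<omega>. w (path_law \<xi> \<alpha> (Suc t) \<omega>) \<partial>prb S) = (\<integral>\<omega>. J w (joint_law \<xi> \<alpha> t \<omega>) \<partial>prb S)"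
proof -
  note p = path_step[OF \<alpha> \<xi>, of t] and pS = path_step[OF \<alpha> \<xi>, of "Suc t"]
  have "(\<integral>\<omega>. w (path_law \<xi> \<alpha> (Suc t) \<omega>) \<partial>prb S) = (\<integral>\<omega>. w (Fhat (joint_law \<xi> \<alpha> t \<omega>) (common S (Suc t) \<omega>)) \<partial>prb S)"
  proof (rule integral_cong_AE)
    show "(\<lambda>\<omega>. w (path_law \<xi> \<alpha> (Suc t) \<omega>)) \<in> borel_measurable (prb S)" using good_integrable_prb[OF w pS(2)] by auto
    have c: "common S (Suc t) \<in> prb S \<rightarrow>\<^sub>M csp S" by (rule common_measurable) simp
    show "(\<lambda>\<omega>. w (Fhat (joint_law \<xi> \<alpha> t \<omega>) (common S (Suc t) \<omega>))) \<in> borel_measurable (prb S)"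
      using measurable_compose[OF measurable_compose[OF measurable_Pair[OF prb_of_com[OF p(1)] c] Fhat_measurable] goodD(3)[OF w]] by simp
  qed (use p(4) in eventually_elim, simp)
  then show ?thesis unfolding expectation_J[OF w p(1)] p(5) by simp
qed

lemma path_reward_props:
  assumes \<alpha>: "\<alpha> \<in> controls S" and \<xi>: "\<xi> \<in> initial_states S \<mu>"
  shows "path_reward \<xi> \<alpha> t \<in> borel_measurable (prb S)" "\<omega> \<in> Om \<Longrightarrow> \<bar>path_reward \<xi> \<alpha> t \<omega>\<bar> \<le> Cb" "integrable (prb S) (path_reward \<xi> \<alpha> t)"
proof -
  note j = path_step(1)[OF \<alpha> \<xi>, of t]
  show 1: "path_reward \<xi> \<alpha> t \<in> borel_measurable (prb S)"
    unfolding path_reward_def using state_measurable[OF \<alpha> \<xi>, of t, THEN prb_of_fil] prb_of_com[OF j] by measurable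
  show 2: "\<bar>path_reward \<xi> \<alpha> t \<omega>\<bar> \<le> Cb" if "\<omega> \<in> Om" for \<omega>
    unfolding path_reward_def by (rule reward_le_Cb) (use measurable_space[OF j, of \<omega>] that in simp)
  show "integrable (prb S) (path_reward \<xi> \<alpha> t)" using 1 2 by (intro integrable_const_bound[of _ Cb] AE_I2) auto
qed

lemma gain_sums:
  assumes \<alpha>: "\<alpha> \<in> controls S" and \<xi>: "\<xi> \<in> initial_states S \<mu>"
  shows "(\<lambda>t. disc S ^ t * (\<integral>\<omega>. path_reward \<xi> \<alpha> t \<omega> \<partial>prb S)) sums gain S \<alpha> \<xi>"
proof -
  note r = path_reward_props[OF \<alpha> \<xi>]
  let ?f = "\<lambda>t \<omega>. disc S ^ t * path_reward \<xi> \<alpha> t \<omega>"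
  have d: "0 \<le> disc S" "disc S < 1" using disc by auto
  have le: "\<bar>?f t \<omega>\<bar> \<le> disc S ^ t * Cb" if "\<omega> \<in> Om" for t \<omega>
    using r(2)[OF that] d by (auto simp: abs_mult intro!: mult_left_mono)
  have geo: "summable (\<lambda>t. disc S ^ t * Cb)" using d by (intro summable_mult2 summable_geometric) auto
  have int: "integrable (prb S) (?f t)" for t using r(3) by auto
  have "(\<lambda>t. \<integral>\<omega>. ?f t \<omega> \<partial>prb S) sums (\<integral>\<omega>. (\<Sum>t. ?f t \<omega>) \<partial>prb S)"
  proof (rule sums_integral[OF int])
    show "AE \<omega> in prb S. summable (\<lambda>t. norm (?f t \<omega>))"
      using AE_space by eventually_elim (rule summable_comparison_test'[OF geo, of 0], use le in auto)
    show "summable (\<lambda>t. \<integral>\<omega>. norm (?f t \<omega>) \<partial>prb S)"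
    proof (rule summable_comparison_test'[OF geo, of 0])
      fix t
      have "(\<integral>\<omega>. norm (?f t \<omega>) \<partial>prb S) \<le> (\<integral>\<omega>. disc S ^ t * Cb \<partial>prb S)"
        using int le by (intro integral_mono) auto
      then show "norm (\<integral>\<omega>. norm (?f t \<omega>) \<partial>prb S) \<le> disc S ^ t * Cb"
        by (simp add: prob_space Bochner_Integration.integral_nonneg)
    qed
  qed
  then show ?thesis by (simp add: gain_def path_reward_def joint_law_def)
qed

text \<open>Telescoping the one-step inequality for the value along the path.\<close>
lemma gain_le_fixpoint:
  assumes \<alpha>: "\<alpha> \<in> controls S" and \<xi>: "\<xi> \<in> initial_states S \<mu>" and w: "good w"
    and le: "\<And>\<gamma>. \<gamma> \<in> Prob \<Longrightarrow> J w \<gamma> \<le> w (pr1 \<gamma>)"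
  shows "gain S \<alpha> \<xi> \<le> w \<mu>"
    and "(\<And>t. AE \<omega> in prb S. J w (joint_law \<xi> \<alpha> t \<omega>) = w (path_law \<xi> \<alpha> t \<omega>)) \<Longrightarrow> gain S \<alpha> \<xi> = w \<mu>"
proof -
  note p = path_step[OF \<alpha> \<xi>]
  have d: "0 \<le> disc S" "disc S < 1" using disc by auto
  define e where "e t = (\<integral>\<omega>. path_reward \<xi> \<alpha> t \<omega> \<partial>prb S)" for t
  define v where "v t = (\<integral>\<omega>. w (path_law \<xi> \<alpha> t \<omega>) \<partial>prb S)" for t
  define j where "j t = (\<integral>\<omega>. J w (joint_law \<xi> \<alpha> t \<omega>) \<partial>prb S)" for t
  \<comment> \<open>The one-step identity solved for the mean reward, in the form that
    telescopes.\<close>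
  have ej: "e t = j t - disc S * v (Suc t)" for t
    using path_bellman[OF \<alpha> \<xi> w, of t] by (simp add: e_def v_def j_def)
  have jv: "j t \<le> v t" for t
    unfolding j_def v_def
  proof (rule integral_mono_AE[OF J_integrable_prb[OF w p(1)] good_integrable_prb[OF w p(2)]])
    show "AE \<omega> in prb S. J w (joint_law \<xi> \<alpha> t \<omega>) \<le> w (path_law \<xi> \<alpha> t \<omega>)"
      using p(3)[of t] AE_space
    proof eventually_elim
      case (elim \<omega>)
      have "joint_law \<xi> \<alpha> t \<omega> \<in> Prob" using measurable_space[OF p(1)] elim(2) by simp
      from le[OF this] elim(1) show ?case by simp
    qed
  qed
  have v0: "v 0 = w \<mu>"
  proof -
    have "v 0 = (\<integral>\<omega>. w \<mu> \<partial>prb S)"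
      unfolding v_def
    proof (rule integral_cong_AE)
      show "(\<lambda>\<omega>. w (path_law \<xi> \<alpha> 0 \<omega>)) \<in> borel_measurable (prb S)" using good_integrable_prb[OF w p(2)] by auto
      show "AE \<omega> in prb S. w (path_law \<xi> \<alpha> 0 \<omega>) = w \<mu>" using initial_law[OF \<xi>] by eventually_elim (simp add: path_law_def)
    qed simp
    then show ?thesis by (simp add: prob_space)
  qed
  have vb: "\<bar>v t\<bar> \<le> Rb" for t
  proof -
    have "\<bar>v t\<bar> \<le> (\<integral>\<omega>. \<bar>w (path_law \<xi> \<alpha> t \<omega>)\<bar> \<partial>prb S)" unfolding v_def by (rule integral_abs_bound)
    also have "\<dots> \<le> (\<integral>\<omega>. Rb \<partial>prb S)"
      using good_integrable_prb[OF w p(2)[of t]] measurable_space[OF p(2)[of t]]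
      by (intro integral_mono) (auto intro!: goodD(2)[OF w])
    finally show ?thesis by (simp add: prob_space)
  qed
  \<comment> \<open>The remainder of the telescoping sum: mean values stay bounded by
    \<open>Rb\<close> while the discount factors vanish.\<close>
  have vlim: "(\<lambda>n. disc S ^ n * v n) \<longlonglongrightarrow> 0"
  proof (rule Lim_null_comparison)
    show "\<forall>\<^sub>F n in sequentially. norm (disc S ^ n * v n) \<le> disc S ^ n * Rb"
      using vb d by (intro always_eventually allI) (auto simp: abs_mult intro!: mult_left_mono)
    show "(\<lambda>n. disc S ^ n * Rb) \<longlonglongrightarrow> 0"
      using tendsto_mult[OF LIMSEQ_power_zero[of "disc S"] tendsto_const[of Rb]] d by simp
  qed
  have lim: "(\<lambda>n. \<Sum>t<n. disc S ^ t * e t) \<longlonglongrightarrow> gain S \<alpha> \<xi>"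
    using gain_sums[OF \<alpha> \<xi>] unfolding sums_def e_def .
  have rhs: "(\<lambda>n. w \<mu> - disc S ^ n * v n) \<longlonglongrightarrow> w \<mu>" using tendsto_diff[OF tendsto_const vlim] by simp
  have part: "(\<Sum>t<n. disc S ^ t * e t) \<le> w \<mu> - disc S ^ n * v n" for n
  proof (induction n)
    case (Suc n)
    have "disc S ^ n * e n \<le> disc S ^ n * (v n - disc S * v (Suc n))"
      using jv[of n] d unfolding ej by (intro mult_left_mono) auto
    with Suc show ?case by (simp add: algebra_simps)
  qed (simp add: v0)
  show "gain S \<alpha> \<xi> \<le> w \<mu>" by (rule LIMSEQ_le[OF lim rhs]) (use part in auto)
  show "gain S \<alpha> \<xi> = w \<mu>" if eq: "\<And>t. AE \<omega> in prb S. J w (joint_law \<xi> \<alpha> t \<omega>) = w (path_law \<xi> \<alpha> t \<omega>)"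
  proof -
    have jv': "j t = v t" for t unfolding j_def v_def
      using J_integrable_prb[OF w p(1)[of t]] good_integrable_prb[OF w p(2)[of t]] eq[of t] by (intro integral_cong_AE) auto
    have "(\<Sum>t<n. disc S ^ t * e t) = w \<mu> - disc S ^ n * v n" for n
      by (induction n) (simp_all add: v0 ej jv' algebra_simps)
    with lim have "(\<lambda>n. w \<mu> - disc S ^ n * v n) \<longlonglongrightarrow> gain S \<alpha> \<xi>" by simp
    with rhs show ?thesis by (metis LIMSEQ_unique)
  qed
qed

section \<open>Randomized feedback\<close>

definition rlaw :: "('x measure \<times> 'x \<times> real \<Rightarrow> 'a) \<Rightarrow> 'x measure \<Rightarrow> ('x \<times> 'a) measure" where
  "rlaw \<aa> \<mu> = distr (\<mu> \<Otimes>\<^sub>M unif) borel (\<lambda>(x, u). (x, \<aa> (\<mu>, x, u)))"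

lemma prob_algebra_to_wass: "f \<in> M \<rightarrow>\<^sub>M prob_algebra borel \<Longrightarrow> f \<in> M \<rightarrow>\<^sub>M wass_borel (dist :: 'x \<Rightarrow> 'x \<Rightarrow> real)"
  using measurable_cong_sets[OF refl Xm.sets_wass_borel_eq, of M] by blast

text \<open>The index set \<open>{0..<t}\<close> excludes \<open>t\<close>, so \<open>X\<close> is
  independent of \<open>rnd S t\<close> and the pair has law
  \<open>\<mu> \<Otimes>\<^sub>M unif\<close>.\<close>

lemma rnd_pair_law:
  assumes X: "X \<in> pv {0..<t} t \<rightarrow>\<^sub>M borel" and P: "distr (prb S) borel X = \<mu>"
    and am: "\<aa> \<in> wass_borel dist \<Otimes>\<^sub>M borel \<Otimes>\<^sub>M unif \<rightarrow>\<^sub>M borel" and \<mu>: "\<mu> \<in> Prob"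
  shows "distr (prb S) borel (\<lambda>\<omega>. (X \<omega>, \<aa> (\<mu>, X \<omega>, rnd S t \<omega>))) = rlaw \<aa> \<mu>"
proof -
  have r1: "rnd S t \<in> rnd_sigma S {t} \<rightarrow>\<^sub>M unif"
    unfolding rnd_sigma_def by (rule gen_sigma_measurable) (use measurable_space[OF rnd_measurable] in \<open>auto simp del: space_unif\<close>)
  have pair: "distr (prb S) (borel \<Otimes>\<^sub>M unif) (\<lambda>\<omega>. (X \<omega>, rnd S t \<omega>)) = \<mu> \<Otimes>\<^sub>M unif"
    unfolding ind_pair_distr[OF ind_pv_rnd X r1] P rnd_uniform ..
  have mP: "(\<lambda>\<omega>. (X \<omega>, rnd S t \<omega>)) \<in> prb S \<rightarrow>\<^sub>M borel \<Otimes>\<^sub>M unif"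
    using measurable_from_subalg[OF sub_pv X] rnd_measurable by (rule measurable_Pair)
  have s: "\<mu> \<in> space (wass_borel dist)" using \<mu> by simp
  have "(\<lambda>p. \<aa> (\<mu>, fst p, snd p)) \<in> borel \<Otimes>\<^sub>M unif \<rightarrow>\<^sub>M borel"
    using measurable_compose[OF measurable_Pair1'[OF s] am] by simp
  then have mF: "(\<lambda>(x, u). (x, \<aa> (\<mu>, x, u))) \<in> borel \<Otimes>\<^sub>M unif \<rightarrow>\<^sub>M borel"
    unfolding case_prod_beta' by (intro borel_measurable_Pair) auto
  show ?thesis unfolding rlaw_def pair[symmetric] by (subst distr_distr[OF mF mP]) (simp add: comp_def)
qed

text \<open>State and action alternate: the state is known before the current randomization is
  drawn, the action just after it. The conditional law fed into the policy is a function of the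
  common noise up to \<open>t\<close>, so adaptedness is exact.\<close>

lemma feedback_measurable:
  assumes \<xi>: "\<xi> \<in> initial_states S \<mu>" and am: "\<aa> \<in> wass_borel dist \<Otimes>\<^sub>M borel \<Otimes>\<^sub>M unif \<rightarrow>\<^sub>M borel"
  shows "feedback_state S \<aa> \<xi> t \<in> fil {0..<t} t \<rightarrow>\<^sub>M borel" "feedback_control S \<aa> \<xi> t \<in> fil {0..t} t \<rightarrow>\<^sub>M borel"
proof -
  have act: "feedback_action S \<aa> t X \<in> fil {0..t} t \<rightarrow>\<^sub>M borel" if X: "X \<in> fil {0..t} t \<rightarrow>\<^sub>M borel" for X t
  proof -
    have c: "cond_law S t X \<in> fil {0..t} t \<rightarrow>\<^sub>M wass_borel dist"
      by (rule prob_algebra_to_wass[OF fil_of_com[OF cond_law_measurable[OF compact_state X]]])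
    have r: "rnd S t \<in> fil {0..t} t \<rightarrow>\<^sub>M unif" by (rule fil_of_pv[OF rnd_pv]) simp
    from measurable_compose[OF measurable_Pair[OF c measurable_Pair[OF X r]] am] show ?thesis
      unfolding feedback_action_def[abs_def] .
  qed
  have up: "X \<in> fil {0..t} t \<rightarrow>\<^sub>M borel" if "X \<in> fil {0..<t} t \<rightarrow>\<^sub>M borel" for X :: "'w \<Rightarrow> 'x" and t
    by (rule measurable_from_subalg[OF fil_mono that]) auto
  show st: "feedback_state S \<aa> \<xi> t \<in> fil {0..<t} t \<rightarrow>\<^sub>M borel" for t
  proof (induction t)
    case 0
    show ?case using initD(3)[OF \<xi>] by simp
  next
    case (Suc t)
    show ?case using step_measurable[OF up[OF Suc] act[OF up[OF Suc]]] by simp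
  qed
  show "feedback_control S \<aa> \<xi> t \<in> fil {0..t} t \<rightarrow>\<^sub>M borel"
    unfolding feedback_control_def by (rule act[OF up[OF st]])
qed

lemma feedback_joint_law:
  assumes \<xi>: "\<xi> \<in> initial_states S \<mu>" and am: "\<aa> \<in> wass_borel dist \<Otimes>\<^sub>M borel \<Otimes>\<^sub>M unif \<rightarrow>\<^sub>M borel"
  shows "AE \<omega> in prb S. joint_law \<xi> (feedback_control S \<aa> \<xi>) t \<omega> = rlaw \<aa> (path_law \<xi> (feedback_control S \<aa> \<xi>) t \<omega>)"
proof -
  define X where "X = feedback_state S \<aa> \<xi> t"
  define L where "L = cond_law S t X"
  have Xm: "X \<in> fil {0..<t} t \<rightarrow>\<^sub>M borel" unfolding X_def by (rule feedback_measurable(1)[OF \<xi> am])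
  obtain g where g: "g \<in> pv {0..<t} t \<Otimes>\<^sub>M com t \<rightarrow>\<^sub>M borel" and gd: "\<And>\<omega>. \<omega> \<in> Om \<Longrightarrow> X \<omega> = g (\<omega>, \<omega>)"
    using fil_factor[OF compact_state Xm] by blast
  have Lm: "L \<in> com t \<rightarrow>\<^sub>M prob_algebra borel" unfolding L_def by (rule cond_law_measurable[OF compact_state Xm])
  have Lg: "AE \<omega> in prb S. L \<omega> = distr (prb S) borel (\<lambda>\<omega>'. g (\<omega>', \<omega>))"
    unfolding L_def by (rule cond_law_diag(2)[OF compact_state ind_pv_comall g gd])
  define h where "h p = (g p, \<aa> (L (snd p), g p, rnd S t (fst p)))" for p
  have idA: "(\<lambda>\<omega>. \<omega>) \<in> pv {0..t} t \<rightarrow>\<^sub>M pv {0..<t} t"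
    by (rule measurable_from_subalg[OF pv_mono[where I = "{0..<t}" and I' = "{0..t}" and s = t and t = t]]) auto
  have idP: "(\<lambda>p. (fst p, snd p)) \<in> pv {0..t} t \<Otimes>\<^sub>M com t \<rightarrow>\<^sub>M pv {0..<t} t \<Otimes>\<^sub>M com t"
    by (intro measurable_Pair measurable_compose[OF measurable_fst idA] measurable_snd)
  have g': "g \<in> pv {0..t} t \<Otimes>\<^sub>M com t \<rightarrow>\<^sub>M borel" using measurable_compose[OF idP g] by simp
  have l': "(\<lambda>p. L (snd p)) \<in> pv {0..t} t \<Otimes>\<^sub>M com t \<rightarrow>\<^sub>M wass_borel dist"
    by (rule measurable_compose[OF measurable_snd prob_algebra_to_wass[OF Lm]])
  have r': "(\<lambda>p. rnd S t (fst p)) \<in> pv {0..t} t \<Otimes>\<^sub>M com t \<rightarrow>\<^sub>M unif"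
    by (rule measurable_compose[OF measurable_fst rnd_pv]) simp
  have h: "h \<in> pv {0..t} t \<Otimes>\<^sub>M com t \<rightarrow>\<^sub>M borel"
    unfolding h_def using measurable_compose[OF measurable_Pair[OF l' measurable_Pair[OF g' r']] am] g'
    by (intro borel_measurable_Pair)
  have "AE \<omega> in prb S. cond_law S t (\<lambda>\<omega>. (X \<omega>, feedback_action S \<aa> t X \<omega>)) \<omega> = distr (prb S) borel (\<lambda>\<omega>'. h (\<omega>', \<omega>))"
    by (rule cond_law_diag(2)[OF Pm.comp ind_pv_comall h]) (simp add: h_def gd feedback_action_def L_def)
  then have "AE \<omega> in prb S. cond_law S t (\<lambda>\<omega>. (X \<omega>, feedback_action S \<aa> t X \<omega>)) \<omega> = rlaw \<aa> (L \<omega>)"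
    using Lg AE_space
  proof eventually_elim
    case (elim \<omega>)
    have "L \<omega> \<in> Prob" using measurable_space[OF Lm] elim(3) by simp
    from rnd_pair_law[OF ind_section_measurable(1)[OF ind_pv_com g elim(3)] elim(2)[symmetric] am this]
    show ?case unfolding elim(1) h_def by simp
  qed
  then show ?thesis
    unfolding joint_law_def path_law_def joint_cond_law_def state_feedback_control
    by (simp add: feedback_control_def X_def L_def)
qed

lemma initial_states_nonempty: "\<mu> \<in> Prob \<Longrightarrow> \<exists>\<xi>. \<xi> \<in> initial_states S \<mu>"
  using init_rich[of \<mu>] by (auto simp: initial_states_def)

lemma on_law_eq:
  assumes "\<mu> \<in> Prob" "\<And>\<xi>. \<xi> \<in> initial_states S \<mu> \<Longrightarrow> \<Phi> \<xi> = v"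
  shows "on_law S \<Phi> \<mu> = v"
  unfolding on_law_def using initial_states_nonempty[OF assms(1)] assms(2) by (intro the_equality) auto

text \<open>At time 0 the joint law is deterministic, so the one-step transition applies with a
  constant kernel, and the Bellman operator becomes the lifted objective at the law realized by the
  policy.\<close>

lemma bellman_at_eq:
  assumes \<xi>: "\<xi> \<in> initial_states S \<mu>" and \<mu>: "\<mu> \<in> Prob" and am: "\<aa> \<in> wass_borel dist \<Otimes>\<^sub>M borel \<Otimes>\<^sub>M unif \<rightarrow>\<^sub>M borel"
    and w: "good w" and V: "\<And>\<mu>. \<mu> \<in> Prob \<Longrightarrow> V \<mu> = w \<mu>"
  shows "bellman_at S (\<lambda>x u. \<aa> (\<mu>, x, u)) V \<xi> = J w (rlaw \<aa> \<mu>)"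
proof -
  define A where "A \<omega> = \<aa> (\<mu>, \<xi> \<omega>, rnd S 0 \<omega>)" for \<omega>
  define L where "L = distr (prb S) borel (\<lambda>\<omega>. (\<xi> \<omega>, A \<omega>))"
  define Y where "Y \<omega> = trans_fun S (\<xi> \<omega>) (A \<omega>) L (noise S 1 \<omega>) (common S 1 \<omega>)" for \<omega>
  have \<xi>p: "\<xi> \<in> pv I 0 \<rightarrow>\<^sub>M borel" for I by (rule init_pv[OF initD(1)[OF \<xi>]])
  have L: "L = rlaw \<aa> \<mu>" unfolding L_def A_def by (rule rnd_pair_law[OF \<xi>p initD(2)[OF \<xi>] am \<mu>])
  have s: "(\<lambda>_. \<mu>) \<in> pv {0..0} 0 \<rightarrow>\<^sub>M wass_borel dist" using \<mu> by (intro measurable_const) simp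
  have r: "rnd S 0 \<in> pv {0..0} 0 \<rightarrow>\<^sub>M unif" by (rule rnd_pv) simp
  have Am: "A \<in> pv {0..0} 0 \<rightarrow>\<^sub>M borel"
    unfolding A_def using measurable_compose[OF measurable_Pair[OF s measurable_Pair[OF \<xi>p r]] am] by simp
  have pm: "(\<lambda>\<omega>. (\<xi> \<omega>, A \<omega>)) \<in> pv {0..0} 0 \<rightarrow>\<^sub>M borel" using \<xi>p Am by (rule borel_measurable_Pair)
  have LP: "L \<in> Prob" unfolding L_def by (rule Prob_distr[OF prob_space_axioms measurable_from_subalg[OF sub_pv pm]])
  define g where "g p = (\<xi> (fst p), A (fst p))" for p :: "'w \<times> 'w"
  have g: "g \<in> pv {0..0} 0 \<Otimes>\<^sub>M com 0 \<rightarrow>\<^sub>M borel" unfolding g_def by (rule measurable_compose[OF measurable_fst pm])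
  have k: "(\<lambda>_. L) \<in> com 0 \<rightarrow>\<^sub>M prob_algebra borel" using LP by (rule measurable_const)
  have kg: "AE \<omega> in prb S. L = distr (prb S) borel (\<lambda>\<omega>'. g (\<omega>', \<omega>))" by (simp add: g_def L_def)
  have step: "AE \<omega> in prb S. cond_law S (Suc 0) Y \<omega> = Fhat L (common S (Suc 0) \<omega>)"
    by (rule cond_law_step[OF g k kg]) (simp add: Y_def g_def)
  have rew: "(\<integral>\<omega>. reward S (\<xi> \<omega>) (A \<omega>) L \<partial>prb S) = fhat L"
    using expectation_reward[OF g k kg] by (simp add: g_def prob_space)
  have ri: "integrable (prb S) (\<lambda>\<omega>. reward S (\<xi> \<omega>) (A \<omega>) L)"
    by (rule reward_integrable[OF LP prob_space_axioms measurable_from_subalg[OF sub_pv \<xi>p] measurable_from_subalg[OF sub_pv Am]])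
  define h where "h p = trans_fun S (\<xi> (fst p)) (A (fst p)) L (noise S (Suc 0) (fst p)) (common S (Suc 0) (snd p))" for p :: "'w \<times> 'w"
  have c: "common S (Suc 0) \<in> prb S \<rightarrow>\<^sub>M csp S" by (rule common_measurable) simp
  have Ym: "Y \<in> fil {0..0} 1 \<rightarrow>\<^sub>M borel"
  proof -
    have u: "f \<in> fil {0..0} 1 \<rightarrow>\<^sub>M N" if "f \<in> pv {0..0} 0 \<rightarrow>\<^sub>M N" for f :: "'w \<Rightarrow> 'n" and N
      by (rule fil_of_pv, rule measurable_from_subalg[OF pv_mono that]) auto
    have [measurable]: "\<xi> \<in> fil {0..0} 1 \<rightarrow>\<^sub>M borel" "A \<in> fil {0..0} 1 \<rightarrow>\<^sub>M borel" using u[OF \<xi>p] u[OF Am] by auto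
    have [measurable]: "noise S 1 \<in> fil {0..0} 1 \<rightarrow>\<^sub>M nsp S" "common S 1 \<in> fil {0..0} 1 \<rightarrow>\<^sub>M csp S"
      by (rule fil_of_pv, rule noise_pv, simp, simp) (rule fil_of_com, rule common_com, simp, simp)
    show ?thesis unfolding Y_def using LP by measurable
  qed
  have cm: "cond_law S 1 Y \<in> com 1 \<rightarrow>\<^sub>M prob_algebra borel" by (rule cond_law_measurable[OF compact_state Ym])
  \<comment> \<open>\<open>V\<close> is known to equal \<open>w\<close> on \<open>Prob\<close> only.
    The conditional law takes values there at every point, so it can be replaced before any
    measurability of the integrand is used.\<close>
  have Vw: "(\<integral>\<omega>. reward S (\<xi> \<omega>) (A \<omega>) L + disc S * V (cond_law S 1 Y \<omega>) \<partial>prb S)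
    = (\<integral>\<omega>. reward S (\<xi> \<omega>) (A \<omega>) L + disc S * w (cond_law S 1 Y \<omega>) \<partial>prb S)"
    using measurable_space[OF cm] by (intro Bochner_Integration.integral_cong) (auto simp: V)
  have wi: "integrable (prb S) (\<lambda>\<omega>. w (cond_law S 1 Y \<omega>))" by (rule good_integrable_prb[OF w cm])
  have "(\<integral>\<omega>. w (cond_law S 1 Y \<omega>) \<partial>prb S) = (\<integral>\<omega>. w (Fhat L (common S (Suc 0) \<omega>)) \<partial>prb S)"
  proof (rule integral_cong_AE)
    show "(\<lambda>\<omega>. w (cond_law S 1 Y \<omega>)) \<in> borel_measurable (prb S)" using wi by auto
    show "(\<lambda>\<omega>. w (Fhat L (common S (Suc 0) \<omega>))) \<in> borel_measurable (prb S)"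
      using measurable_compose[OF measurable_compose[OF measurable_Pair[OF measurable_const[OF LP] c] Fhat_measurable] goodD(3)[OF w]] by simp
  qed (use step in eventually_elim, simp)
  then have "(\<integral>\<omega>. reward S (\<xi> \<omega>) (A \<omega>) L + disc S * V (cond_law S 1 Y \<omega>) \<partial>prb S) = J w L"
    unfolding Vw using ri wi rew expectation_J[OF w k] by (simp add: prob_space)
  then show ?thesis by (simp only: bellman_at_def Let_def A_def[symmetric] L_def[symmetric] Y_def[symmetric] L[symmetric])
qed

theorem optimal_feedback:
  "\<exists>\<aa> \<in> wass_borel dist \<Otimes>\<^sub>M borel \<Otimes>\<^sub>M unif \<rightarrow>\<^sub>M borel.
     (\<forall>\<mu>\<in>Prob. bellman S (\<lambda>x u. \<aa> (\<mu>, x, u)) (value_law S) \<mu> = value_law S \<mu>) \<and>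
     (\<forall>\<mu>\<^sub>0\<in>Prob. \<forall>\<xi>\<^sub>0\<in>initial_states S \<mu>\<^sub>0.
        feedback_control S \<aa> \<xi>\<^sub>0 \<in> controls S \<and>
        gain S (feedback_control S \<aa> \<xi>\<^sub>0) \<xi>\<^sub>0 = value_law S \<mu>\<^sub>0)"
proof -
  obtain W \<aa> where gW: "good W" and le: "\<And>\<gamma>. \<gamma> \<in> Prob \<Longrightarrow> J W \<gamma> \<le> W (pr1 \<gamma>)"
    and am: "\<aa> \<in> wass_borel dist \<Otimes>\<^sub>M borel \<Otimes>\<^sub>M unif \<rightarrow>\<^sub>M borel"
    and opt: "\<And>\<mu>. \<mu> \<in> Prob \<Longrightarrow> J W (rlaw \<aa> \<mu>) = W \<mu>"
    using optimal_randomization unfolding rlaw_def by blast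
  have fc: "feedback_control S \<aa> \<xi> \<in> controls S" if \<xi>: "\<xi> \<in> initial_states S \<mu>" for \<xi> \<mu>
    using feedback_measurable(2)[OF \<xi> am] by (auto simp: controls_def measurable_filt)
  have fg: "gain S (feedback_control S \<aa> \<xi>) \<xi> = W \<mu>" if \<xi>: "\<xi> \<in> initial_states S \<mu>" for \<xi> \<mu>
  proof (rule gain_le_fixpoint(2)[OF fc[OF \<xi>] \<xi> gW le])
    fix t
    show "AE \<omega> in prb S. J W (joint_law \<xi> (feedback_control S \<aa> \<xi>) t \<omega>) = W (path_law \<xi> (feedback_control S \<aa> \<xi>) t \<omega>)"
      using feedback_joint_law[OF \<xi> am, of t] AE_space
    proof eventually_elim
      case (elim \<omega>)
      have "path_law \<xi> (feedback_control S \<aa> \<xi>) t \<omega> \<in> Prob"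
        using measurable_space[OF path_step(2)[OF fc[OF \<xi>] \<xi>]] elim(2) by simp
      from opt[OF this] elim(1) show ?case by simp
    qed
  qed
  \<comment> \<open>The bound valid for all controls is reached by the feedback, so the supremum is
    a maximum. Its value depends on the initial state only through the law, which determines
    \<open>value_law\<close>.\<close>
  have va: "value_at S \<xi> = W \<mu>" if \<xi>: "\<xi> \<in> initial_states S \<mu>" for \<xi> \<mu>
    unfolding value_at_def
  proof (rule cSup_eq_maximum)
    show "W \<mu> \<in> (\<lambda>\<alpha>. gain S \<alpha> \<xi>) ` controls S" using fg[OF \<xi>] fc[OF \<xi>] by (metis image_eqI)
    show "x \<le> W \<mu>" if "x \<in> (\<lambda>\<alpha>. gain S \<alpha> \<xi>) ` controls S" for x
      using that gain_le_fixpoint(1)[OF _ \<xi> gW le] by auto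
  qed
  have vl: "value_law S \<mu> = W \<mu>" if "\<mu> \<in> Prob" for \<mu>
    unfolding value_law_def by (rule on_law_eq[OF that va])
  show ?thesis
  proof (intro bexI[OF _ am] conjI ballI)
    fix \<mu> :: "'x measure" assume P: "\<mu> \<in> Prob"
    show "bellman S (\<lambda>x u. \<aa> (\<mu>, x, u)) (value_law S) \<mu> = value_law S \<mu>"
      unfolding bellman_def
      by (rule on_law_eq[OF P]) (simp add: bellman_at_eq[OF _ P am gW vl] opt[OF P] vl[OF P])
    fix \<xi> assume \<xi>: "\<xi> \<in> initial_states S \<mu>"
    show "feedback_control S \<aa> \<xi> \<in> controls S" by (rule fc[OF \<xi>])
    show "gain S (feedback_control S \<aa> \<xi>) \<xi> = value_law S \<mu>" using fg[OF \<xi>] vl[OF P] by simp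
  qed
qed

end

theorem mainTheorem4:
  fixes S :: "('w, 'x::polish_space, 'a::polish_space, 'e, 'e0) mkv_data"
  assumes "cmkv_mdp S"
  shows "\<exists>\<aa> \<in> wass_borel dist \<Otimes>\<^sub>M borel \<Otimes>\<^sub>M unif \<rightarrow>\<^sub>M borel.
           (\<forall>\<mu>\<in>Prob. bellman S (\<lambda>x u. \<aa> (\<mu>, x, u)) (value_law S) \<mu> = value_law S \<mu>) \<and>
           (\<forall>\<mu>\<^sub>0\<in>Prob. \<forall>\<xi>\<^sub>0\<in>initial_states S \<mu>\<^sub>0.
              feedback_control S \<aa> \<xi>\<^sub>0 \<in> controls S \<and>
              gain S (feedback_control S \<aa> \<xi>\<^sub>0) \<xi>\<^sub>0 = value_law S \<mu>\<^sub>0)"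
  by (rule cmkv_mdp.optimal_feedback[OF assms])

end
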